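(* Consider the Gaussian covert communication setting with noncausal CSI at the transmitter described in the context, and define $\gamma^*=\min\{1,\frac{P}{2T}\}$, $T^*=(1-\gamma^* )^2T$, $P^*=T-T^*$, and $\alpha=\frac{P^*}{P^*+1}$. If $$R_K>\frac12\log\Big(1+\frac{(P^*+\alpha T^* )^2}{(P^*+\alpha^2T^* )(P^*+T^*+\sigma^2)-(P^*+\alpha T^* )^2}\Big)-\frac12\log\Big(1+\frac{(P^*+\alpha T^* )^2}{(P^*+\alpha^2T^* )(P^*+T^*+1)-(P^*+\alpha T^* )^2}\Big),$$ then the covert capacity with noncausal CSI is $$C_{\mathrm{nc}}=\frac12\log(1+P^* ).$$
   Context: Gaussian channel with state: at each time $i$, the receiver observes $Y_i=X_i+S_i+N_{Y,i}$ and the warden observes $Z_i=X_i+S_i+N_{Z,i}$, where $X_i\in\mathbb{R}$ is the channel input, $S_i\sim\mathcal{N}(0,T)$ with $T>0$, $N_{Y,i}\sim\mathcal{N}(0,1)$, $N_{Z,i}\sim\mathcal{N}(0,\sigma^2)$ with $\sigma^2>0$, and all of $(S_i),(N_{Y,i}),(N_{Z,i})$ are IID over time and mutually independent, and independent of the message and key. The state is known to the transmitter (causally: $X_i$ depends on $(M,K,S^i)$ and possibly private randomness; noncausally: $X^n$ depends on $(M,K,S^n)$ and possibly private randomness), but not to the receiver or the warden. A secret key $K$ uniform on $[1:2^{nR_K}]$ and message $M$ uniform on $[1:2^{nR}]$ are independent; the decoder maps $(Y^n,K)$ to $\hat M$. The input power constraint is $\limsup_n \mathrm{E}[\frac1n\sum_{i=1}^n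 X_i^2]\leq P$ with $P>0$. The no-input symbol is $0$, so with no transmission the warden sees $Z^n\sim Q_0^{\times n}$ with $Q_0=\mathcal{N}(0,T+\sigma^2)$. A rate $R$ is achievable if there exist codes satisfying the power constraint with $P(\hat M\neq M)\to 0$ and $D(\widehat{P}_{Z^n}\|Q_0^{\times n})\to0$, where $\widehat{P}_{Z^n}$ is the warden's output distribution induced by the code; the covert capacities $C_{\mathrm{c}}$ (causal CSI) and $C_{\mathrm{nc}}$ (noncausal CSI) are the suprema of achievable rates. *)

theory Defs
  imports "HOL-Probability.Probability"
begin

definition vspace :: "nat \<Rightarrow> (nat \<Rightarrow> real) measure" where
  "vspace n = PiM {..<n} (\<lambda>_. borel)"

definition gauss_iid :: "nat \<Rightarrow> real \<Rightarrow> (nat \<Rightarrow> real) measure" where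
  "gauss_iid n v = PiM {..<n} (\<lambda>_. density lborel (\<lambda>x. ennreal (normal_density 0 (sqrt v) x)))"

definition add_noise :: "nat \<Rightarrow> real \<Rightarrow> (nat \<Rightarrow> real) \<Rightarrow> (nat \<Rightarrow> real) measure" where
  "add_noise n v u = distr (gauss_iid n v) (vspace n) (\<lambda>w. \<lambda>i\<in>{..<n}. u i + w i)"

text \<open>Message set [1:2^(nR)] and key set [1:2^(nR_K)] (sizes rounded up).\<close>
definition set_size :: "nat \<Rightarrow> real \<Rightarrow> nat" where
  "set_size n R = nat \<lceil>2 powr (real n * R)\<rceil>"

text \<open>A noncausal code of length n: a stochastic encoder (Markov kernel) mapping
  (m, k, s^n) to a distribution of x^n (private randomness allowed), and a
  decoder mapping (y^n, k) to a message estimate.\<close>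
definition nc_code ::
  "nat \<Rightarrow> (nat \<Rightarrow> nat \<Rightarrow> (nat \<Rightarrow> real) \<Rightarrow> (nat \<Rightarrow> real) measure)
   \<Rightarrow> ((nat \<Rightarrow> real) \<Rightarrow> nat \<Rightarrow> nat) \<Rightarrow> bool" where
  "nc_code n enc dec \<longleftrightarrow>
     (\<forall>m k. enc m k \<in> vspace n \<rightarrow>\<^sub>M prob_algebra (vspace n)) \<and>
     (\<forall>k. (\<lambda>y. dec y k) \<in> vspace n \<rightarrow>\<^sub>M count_space UNIV)"

text \<open>Output distribution (receiver: noise variance 1; warden: noise variance sigma^2)
  given message m and key k: S^n ~ N(0,T)^n, X^n ~ enc m k S^n, output X^n+S^n+N^n.\<close>
definition out_dist ::
  "nat \<Rightarrow> real \<Rightarrow> real \<Rightarrow> (nat \<Rightarrow> nat \<Rightarrow> (nat \<Rightarrow> real) \<Rightarrow> (nat \<Rightarrow> real) measure)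
   \<Rightarrow> nat \<Rightarrow> nat \<Rightarrow> (nat \<Rightarrow> real) measure" where
  "out_dist n T v enc m k =
     bind (gauss_iid n T) (\<lambda>s. bind (enc m k s) (\<lambda>x. add_noise n v (\<lambda>i. x i + s i)))"

definition err_prob ::
  "nat \<Rightarrow> real \<Rightarrow> real \<Rightarrow> real \<Rightarrow> (nat \<Rightarrow> nat \<Rightarrow> (nat \<Rightarrow> real) \<Rightarrow> (nat \<Rightarrow> real) measure)
   \<Rightarrow> ((nat \<Rightarrow> real) \<Rightarrow> nat \<Rightarrow> nat) \<Rightarrow> real" where
  "err_prob n T R RK enc dec =
     (\<Sum>m\<in>{1..set_size n R}. \<Sum>k\<in>{1..set_size n RK}.
        measure (out_dist n T 1 enc m k) {y \<in> space (vspace n). dec y k \<noteq> m})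
     / (real (set_size n R) * real (set_size n RK))"

definition avg_power ::
  "nat \<Rightarrow> real \<Rightarrow> real \<Rightarrow> real \<Rightarrow> (nat \<Rightarrow> nat \<Rightarrow> (nat \<Rightarrow> real) \<Rightarrow> (nat \<Rightarrow> real) measure)
   \<Rightarrow> ennreal" where
  "avg_power n T R RK enc =
     ennreal (1 / (real (set_size n R) * real (set_size n RK))) *
     (\<Sum>m\<in>{1..set_size n R}. \<Sum>k\<in>{1..set_size n RK}.
        \<integral>\<^sup>+ s. \<integral>\<^sup>+ x. ennreal ((\<Sum>i<n. (x i)\<^sup>2) / real n) \<partial>(enc m k s) \<partial>(gauss_iid n T))"

definition warden_dist ::
  "nat \<Rightarrow> real \<Rightarrow> real \<Rightarrow> real \<Rightarrow> real \<Rightarrow> (nat \<Rightarrow> nat \<Rightarrow> (nat \<Rightarrow> real) \<Rightarrow> (nat \<Rightarrow> real) measure)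
   \<Rightarrow> (nat \<Rightarrow> real) measure" where
  "warden_dist n T \<sigma>2 R RK enc =
     bind (measure_pmf (pmf_of_set ({1..set_size n R} \<times> {1..set_size n RK})))
          (\<lambda>(m, k). out_dist n T \<sigma>2 enc m k)"

definition rel_entropy :: "'a measure \<Rightarrow> 'a measure \<Rightarrow> ereal" where
  "rel_entropy P Q =
     (if absolutely_continuous Q P \<and> sets P = sets Q \<and>
         integrable P (entropy_density (exp 1) Q P)
      then ereal (KL_divergence (exp 1) Q P) else \<infinity>)"

definition nc_achievable :: "real \<Rightarrow> real \<Rightarrow> real \<Rightarrow> real \<Rightarrow> real \<Rightarrow> bool" where
  "nc_achievable T \<sigma>2 P RK R \<longleftrightarrow>
     (\<exists>enc dec. (\<forall>n. nc_code n (enc n) (dec n)) \<and>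
        limsup (\<lambda>n. avg_power n T R RK (enc n)) \<le> ennreal P \<and>
        (\<lambda>n. err_prob n T R RK (enc n) (dec n)) \<longlonglongrightarrow> 0 \<and>
        (\<lambda>n. rel_entropy (warden_dist n T \<sigma>2 R RK (enc n)) (gauss_iid n (T + \<sigma>2)))
          \<longlonglongrightarrow> 0)"

definition covert_capacity_nc :: "real \<Rightarrow> real \<Rightarrow> real \<Rightarrow> real \<Rightarrow> ereal" where
  "covert_capacity_nc T \<sigma>2 P RK = (SUP R \<in> {R. nc_achievable T \<sigma>2 P RK R}. ereal R)"

end

theory Submission
  imports Defs "HOL-Real_Asymp.Real_Asymp"
begin

text \<open>Achievability: dirty-paper coding with random binning, where the auxiliary codewords are Gaussian vectors.
  Given the state, the encoder draws an index of the bin with probability proportional to the likelihood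
  ratio of the state for that codeword, and sends 0 with a small leftover probability. The warden's output
  density is then dominated by that of an ideal soft covering code plus a part of the density without
  transmission, so it suffices to bound divergences of soft coverings. Averaged over codebooks of size
  \<open>N\<close>, such a divergence is at most the mean of \<open>\<rho> ln (1 + \<rho> / N)\<close>, which a Gaussian moment bound makes
  exponentially small.

  Converse: comparing the receiver's output with a fixed Gaussian law bounds the rate by the energy of
  \<open>X + g S\<close>. This energy is a convex combination, up to a constant, of those of \<open>X\<close> and \<open>X + S\<close>; the
  first is controlled by the power constraint, the second is forced by covertness to be about \<open>n T\<close>.\<close>

section \<open>Gaussian likelihood ratios\<close>

text \<open>The parameters come from one picture: the input is \<open>X' - g * S\<close> with
  \<open>X'\<close> Gaussian and independent of the state \<open>S\<close>. Input plus state must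
  keep the variance \<open>T\<close>, so \<open>X'\<close> has variance
  \<open>p = T - (1 - g)\<^sup>2 * T\<close> and the power is
  \<open>p + g\<^sup>2 * T = 2 * g * T\<close>. The power constraint allows \<open>g\<close> up to
  \<open>P / (2 * T)\<close>, and \<open>p\<close> is largest at \<open>g = 1\<close>; this is the
  \<gamma> of the theorem. Dirty-paper coding handles the remaining interference
  \<open>(1 - g) * S\<close>. The key supplies the codeword randomness that the warden's output
  needs beyond what the receiver can decode, hence the difference of two mutual informations.

  The obstacle is that the divergence of the whole block must vanish, not its average per letter,
  and closeness in total variation does not give that. Hence laws are kept as explicit densities,
  and the actual density is compared pointwise with an ideal one.\<close>

definition gm :: "real \<Rightarrow> real \<Rightarrow> real measure" where
  "gm v a = density lborel (\<lambda>x. ennreal (normal_density a (sqrt v) x))"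

text \<open>Laws are described by ratios to one fixed centred Gaussian: mixtures over codewords
  become plain averages, and divergences become integrals of functions of such averages.
  \<open>v\<close> and \<open>w\<close> are variances.\<close>

definition lr :: "real \<Rightarrow> real \<Rightarrow> real \<Rightarrow> real \<Rightarrow> real" where
  "lr v w a z = normal_density a (sqrt v) z / normal_density 0 (sqrt w) z"

definition LR :: "nat \<Rightarrow> real \<Rightarrow> real \<Rightarrow> (nat \<Rightarrow> real) \<Rightarrow> (nat \<Rightarrow> real) \<Rightarrow> real" where
  "LR n v w a z = (\<Prod>i<n. lr v w (a i) (z i))"

lemma sets_gm[measurable_cong, simp]: "sets (gm v a) = sets borel"
  by (simp add: gm_def)

lemma space_gm[simp]: "space (gm v a) = UNIV"
  by (simp add: gm_def)

lemma prob_space_gm: "v > 0 \<Longrightarrow> prob_space (gm v a)"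
  unfolding gm_def by (rule prob_space_normal_density) simp

lemma lr_pos: "v > 0 \<Longrightarrow> w > 0 \<Longrightarrow> lr v w a z > 0"
  by (simp add: lr_def normal_density_pos)

lemma LR_pos: "v > 0 \<Longrightarrow> w > 0 \<Longrightarrow> LR n v w a z > 0"
  by (simp add: LR_def prod_pos lr_pos)

lemma normal_density_measurable[measurable (raw)]:
  assumes [measurable]: "f \<in> borel_measurable M" "g \<in> borel_measurable M"
  shows "(\<lambda>x. normal_density (f x) c (g x)) \<in> borel_measurable M"
  unfolding normal_density_def by measurable

lemma lr_measurable[measurable (raw)]:
  assumes [measurable]: "f \<in> borel_measurable M" "g \<in> borel_measurable M"
  shows "(\<lambda>x. lr v w (f x) (g x)) \<in> borel_measurable M"
  unfolding lr_def by measurable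

lemma LR_measurable[measurable (raw)]:
  assumes "\<And>i. i < n \<Longrightarrow> (\<lambda>x. f x i) \<in> borel_measurable M"
    "\<And>i. i < n \<Longrightarrow> (\<lambda>x. g x i) \<in> borel_measurable M"
  shows "(\<lambda>x. LR n v w (f x) (g x)) \<in> borel_measurable M"
  unfolding LR_def using assms by (intro borel_measurable_prod lr_measurable) auto

lemma normal_density_exp:
  assumes "v > 0"
  shows "normal_density a (sqrt v) x = exp (- (x - a)\<^sup>2 / (2 * v) - ln (2 * pi * v) / 2)"
proof -
  have "1 / sqrt (2 * pi * v) = exp (- ln (2 * pi * v) / 2)"
    using assms by (simp add: exp_minus ln_sqrt[symmetric] field_simps flip: ln_sqrt)
  then have "normal_density a (sqrt v) x = exp (- ln (2 * pi * v) / 2) * exp (- (x - a)\<^sup>2 / (2 * v))"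
    using assms by (simp add: normal_density_def)
  then show ?thesis by (simp flip: exp_add)
qed

text \<open>Completing the square leaves a normal density with mean \<open>b / (2 * a)\<close> and
  variance \<open>1 / (2 * a)\<close>. The convolution and moment formulas below are both reduced to
  it.\<close>

lemma nn_integral_exp_quadratic:
  assumes "a > 0"
  shows "(\<integral>\<^sup>+x. ennreal (exp (- a * x\<^sup>2 + b * x + c)) \<partial>lborel)
    = ennreal (exp (b\<^sup>2 / (4 * a) + c + ln (pi / a) / 2))"
proof -
  define k where "k = exp (b\<^sup>2 / (4 * a) + c + ln (pi / a) / 2)"
  have "exp (- a * x\<^sup>2 + b * x + c) = k * normal_density (b / (2 * a)) (sqrt (1 / (2 * a))) x" for x
  proof -
    have "2 * pi * (1 / (2 * a)) = pi / a" by simp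
    moreover have "- a * x\<^sup>2 + b * x + c
      = b\<^sup>2 / (4 * a) + c + - (x - b / (2 * a))\<^sup>2 / (2 * (1 / (2 * a)))"
      using assms by (simp add: field_simps power2_eq_square)
    ultimately show ?thesis
      using assms by (simp add: normal_density_exp k_def flip: exp_add)
  qed
  then have "(\<integral>\<^sup>+x. ennreal (exp (- a * x\<^sup>2 + b * x + c)) \<partial>lborel)
    = (\<integral>\<^sup>+x. ennreal k * ennreal (normal_density (b / (2 * a)) (sqrt (1 / (2 * a))) x) \<partial>lborel)"
    by (simp add: ennreal_mult k_def)
  also have "\<dots> = ennreal k"
    using assms by (simp add: nn_integral_cmult nn_integral_eq_integral)
  finally show ?thesis by (simp add: k_def)
qed

lemma normal_convolution:
  assumes "a > 0" "b > 0"
  shows "(\<integral>\<^sup>+s. ennreal (normal_density m (sqrt a) s) * ennreal (normal_density (e + d * s) (sqrt b) z) \<partial>lborel)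
    = ennreal (normal_density (e + d * m) (sqrt (b + d\<^sup>2 * a)) z)"
proof -
  \<comment> \<open>Coefficients of the exponent as a polynomial in the integration variable
    \<open>s\<close>.\<close>
  define A where "A = 1 / (2 * a) + d\<^sup>2 / (2 * b)"
  define B where "B = m / a + d * (z - e) / b"
  define C where "C = - m\<^sup>2 / (2 * a) - (z - e)\<^sup>2 / (2 * b) - ln (2 * pi * a) / 2 - ln (2 * pi * b) / 2"
  have A: "A > 0" using assms by (simp add: A_def add_pos_nonneg)
  have ab: "b + d\<^sup>2 * a > 0" using assms by (simp add: add_pos_nonneg)
  have eA: "A = (b + d\<^sup>2 * a) / (2 * a * b)" using assms by (simp add: A_def field_simps)
  have "(\<integral>\<^sup>+s. ennreal (normal_density m (sqrt a) s) * ennreal (normal_density (e + d * s) (sqrt b) z) \<partial>lborel)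
    = (\<integral>\<^sup>+s. ennreal (exp (- A * s\<^sup>2 + B * s + C)) \<partial>lborel)"
  proof (intro nn_integral_cong, goal_cases)
    case (1 s)
    have "(- (s - m)\<^sup>2 / (2 * a) - ln (2 * pi * a) / 2) + (- (z - (e + d * s))\<^sup>2 / (2 * b) - ln (2 * pi * b) / 2)
      = - A * s\<^sup>2 + B * s + C"
      using assms by (simp add: A_def B_def C_def field_simps power2_eq_square)
    then show ?case
      using assms by (simp add: normal_density_exp ennreal_mult[symmetric] flip: exp_add)
  qed
  also have "\<dots> = ennreal (exp (B\<^sup>2 / (4 * A) + C + ln (pi / A) / 2))"
    by (rule nn_integral_exp_quadratic[OF A])
  also have "B\<^sup>2 / (4 * A) + C + ln (pi / A) / 2
     = - (z - (e + d * m))\<^sup>2 / (2 * (b + d\<^sup>2 * a)) - ln (2 * pi * (b + d\<^sup>2 * a)) / 2"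
  proof -
    have "ln (pi / A) = ln (2 * pi * a) + ln (2 * pi * b) - ln (2 * pi * (b + d\<^sup>2 * a))"
      using assms ab by (simp add: eA ln_mult ln_div)
    moreover have "B\<^sup>2 / (4 * A) - m\<^sup>2 / (2 * a) - (z - e)\<^sup>2 / (2 * b) = - (z - (e + d * m))\<^sup>2 / (2 * (b + d\<^sup>2 * a))"
    proof -
      have B: "B = (m * b + d * (z - e) * a) / (a * b)" using assms by (simp add: B_def field_simps)
      have frac: "(N / (a * b))\<^sup>2 / (4 * (q / (2 * a * b))) = N\<^sup>2 / (2 * a * b * q)" if "q > 0" for N q :: real
        using assms that by (simp add: field_simps power2_eq_square)
      have "B\<^sup>2 / (4 * A) = (m * b + d * (z - e) * a)\<^sup>2 / (2 * a * b * (b + d\<^sup>2 * a))"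
        unfolding B eA by (rule frac[OF ab])
      also have "\<dots> - m\<^sup>2 / (2 * a) - (z - e)\<^sup>2 / (2 * b) =
         ((m * b + d * (z - e) * a)\<^sup>2 - m\<^sup>2 * b * (b + d\<^sup>2 * a) - (z - e)\<^sup>2 * a * (b + d\<^sup>2 * a)) / (2 * a * b * (b + d\<^sup>2 * a))"
        using assms ab by (simp add: diff_divide_distrib)
      also have "(m * b + d * (z - e) * a)\<^sup>2 - m\<^sup>2 * b * (b + d\<^sup>2 * a) - (z - e)\<^sup>2 * a * (b + d\<^sup>2 * a)
        = a * b * (- (z - (e + d * m))\<^sup>2)"
        by (simp add: algebra_simps power2_eq_square)
      also have "a * b * (- (z - (e + d * m))\<^sup>2) / (2 * a * b * (b + d\<^sup>2 * a)) = - (z - (e + d * m))\<^sup>2 / (2 * (b + d\<^sup>2 * a))"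
        using assms by simp
      finally show ?thesis .
    qed
    ultimately show ?thesis by (simp add: C_def field_simps)
  qed
  finally show ?thesis using ab by (simp add: normal_density_exp)
qed

lemma nn_integral_gm:
  "f \<in> borel_measurable borel \<Longrightarrow> (\<integral>\<^sup>+x. f x \<partial>gm v a) = (\<integral>\<^sup>+x. ennreal (normal_density a (sqrt v) x) * f x \<partial>lborel)"
  unfolding gm_def by (subst nn_integral_density) auto

text \<open>Convolution in ratio form: a Gaussian state with mean \<open>m\<close> and variance
  \<open>vS\<close>, mapped to \<open>e + d * s\<close> and disturbed by noise, is again Gaussian.
  In the coding scheme this is the state conditioned on a codeword, and \<open>e + d * s\<close> is
  input plus state.\<close>

lemma lr_conv:
  assumes "w > 0" "vS > 0" "v > 0" "w' > 0"
  shows "(\<integral>\<^sup>+s. ennreal (lr vS w m s) * ennreal (lr v w' (e + d * s) z) \<partial>gm w 0)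
    = ennreal (lr (v + d\<^sup>2 * vS) w' (e + d * m) z)"
proof -
  have "(\<integral>\<^sup>+s. ennreal (lr vS w m s) * ennreal (lr v w' (e + d * s) z) \<partial>gm w 0)
    = (\<integral>\<^sup>+s. ennreal (1 / normal_density 0 (sqrt w') z) * (ennreal (normal_density m (sqrt vS) s) * ennreal (normal_density (e + d * s) (sqrt v) z)) \<partial>lborel)"
  proof (subst nn_integral_gm, measurable, intro nn_integral_cong, goal_cases)
    case (1 s)
    have "normal_density 0 (sqrt w) s > 0" using assms by (simp add: normal_density_pos)
    then show ?case by (simp add: lr_def ennreal_mult[symmetric])
  qed
  also have "\<dots> = ennreal (1 / normal_density 0 (sqrt w') z) * ennreal (normal_density (e + d * m) (sqrt (v + d\<^sup>2 * vS)) z)"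
    using assms by (simp add: nn_integral_cmult normal_convolution)
  finally show ?thesis by (simp add: lr_def ennreal_mult[symmetric])
qed

lemma density_gm_lr:
  assumes "v > 0" "w > 0"
  shows "density (gm w 0) (\<lambda>z. ennreal (lr v w a z)) = gm v a"
proof -
  have "normal_density 0 (sqrt w) z > 0" for z using assms by (simp add: normal_density_pos)
  then have "normal_density 0 (sqrt w) z * lr v w a z = normal_density a (sqrt v) z" for z
    by (simp add: lr_def less_imp_neq[symmetric])
  then show ?thesis
    unfolding gm_def by (subst density_density_eq) (simp_all flip: ennreal_mult')
qed

lemma distr_gm_shift: "distr (gm v 0) borel (\<lambda>x. a + x) = gm v a"
proof -
  have "distr (gm v 0) borel ((+) a) = density (distr lborel borel ((+) a)) (\<lambda>x. ennreal (normal_density a (sqrt v) x))"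
    unfolding gm_def by (subst density_distr) (auto simp: normal_density_def)
  then show ?thesis by (simp add: gm_def lborel_distr_plus)
qed

lemma second_moment_gm:
  assumes "v > 0"
  shows "(\<integral>\<^sup>+x. ennreal ((x - e)\<^sup>2) \<partial>gm v a) = ennreal ((a - e)\<^sup>2 + v)"
proof -
  let ?n = "normal_density a (sqrt v)"
  have 0: "has_bochner_integral lborel ?n 1"
    using assms by (simp add: has_bochner_integral_iff)
  have 1: "has_bochner_integral lborel (\<lambda>x. ?n x * (x - a)) 0"
    using normal_moment_odd[of "sqrt v" a 0] assms by simp
  have 2: "has_bochner_integral lborel (\<lambda>x. ?n x * (x - a)\<^sup>2) v"
    using normal_moment_even[of "sqrt v" a 1] assms by (simp add: fact_2)
  have "has_bochner_integral lborel (\<lambda>x. ?n x * (x - a)\<^sup>2 + (2 * (a - e) * (?n x * (x - a)) + (a - e)\<^sup>2 * ?n x))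
    (v + (2 * (a - e) * 0 + (a - e)\<^sup>2 * 1))"
    by (intro has_bochner_integral_add has_bochner_integral_mult_right 0 1 2)
  moreover have "?n x * (x - a)\<^sup>2 + (2 * (a - e) * (?n x * (x - a)) + (a - e)\<^sup>2 * ?n x) = ?n x * (x - e)\<^sup>2" for x
    by (simp add: algebra_simps power2_eq_square)
  ultimately have "has_bochner_integral lborel (\<lambda>x. ?n x * (x - e)\<^sup>2) ((a - e)\<^sup>2 + v)"
    by (simp add: add.commute)
  then have "(\<integral>\<^sup>+x. ennreal (?n x * (x - e)\<^sup>2) \<partial>lborel) = ennreal ((a - e)\<^sup>2 + v)"
    by (subst nn_integral_eq_integral) (auto simp: has_bochner_integral_iff)
  then show ?thesis
    by (subst nn_integral_gm) (auto simp: ennreal_mult)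
qed

lemma lr_exp:
  assumes "v > 0" "w > 0"
  shows "lr v w a z = exp (- (z - a)\<^sup>2 / (2 * v) + z\<^sup>2 / (2 * w) + ln (w / v) / 2)"
  using assms by (simp add: lr_def normal_density_exp ln_mult ln_div diff_divide_distrib add_divide_distrib algebra_simps flip: exp_diff)

text \<open>\<open>1 - v / w\<close> is the squared correlation between codeword letter and output,
  and \<open>ln (w / v) / 2\<close> is their mutual information, which is the slope of the exponent
  at \<open>t = 0\<close>. Positive \<open>t\<close> serves soft covering, negative \<open>t\<close>
  decoding.\<close>

lemma lr_moment:
  fixes t \<beta> :: real
  assumes V: "V > 0" and v: "v > 0" and t: "\<bar>t\<bar> < 1"
  defines "w \<equiv> v + \<beta>\<^sup>2 * V"
  shows "(\<integral>\<^sup>+z. (\<integral>\<^sup>+u. ennreal (lr v w (\<beta> * u) z powr (1 + t)) \<partial>gm V 0) \<partial>gm w 0)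
    = ennreal (exp (t * (ln (w / v) / 2) - ln (1 - t\<^sup>2 * (1 - v / w)) / 2))"
proof -
  have w: "w > 0" using V v by (simp add: w_def add_pos_nonneg)
  have vw: "v \<le> w" using V by (simp add: w_def)
  \<comment> \<open>Numerator of \<open>1 / (2 * V) + (1 + t) * \<beta>\<^sup>2 / (2 * v)\<close>,
    the coefficient of \<open>- u\<^sup>2\<close>, over the denominator
    \<open>2 * V * v\<close>.\<close>
  define q where "q = v + (1 + t) * (\<beta>\<^sup>2 * V)"
  have q: "q > 0" using V v t by (auto simp: q_def intro!: add_pos_nonneg mult_nonneg_nonneg)
  define A where "A = q / (2 * V * v)"
  have A: "A > 0" using V v q by (simp add: A_def)
  have "t\<^sup>2 < 1" using t by (simp add: abs_square_less_1)
  moreover have "0 \<le> 1 - v / w" "1 - v / w < 1" using vw v w by simp_all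
  ultimately have k: "1 - t\<^sup>2 * (1 - v / w) > 0"
    by (smt (verit) mult_left_le zero_le_power2)
  \<comment> \<open>Coefficient of \<open>- z\<^sup>2\<close> once \<open>u\<close> has been
    integrated out; it is positive because \<open>\<bar>t\<bar> < 1\<close>.\<close>
  define B where "B = (1 - t\<^sup>2 * (1 - v / w)) / (2 * q)"
  have B: "B > 0" using k q by (simp add: B_def)
  define C where "C = (1 + t) * ln (w / v) / 2 - ln (2 * pi * V) / 2"
  have inner_int: "(\<integral>\<^sup>+u. ennreal (lr v w (\<beta> * u) z powr (1 + t)) \<partial>gm V 0) =
     ennreal (exp (((1 + t) * \<beta> * z / v)\<^sup>2 / (4 * A) + (C - (1 + t) * (z\<^sup>2 / (2 * v) - z\<^sup>2 / (2 * w))) + ln (pi / A) / 2))" for z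
  proof -
    have "ennreal (normal_density 0 (sqrt V) u) * ennreal (lr v w (\<beta> * u) z powr (1 + t))
      = ennreal (exp (- A * u\<^sup>2 + ((1 + t) * \<beta> * z / v) * u + (C - (1 + t) * (z\<^sup>2 / (2 * v) - z\<^sup>2 / (2 * w)))))" for u
    proof -
      have e: "normal_density 0 (sqrt V) u * (lr v w (\<beta> * u) z powr (1 + t)) =
         exp ((- (u - 0)\<^sup>2 / (2 * V) - ln (2 * pi * V) / 2) + (- (z - \<beta> * u)\<^sup>2 / (2 * v) + z\<^sup>2 / (2 * w) + ln (w / v) / 2) * (1 + t))"
        unfolding lr_exp[OF v w] normal_density_exp[OF V] exp_powr_real by (rule exp_add[symmetric])
      have "(- (u - 0)\<^sup>2 / (2 * V) - ln (2 * pi * V) / 2) + (- (z - \<beta> * u)\<^sup>2 / (2 * v) + z\<^sup>2 / (2 * w) + ln (w / v) / 2) * (1 + t)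
        = - A * u\<^sup>2 + ((1 + t) * \<beta> * z / v) * u + (C - (1 + t) * (z\<^sup>2 / (2 * v) - z\<^sup>2 / (2 * w)))"
        using V v w by (simp add: C_def A_def q_def field_simps power2_eq_square)
      then show ?thesis
        using e by (simp add: ennreal_mult[symmetric])
    qed
    note inner = this
    show ?thesis
      by (subst nn_integral_gm, measurable) (simp only: inner nn_integral_exp_quadratic[OF A])
  qed
  have quad: "((1 + t) * \<beta> * z / v)\<^sup>2 / (4 * A) - (1 + t) * (z\<^sup>2 / (2 * v) - z\<^sup>2 / (2 * w)) - z\<^sup>2 / (2 * w)
     = - B * z\<^sup>2" for z
  proof -
    have "((1 + t) * \<beta> * z / v)\<^sup>2 / (4 * A) = (1 + t)\<^sup>2 * (\<beta>\<^sup>2 * V) * z\<^sup>2 / (2 * v * q)"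
      using V v q by (simp add: A_def field_simps power2_eq_square)
    also have "\<dots> = (1 + t) * (q - v) * z\<^sup>2 / (2 * v * q)"
      by (simp add: q_def algebra_simps power2_eq_square)
    finally have X: "((1 + t) * \<beta> * z / v)\<^sup>2 / (4 * A) = (1 + t) * (q - v) * z\<^sup>2 / (2 * v * q)" .
    have 1: "((1 + t) * \<beta> * z / v)\<^sup>2 / (4 * A) - (1 + t) * (z\<^sup>2 / (2 * v) - z\<^sup>2 / (2 * w)) - z\<^sup>2 / (2 * w)
       = - (((1 + t) * w - t * q) / (2 * q * w)) * z\<^sup>2"
      unfolding X using v q w by (simp add: field_simps power2_eq_square)
    have qw: "q = v + (1 + t) * (w - v)" by (simp add: q_def w_def)
    have "((1 + t) * w - t * q) = w - t\<^sup>2 * (w - v)"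
      unfolding qw by (simp add: algebra_simps power2_eq_square)
    also have "\<dots> / (2 * q * w) = B" using w q by (simp add: B_def field_simps)
    finally show ?thesis using 1 by simp
  qed
  have "(\<integral>\<^sup>+z. (\<integral>\<^sup>+u. ennreal (lr v w (\<beta> * u) z powr (1 + t)) \<partial>gm V 0) \<partial>gm w 0)
    = (\<integral>\<^sup>+z. ennreal (exp (- B * z\<^sup>2 + 0 * z + (C + ln (pi / A) / 2 - ln (2 * pi * w) / 2))) \<partial>lborel)"
    unfolding inner_int
  proof (subst nn_integral_gm, measurable, intro nn_integral_cong, goal_cases)
    case (1 z)
    have "(- (z - 0)\<^sup>2 / (2 * w) - ln (2 * pi * w) / 2) + (((1 + t) * \<beta> * z / v)\<^sup>2 / (4 * A) + (C - (1 + t) * (z\<^sup>2 / (2 * v) - z\<^sup>2 / (2 * w))) + ln (pi / A) / 2)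
      = - B * z\<^sup>2 + 0 * z + (C + ln (pi / A) / 2 - ln (2 * pi * w) / 2)"
      using quad[of z] by simp
    then show ?case using w by (simp add: normal_density_exp ennreal_mult[symmetric] flip: exp_add)
  qed
  also have "\<dots> = ennreal (exp (0\<^sup>2 / (4 * B) + (C + ln (pi / A) / 2 - ln (2 * pi * w) / 2) + ln (pi / B) / 2))"
    by (rule nn_integral_exp_quadratic[OF B])
  also have "0\<^sup>2 / (4 * B) + (C + ln (pi / A) / 2 - ln (2 * pi * w) / 2) + ln (pi / B) / 2
    = t * (ln (w / v) / 2) - ln (1 - t\<^sup>2 * (1 - v / w)) / 2"
    using V v w q k by (simp add: C_def A_def B_def ln_mult ln_div field_simps)
  finally show ?thesis .
qed

section \<open>Product Gaussian measures and block likelihood ratios\<close>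

lemma product_prob_space_const: "prob_space M \<Longrightarrow> product_prob_space (\<lambda>_. M)"
  by (simp add: product_prob_space_def product_prob_space_axioms_def product_sigma_finite_def prob_space_imp_sigma_finite)

lemma measurable_gm1[simp]: "measurable (gm v a) N = measurable borel N"
  by (rule measurable_cong_sets) auto

lemma measurable_gm2[simp]: "measurable N (gm v a) = measurable N borel"
  by (rule measurable_cong_sets) auto

lemma gauss_iid_eq_PiM: "gauss_iid n v = PiM {..<n} (\<lambda>_. gm v 0)"
  by (simp add: gauss_iid_def gm_def)

lemma sets_vspace_PiM: "(\<And>i. sets (M i) = sets borel) \<Longrightarrow> sets (PiM {..<n} M) = sets (vspace n)"
  unfolding vspace_def by (rule sets_PiM_cong) auto

lemma sets_gauss_iid[measurable_cong, simp]: "sets (gauss_iid n v) = sets (vspace n)"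
  unfolding gauss_iid_eq_PiM by (rule sets_vspace_PiM) simp

lemma space_gauss_iid[simp]: "space (gauss_iid n v) = space (vspace n)"
  by (rule sets_eq_imp_space_eq) simp

lemma measurable_gauss_iid1[simp]: "measurable (gauss_iid n v) N = measurable (vspace n) N"
  by (rule measurable_cong_sets) auto

lemma prob_space_gauss_iid: "v > 0 \<Longrightarrow> prob_space (gauss_iid n v)"
  unfolding gauss_iid_eq_PiM by (intro prob_space_PiM prob_space_gm)

lemma product_gm: "(\<And>i. v i > 0) \<Longrightarrow> product_prob_space (\<lambda>i. gm (v i) (a i))"
  by (simp add: product_prob_space_def product_prob_space_axioms_def product_sigma_finite_def
    prob_space_imp_sigma_finite prob_space_gm)

lemma vspace_component: "i < n \<Longrightarrow> (\<lambda>z. z i) \<in> borel_measurable (vspace n)"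
  unfolding vspace_def by measurable

lemma vspace_nth:
  "f \<in> M \<rightarrow>\<^sub>M vspace n \<Longrightarrow> i < n \<Longrightarrow> (\<lambda>x. f x i) \<in> borel_measurable M"
  by (rule measurable_compose[OF _ vspace_component])

lemma LR_vspace_measurable[measurable]: "(\<lambda>z. LR n v w a z) \<in> borel_measurable (vspace n)"
  by (intro LR_measurable borel_measurable_const vspace_component)

lemma vspace_restrict_measurable:
  assumes "\<And>i. i < n \<Longrightarrow> (\<lambda>x. f x i) \<in> borel_measurable M"
  shows "(\<lambda>x. \<lambda>i\<in>{..<n}. f x i) \<in> M \<rightarrow>\<^sub>M vspace n"
  unfolding vspace_def using assms by (intro measurable_restrict) auto

lemma space_vspace_nonempty[simp]: "space (vspace n) \<noteq> {}"
  by (auto simp: vspace_def space_PiM PiE_eq_empty_iff)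

lemma nn_integral_gauss_prod:
  assumes "v > 0" "\<And>i. i < n \<Longrightarrow> f i \<in> borel_measurable borel"
  shows "(\<integral>\<^sup>+z. (\<Prod>i<n. f i (z i)) \<partial>gauss_iid n v) = (\<Prod>i<n. \<integral>\<^sup>+x. f i x \<partial>gm v 0)"
proof -
  interpret product_prob_space "\<lambda>_. gm v 0" by (rule product_gm) (use assms in auto)
  show ?thesis unfolding gauss_iid_eq_PiM
    by (rule product_nn_integral_prod) (use assms in auto)
qed

text \<open>Product measures are determined by their values on rectangles, where the integral
  factors over coordinates.\<close>

lemma density_gauss_LR:
  assumes "v > 0" "w > 0"
  shows "density (gauss_iid n w) (\<lambda>z. ennreal (LR n v w a z)) = PiM {..<n} (\<lambda>i. gm v (a i))"
proof -
  interpret P: product_prob_space "\<lambda>i. gm v (a i)" by (rule product_gm) (use assms in auto)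
  show ?thesis
  proof (rule P.PiM_eqI)
    show "sets (density (gauss_iid n w) (\<lambda>z. ennreal (LR n v w a z))) = sets (PiM {..<n} (\<lambda>i. gm v (a i)))"
      by (simp add: sets_vspace_PiM)
    fix A assume A: "\<And>i. i \<in> {..<n} \<Longrightarrow> A i \<in> sets (gm v (a i))"
    have [measurable]: "Pi\<^sub>E {..<n} A \<in> sets (vspace n)"
      unfolding vspace_def using A by (intro sets_PiM_I_finite) auto
    have "emeasure (density (gauss_iid n w) (\<lambda>z. ennreal (LR n v w a z))) (Pi\<^sub>E {..<n} A)
      = (\<integral>\<^sup>+z. ennreal (LR n v w a z) * indicator (Pi\<^sub>E {..<n} A) z \<partial>gauss_iid n w)"
      by (subst emeasure_density) auto
    also have "\<dots> = (\<integral>\<^sup>+z. (\<Prod>i<n. ennreal (lr v w (a i) (z i)) * indicator (A i) (z i)) \<partial>gauss_iid n w)"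
    proof (intro nn_integral_cong)
      fix z assume "z \<in> space (gauss_iid n w)"
      then have "z \<in> extensional {..<n}" by (auto simp: vspace_def space_PiM PiE_def)
      then have "indicator (Pi\<^sub>E {..<n} A) z = (\<Prod>i<n. indicator (A i) (z i) :: ennreal)"
        by (auto simp: indicator_def PiE_def Pi_def prod_zero_iff)
      then show "ennreal (LR n v w a z) * indicator (Pi\<^sub>E {..<n} A) z = (\<Prod>i<n. ennreal (lr v w (a i) (z i)) * indicator (A i) (z i))"
        using assms by (simp add: LR_def prod.distrib prod_ennreal less_imp_le[OF lr_pos])
    qed
    also have "\<dots> = (\<Prod>i<n. \<integral>\<^sup>+x. ennreal (lr v w (a i) x) * indicator (A i) x \<partial>gm w 0)"
      using assms A by (intro nn_integral_gauss_prod) auto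
    also have "\<dots> = (\<Prod>i\<in>{..<n}. emeasure (gm v (a i)) (A i))"
      using A by (intro prod.cong refl) (simp add: density_gm_lr[OF assms, symmetric], subst emeasure_density, auto)
    finally show "emeasure (density (gauss_iid n w) (\<lambda>z. ennreal (LR n v w a z))) (Pi\<^sub>E {..<n} A) = (\<Prod>i\<in>{..<n}. emeasure (gm v (a i)) (A i))" .
  qed simp
qed

lemma add_noise_measurable: "(\<lambda>w. \<lambda>i\<in>{..<n}. u i + w i) \<in> vspace n \<rightarrow>\<^sub>M vspace n"
  by (intro vspace_restrict_measurable borel_measurable_add borel_measurable_const vspace_component)

text \<open>Shifting the coordinates of an i.i.d. vector keeps them independent; as a product of
  shifted normal laws the noise kernel fits the product formulas.\<close>

lemma add_noise_eq_PiM: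
  assumes "v > 0"
  shows "add_noise n v u = PiM {..<n} (\<lambda>i. gm v (u i))"
proof -
  interpret P: product_prob_space "\<lambda>i. gm v (u i)" by (rule product_gm) (use assms in auto)
  interpret Q: product_prob_space "\<lambda>i. gm v 0" by (rule product_gm) (use assms in auto)
  have m: "(\<lambda>w. \<lambda>i\<in>{..<n}. u i + w i) \<in> gauss_iid n v \<rightarrow>\<^sub>M vspace n"
    using add_noise_measurable by (simp add: measurable_cong_sets[OF sets_gauss_iid refl])
  show ?thesis unfolding add_noise_def
  proof (rule P.PiM_eqI)
    show "sets (distr (gauss_iid n v) (vspace n) (\<lambda>w. \<lambda>i\<in>{..<n}. u i + w i)) = sets (PiM {..<n} (\<lambda>i. gm v (u i)))"
      by (simp add: sets_vspace_PiM)
    fix A assume A: "\<And>i. i \<in> {..<n} \<Longrightarrow> A i \<in> sets (gm v (u i))"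
    have "Pi\<^sub>E {..<n} A \<in> sets (vspace n)"
      unfolding vspace_def using A by (intro sets_PiM_I_finite) auto
    then have "emeasure (distr (gauss_iid n v) (vspace n) (\<lambda>w. \<lambda>i\<in>{..<n}. u i + w i)) (Pi\<^sub>E {..<n} A)
       = emeasure (gauss_iid n v) ((\<lambda>w. \<lambda>i\<in>{..<n}. u i + w i) -` Pi\<^sub>E {..<n} A \<inter> space (gauss_iid n v))"
      by (intro emeasure_distr m)
    also have "(\<lambda>w. \<lambda>i\<in>{..<n}. u i + w i) -` Pi\<^sub>E {..<n} A \<inter> space (gauss_iid n v) =
       Pi\<^sub>E {..<n} (\<lambda>i. (\<lambda>x. u i + x) -` A i)"
      by (auto simp: vspace_def space_PiM PiE_def Pi_def extensional_def)
    also have "emeasure (gauss_iid n v) \<dots> = (\<Prod>i<n. emeasure (gm v 0) ((\<lambda>x. u i + x) -` A i))"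
      unfolding gauss_iid_eq_PiM using A measurable_sets_borel[of "\<lambda>x. u i + x" for i]
      by (intro Q.emeasure_PiM) (auto intro!: measurable_sets_borel)
    also have "\<dots> = (\<Prod>i<n. emeasure (gm v (u i)) (A i))"
    proof (intro prod.cong refl)
      fix i assume "i \<in> {..<n}"
      then have "emeasure (distr (gm v 0) borel (\<lambda>x. u i + x)) (A i) = emeasure (gm v 0) ((\<lambda>x. u i + x) -` A i)"
        using A by (subst emeasure_distr) auto
      then show "emeasure (gm v 0) ((\<lambda>x. u i + x) -` A i) = emeasure (gm v (u i)) (A i)"
        by (simp only: distr_gm_shift)
    qed
    finally show "emeasure (distr (gauss_iid n v) (vspace n) (\<lambda>w. \<lambda>i\<in>{..<n}. u i + w i)) (Pi\<^sub>E {..<n} A) = (\<Prod>i\<in>{..<n}. emeasure (gm v (u i)) (A i))" .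
  qed simp
qed

text \<open>The reference variance \<open>w\<close> is free here; later it is set to that of the
  state, of the output, or of a comparison law.\<close>

lemma add_noise_density:
  "v > 0 \<Longrightarrow> w > 0 \<Longrightarrow> add_noise n v u = density (gauss_iid n w) (\<lambda>z. ennreal (LR n v w u z))"
  by (simp add: add_noise_eq_PiM density_gauss_LR)

lemma add_noise_zero: "v > 0 \<Longrightarrow> add_noise n v (\<lambda>_. 0) = gauss_iid n v"
  by (simp add: add_noise_eq_PiM gauss_iid_eq_PiM)

lemma LR_conv:
  assumes "w > 0" "vS > 0" "v > 0" "w' > 0"
  shows "(\<integral>\<^sup>+s. ennreal (LR n vS w m s) * ennreal (LR n v w' (\<lambda>i. e i + d * s i) z) \<partial>gauss_iid n w)
    = ennreal (LR n (v + d\<^sup>2 * vS) w' (\<lambda>i. e i + d * m i) z)"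
proof -
  have "ennreal (LR n vS w m s) * ennreal (LR n v w' (\<lambda>i. e i + d * s i) z) =
    (\<Prod>i<n. ennreal (lr vS w (m i) (s i)) * ennreal (lr v w' (e i + d * s i) (z i)))" for s
    using assms by (simp add: LR_def prod.distrib prod_ennreal less_imp_le[OF lr_pos])
  then have "(\<integral>\<^sup>+s. ennreal (LR n vS w m s) * ennreal (LR n v w' (\<lambda>i. e i + d * s i) z) \<partial>gauss_iid n w)
    = (\<Prod>i<n. \<integral>\<^sup>+s. ennreal (lr vS w (m i) s) * ennreal (lr v w' (e i + d * s) (z i)) \<partial>gm w 0)"
    using assms nn_integral_gauss_prod[where f="\<lambda>i s. ennreal (lr vS w (m i) s) * ennreal (lr v w' (e i + d * s) (z i))" and n=n and v=w]
    by simp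
  also have "\<dots> = (\<Prod>i<n. ennreal (lr (v + d\<^sup>2 * vS) w' (e i + d * m i) (z i)))"
    using assms by (simp add: lr_conv)
  finally show ?thesis
    using assms by (simp add: LR_def prod_ennreal less_imp_le[OF lr_pos] add_pos_nonneg)
qed

lemma LR_same: "w > 0 \<Longrightarrow> LR n w w (\<lambda>_. 0) z = 1"
  using normal_density_pos[of "sqrt w" 0] by (simp add: LR_def lr_def less_imp_neq[symmetric])

lemma nn_integral_LR_output:
  assumes "v > 0" "w > 0"
  shows "(\<integral>\<^sup>+z. ennreal (LR n v w a z) \<partial>gauss_iid n w) = 1"
proof -
  interpret prob_space "density (gauss_iid n w) (\<lambda>z. ennreal (LR n v w a z))"
    unfolding density_gauss_LR[OF assms] using assms by (intro prob_space_PiM prob_space_gm)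
  have "(\<integral>\<^sup>+z. ennreal (LR n v w a z) \<partial>gauss_iid n w) =
    emeasure (density (gauss_iid n w) (\<lambda>z. ennreal (LR n v w a z))) (space (gauss_iid n w))"
    by (subst emeasure_density) (auto intro!: nn_integral_cong)
  then show ?thesis using emeasure_space_1 by simp
qed

text \<open>The reference variance is that of \<open>\<beta> * u\<close> plus noise, so averaging
  the conditional density over the codeword gives back the reference law. It follows from the
  convolution formula started with the trivial ratio 1. Soft covering and threshold decoding both
  ask for this normalisation.\<close>

lemma nn_integral_LR_input:
  assumes "V > 0" "v > 0"
  shows "(\<integral>\<^sup>+u. ennreal (LR n v (v + \<beta>\<^sup>2 * V) (\<lambda>i. \<beta> * u i) z) \<partial>gauss_iid n V) = 1"
proof -
  have w: "v + \<beta>\<^sup>2 * V > 0" using assms by (simp add: add_pos_nonneg)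
  have "(\<integral>\<^sup>+u. ennreal (LR n V V (\<lambda>_. 0) u) * ennreal (LR n v (v + \<beta>\<^sup>2 * V) (\<lambda>i. 0 + \<beta> * u i) z) \<partial>gauss_iid n V)
     = ennreal (LR n (v + \<beta>\<^sup>2 * V) (v + \<beta>\<^sup>2 * V) (\<lambda>i. 0 + \<beta> * 0) z)"
    by (rule LR_conv) (use assms w in auto)
  then show ?thesis
    by (simp only: LR_same[OF w] LR_same[OF assms(1)] mult_zero_right add_0_left add_0_right ennreal_1 mult_1)
qed

text \<open>Both integrals factor over coordinates, so the single-letter exponent is multiplied by
  \<open>n\<close>.\<close>

lemma LR_moment:
  fixes t \<beta> :: real
  assumes V: "V > 0" and v: "v > 0" and t: "\<bar>t\<bar> < 1"
  defines "w \<equiv> v + \<beta>\<^sup>2 * V"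
  shows "(\<integral>\<^sup>+z. (\<integral>\<^sup>+u. ennreal (LR n v w (\<lambda>i. \<beta> * u i) z powr (1 + t)) \<partial>gauss_iid n V) \<partial>gauss_iid n w)
    = ennreal (exp (real n * (t * (ln (w / v) / 2) - ln (1 - t\<^sup>2 * (1 - v / w)) / 2)))"
proof -
  have w: "w > 0" using V v by (simp add: w_def add_pos_nonneg)
  interpret G: prob_space "gm V 0" using V by (rule prob_space_gm)
  have "ennreal (LR n v w (\<lambda>i. \<beta> * u i) z powr (1 + t)) = (\<Prod>i<n. ennreal (lr v w (\<beta> * u i) (z i) powr (1 + t)))" for u z
    by (simp add: LR_def prod_ennreal) (metis lr_pos[OF v w] less_imp_le prod_powr_distrib)
  then have "(\<integral>\<^sup>+z. (\<integral>\<^sup>+u. ennreal (LR n v w (\<lambda>i. \<beta> * u i) z powr (1 + t)) \<partial>gauss_iid n V) \<partial>gauss_iid n w)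
    = (\<integral>\<^sup>+z. (\<Prod>i<n. \<integral>\<^sup>+u. ennreal (lr v w (\<beta> * u) (z i) powr (1 + t)) \<partial>gm V 0) \<partial>gauss_iid n w)"
    using V nn_integral_gauss_prod[where f="\<lambda>i u. ennreal (lr v w (\<beta> * u) (z i) powr (1 + t))" and n=n and v=V for z]
    by simp
  also have "\<dots> = (\<Prod>i<n. \<integral>\<^sup>+z. \<integral>\<^sup>+u. ennreal (lr v w (\<beta> * u) z powr (1 + t)) \<partial>gm V 0 \<partial>gm w 0)"
    using w by (intro nn_integral_gauss_prod) auto
  also have "\<dots> = (\<Prod>i<n. ennreal (exp (t * (ln (w / v) / 2) - ln (1 - t\<^sup>2 * (1 - v / w)) / 2)))"
    using lr_moment[OF V v t, of \<beta>] by (simp add: w_def)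
  finally show ?thesis
    by (simp add: ennreal_power exp_of_nat_mult)
qed

section \<open>Integrals of functions of one or two random codewords\<close>

lemma nn_integral_PiM_component:
  assumes "prob_space M" "finite I" "j \<in> I" "f \<in> borel_measurable M"
  shows "(\<integral>\<^sup>+C. f (C j) \<partial>PiM I (\<lambda>_. M)) = (\<integral>\<^sup>+x. f x \<partial>M)"
  using assms by (subst (2) distr_PiM_component[symmetric, of I "\<lambda>_. M" j]) (auto simp: nn_integral_distr)

lemma nn_integral_PiM_pair:
  assumes "prob_space M" "finite I" "j \<in> I" "i \<in> I" "i \<noteq> j"
    and [measurable]: "f \<in> borel_measurable M" "g \<in> borel_measurable M"
  shows "(\<integral>\<^sup>+C. f (C j) * g (C i) \<partial>PiM I (\<lambda>_. M)) = (\<integral>\<^sup>+x. f x \<partial>M) * (\<integral>\<^sup>+x. g x \<partial>M)"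
proof -
  interpret M: prob_space M by fact
  interpret product_prob_space "\<lambda>_. M" by (rule product_prob_space_const) fact
  define h where "h l = (if l = j then f else if l = i then g else (\<lambda>_. 1))" for l
  have [measurable]: "h l \<in> borel_measurable M" for l by (simp add: h_def)
  have split: "(\<Prod>l\<in>I. k l) = k j * k i" if "\<And>l. l \<in> I \<Longrightarrow> l \<noteq> i \<Longrightarrow> l \<noteq> j \<Longrightarrow> k l = 1" for k :: "'b \<Rightarrow> ennreal"
  proof -
    have "(\<Prod>l\<in>I. k l) = (\<Prod>l\<in>{i,j}. k l)"
      using assms that by (intro prod.mono_neutral_right) auto
    then show ?thesis using assms by (simp add: mult.commute)
  qed
  have "(\<integral>\<^sup>+C. (\<Prod>l\<in>I. h l (C l)) \<partial>PiM I (\<lambda>_. M)) = (\<Prod>l\<in>I. \<integral>\<^sup>+x. h l x \<partial>M)"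
    by (rule product_nn_integral_prod) (use assms in auto)
  moreover have "(\<Prod>l\<in>I. h l (C l)) = f (C j) * g (C i)" for C
    using assms(5) by (subst split) (auto simp: h_def)
  moreover have "(\<Prod>l\<in>I. \<integral>\<^sup>+x. h l x \<partial>M) = (\<integral>\<^sup>+x. f x \<partial>M) * (\<integral>\<^sup>+x. g x \<partial>M)"
    using assms(5) by (subst split) (auto simp: h_def M.emeasure_space_1)
  ultimately show ?thesis by simp
qed

lemma second_moment_add_noise:
  assumes "v > 0"
  shows "(\<integral>\<^sup>+z. ennreal (\<Sum>i<n. (z i - e i)\<^sup>2) \<partial>add_noise n v a) = ennreal ((\<Sum>i<n. (a i - e i)\<^sup>2) + real n * v)"
proof -
  have [measurable]: "(\<lambda>z. z i) \<in> borel_measurable (PiM {..<n} (\<lambda>i. gm v (a i)))" if "i \<in> {..<n}" for i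
    using measurable_component_singleton[OF that, of "\<lambda>i. gm v (a i)"] by simp
  have "(\<integral>\<^sup>+z. ennreal (\<Sum>i<n. (z i - e i)\<^sup>2) \<partial>add_noise n v a) = (\<integral>\<^sup>+z. (\<Sum>i<n. ennreal ((z i - e i)\<^sup>2)) \<partial>PiM {..<n} (\<lambda>i. gm v (a i)))"
    using assms by (simp add: add_noise_eq_PiM sum_ennreal)
  also have "\<dots> = (\<Sum>i<n. \<integral>\<^sup>+z. ennreal ((z i - e i)\<^sup>2) \<partial>PiM {..<n} (\<lambda>i. gm v (a i)))"
    by (subst nn_integral_sum) auto
  also have "\<dots> = (\<Sum>i<n. \<integral>\<^sup>+x. ennreal ((x - e i)\<^sup>2) \<partial>gm v (a i))"
  proof (intro sum.cong refl)
    fix i assume i: "i \<in> {..<n}"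
    have "(\<integral>\<^sup>+x. ennreal ((x - e i)\<^sup>2) \<partial>gm v (a i)) = (\<integral>\<^sup>+x. ennreal ((x - e i)\<^sup>2) \<partial>distr (PiM {..<n} (\<lambda>i. gm v (a i))) (gm v (a i)) (\<lambda>z. z i))"
      using assms i by (subst distr_PiM_component) (auto intro: prob_space_gm)
    also have "\<dots> = (\<integral>\<^sup>+z. ennreal ((z i - e i)\<^sup>2) \<partial>PiM {..<n} (\<lambda>i. gm v (a i)))"
      using i measurable_component_singleton[of i "{..<n}" "\<lambda>i. gm v (a i)"] by (subst nn_integral_distr) auto
    finally show "(\<integral>\<^sup>+z. ennreal ((z i - e i)\<^sup>2) \<partial>PiM {..<n} (\<lambda>i. gm v (a i))) = (\<integral>\<^sup>+x. ennreal ((x - e i)\<^sup>2) \<partial>gm v (a i))" by simp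
  qed
  also have "\<dots> = ennreal (\<Sum>i<n. (a i - e i)\<^sup>2 + v)"
    using assms by (simp add: second_moment_gm sum_ennreal del: ennreal_plus)
  finally show ?thesis by (simp add: sum.distrib)
qed

section \<open>Soft covering and threshold decoding\<close>

text \<open>Generator of relative entropy with the affine part that makes it nonnegative with
  minimum 0 at 1; for a density with respect to a probability measure that part integrates to 0.
  Since \<open>ln 0 = 0\<close>, the value at 0 is 1, which is also the continuous one.\<close>

definition relF :: "real \<Rightarrow> real" where "relF t = t * ln t - t + 1"

lemma relF_measurable[measurable (raw)]:
  assumes [measurable]: "f \<in> borel_measurable M"
  shows "(\<lambda>x. relF (f x)) \<in> borel_measurable M"
  unfolding relF_def by measurable

text \<open>Convexity; dividing by \<open>x\<close> reduces it to \<open>ln s \<le> s - 1\<close> at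
  \<open>s = y / x\<close>.\<close>

lemma relF_tangent:
  assumes "x \<ge> 0" "y > 0" shows "relF x \<ge> relF y + ln y * (x - y)"
proof (cases "x = 0")
  case False
  then have "ln (y / x) \<le> y / x - 1" using assms by (intro ln_le_minus_one) auto
  then have "x * ln (y / x) \<le> x * (y / x - 1)" using assms by (intro mult_left_mono)
  then show ?thesis using assms False by (simp add: relF_def ln_div algebra_simps)
qed (use assms in \<open>simp add: relF_def algebra_simps\<close>)

lemma relF_nonneg: "x \<ge> 0 \<Longrightarrow> relF x \<ge> 0"
  using relF_tangent[of x 1] by (simp add: relF_def)

lemma relF_le_one_minus:
  assumes "0 \<le> x" "x \<le> 1" shows "relF x \<le> 1 - x"
  using assms by (cases "x = 0") (auto simp: relF_def intro!: mult_nonneg_nonpos)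

text \<open>The difference of the two sides has derivative \<open>ln y + 1 - y \<le> 0\<close> and
  vanishes at 1.\<close>

lemma relF_lower:
  assumes "0 \<le> x" "x \<le> 1" shows "(1 - x)\<^sup>2 / 2 \<le> relF x"
proof (cases "x = 0")
  case False
  define g where "g y = relF y - (1 - y)\<^sup>2 / 2" for y
  have "g 1 \<le> g x"
  proof (rule DERIV_nonpos_imp_nonincreasing[of x 1 g])
    fix y assume y: "x \<le> y" "y \<le> 1"
    have "(g has_real_derivative (ln y + 1 - y)) (at y)"
      unfolding g_def relF_def using y assms False
      by (auto intro!: derivative_eq_intros simp: field_simps)
    moreover have "ln y + 1 - y \<le> 0" using ln_le_minus_one[of y] y assms False by auto
    ultimately show "\<exists>z. (g has_real_derivative z) (at y) \<and> z \<le> 0" by blast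
  qed (use assms in auto)
  then show ?thesis by (simp add: g_def relF_def)
qed (simp add: relF_def)

text \<open>A small divergence leaves little missing mass. The free parameter linearises the square
  root of a Pinsker-type bound, so the inequality can be integrated and averaged before \<eta> is
  chosen.\<close>

lemma pos_part_le_relF:
  assumes "0 \<le> x" "\<eta> > 0" shows "max 0 (1 - x) \<le> \<eta> + relF x / (2 * \<eta>)"
proof (cases "x \<le> 1")
  case True
  have "0 \<le> (1 - x - 2 * \<eta>)\<^sup>2" by simp
  then have "4 * \<eta> * (1 - x) \<le> 4 * \<eta>\<^sup>2 + (1 - x)\<^sup>2" by (simp add: power2_eq_square algebra_simps)
  also have "\<dots> \<le> 4 * \<eta>\<^sup>2 + 2 * relF x" using relF_lower[OF assms(1) True] by simp
  also have "\<dots> = 4 * \<eta> * (\<eta> + relF x / (2 * \<eta>))"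
    using assms by (simp add: field_simps power2_eq_square)
  finally show ?thesis using assms True relF_nonneg[OF assms(1)] by auto
qed (use assms relF_nonneg[OF assms(1)] in auto)

text \<open>\<open>h\<close> is the true density, \<open>g\<close> the ideal covering density,
  \<open>b\<close> the fallback. Domination by \<open>g + b\<close> does not bound
  \<open>relF h\<close> alone, since \<open>h\<close> may also fall below \<open>g\<close>; that
  deficit is charged to \<open>g + b - h\<close>, whose integral is small when \<open>h\<close> and
  \<open>g\<close> have equal mass. \<open>c\<close> truncates the unbounded factor
  \<open>ln (g + 1)\<close>.\<close>

lemma relF_perturb:
  assumes "0 \<le> h" "0 \<le> g" "0 \<le> b" "b \<le> 1" "h \<le> g + b" "\<eta> > 0" "c \<ge> 1"
  shows "relF h \<le> relF g + b * ln c + (g + b) / c + (g + b - h) + \<eta> + relF g / (2 * \<eta>)"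
proof -
  have nn: "0 \<le> b * ln c" "0 \<le> (g + b) / c" "0 \<le> relF g" "0 \<le> relF g / (2 * \<eta>)"
    using assms relF_nonneg[of g] by auto
  \<comment> \<open>Above \<open>g\<close> the excess is at most \<open>b\<close> and the tangent at
    \<open>h\<close> applies; between 1 and \<open>g\<close>, \<open>relF\<close> is increasing;
    below both, \<open>1 - h\<close> splits into \<open>1 - g\<close> and the deficit
    \<open>g - h\<close>.\<close>
  consider "h \<ge> g" "h > 0" | "h = 0" "g = 0" | "h < g" "h \<ge> 1" | "h < g" "h < 1"
    using assms by linarith
  then show ?thesis
  proof cases
    case 1
    have "relF h \<le> relF g + ln h * (h - g)" using relF_tangent[OF assms(2) 1(2)] by (simp add: algebra_simps)
    also have "ln h * (h - g) \<le> ln (g + 1) * b"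
    proof (rule order.trans)
      show "ln h * (h - g) \<le> ln (g + 1) * (h - g)"
        using 1 assms by (intro mult_right_mono) auto
      show "ln (g + 1) * (h - g) \<le> ln (g + 1) * b"
        using 1 assms by (intro mult_left_mono) auto
    qed
    also have "ln (g + 1) * b \<le> b * ln c + (g + b) / c"
    proof -
      have "ln ((g + 1) / c) \<le> (g + 1) / c - 1" using assms by (intro ln_le_minus_one) auto
      then have "b * ln (g + 1) \<le> b * (ln c + (g + 1) / c - 1)"
        using assms by (intro mult_left_mono) (auto simp: ln_div)
      also have "\<dots> \<le> b * ln c + b * ((g + 1) / c)" using assms by (simp add: algebra_simps)
      also have "b * ((g + 1) / c) \<le> (g + b) / c"
        using assms mult_right_mono[OF assms(4), of g] by (simp add: divide_right_mono algebra_simps)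
      finally show ?thesis by (simp add: mult.commute)
    qed
    finally show ?thesis using nn assms by linarith
  next
    case 3
    have "relF h \<le> relF g"
      using relF_tangent[of g h] 3 mult_nonneg_nonneg[OF ln_ge_zero[OF 3(2)], of "g - h"] by linarith
    then show ?thesis using nn assms 3 by linarith
  next
    case 4
    have "relF h \<le> 1 - h" using 4 assms by (intro relF_le_one_minus) auto
    then show ?thesis
      using nn assms pos_part_le_relF[OF assms(2,6)] by linarith
  qed (use nn assms in auto)
qed

text \<open>Subadditivity \<open>(1 + x) powr t \<le> 1 + x powr t\<close>, followed by
  \<open>ln (1 + y) \<le> y\<close>. It turns the logarithmic mean of soft covering into a moment of
  order \<open>1 + t\<close>.\<close>

lemma ln_add_one_le_powr:
  fixes t x :: real
  assumes "0 < t" "t \<le> 1" "0 \<le> x"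
  shows "ln (1 + x) \<le> x powr t / t"
proof -
  define s where "s = 1 + x"
  have s: "s \<ge> 1" using assms by (simp add: s_def)
  have small: "y \<le> y powr t" if "0 \<le> y" "y \<le> 1" for y :: real
    using powr_mono'[of t 1 y] that assms by (cases "y = 0") auto
  have "1 = 1 / s + x / s" using s by (simp add: s_def field_simps)
  also have "\<dots> \<le> (1 / s) powr t + (x / s) powr t"
    using s assms by (intro add_mono small) (auto simp: s_def)
  also have "\<dots> = (1 + x powr t) / s powr t"
    using s assms by (simp add: powr_divide add_divide_distrib)
  finally have "s powr t \<le> 1 + x powr t" using s by (simp add: field_simps)
  then have "ln (s powr t) \<le> ln (1 + x powr t)" using s by (subst ln_le_cancel_iff) (auto intro: add_pos_nonneg)
  also have "\<dots> \<le> x powr t" by (rule ln_add_one_self_le_self) simp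
  finally show ?thesis using assms s by (simp add: ln_powr s_def field_simps)
qed

text \<open>The tangent of the logarithm at \<open>1 + r (C j) / card I\<close>, which bounds the mean of the average given the codeword \<open>C j\<close>,
  plays the role of Jensen's inequality.\<close>

lemma soft_covering_point:
  fixes r :: "'a \<Rightarrow> real"
  assumes A: "prob_space A" and J: "finite J" "I \<subseteq> J" "I \<noteq> {}"
    and r [measurable]: "r \<in> borel_measurable A" and r0: "\<And>u. 0 \<le> r u" and r1: "(\<integral>\<^sup>+u. ennreal (r u) \<partial>A) = 1"
  shows "(\<integral>\<^sup>+C. ennreal (relF ((\<Sum>j\<in>I. r (C j)) / real (card I))) \<partial>PiM J (\<lambda>_. A))
    \<le> (\<integral>\<^sup>+u. ennreal (r u * ln (1 + r u / real (card I))) \<partial>A)"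
proof -
  let ?P = "PiM J (\<lambda>_. A)"
  interpret A: prob_space A by fact
  interpret P: prob_space "?P" by (intro prob_space_PiM A)
  define N where "N = real (card I)"
  have fI: "finite I" using J finite_subset by blast
  have N: "N \<ge> 1" using J fI by (simp add: N_def card_gt_0_iff Suc_leI)
  define c where "c u = 1 + r u / N" for u
  let ?X = "\<lambda>j i. \<integral>\<^sup>+C. ennreal (r (C j) / c (C j) / N * (r (C i) / N)) \<partial>?P"
  have c: "c u \<ge> 1" for u using r0[of u] N by (simp add: c_def)
  have [measurable]: "c \<in> borel_measurable A" unfolding c_def by measurable
  define h where "h C = (\<Sum>j\<in>I. r (C j)) / N" for C :: "'b \<Rightarrow> 'a"
  have h0: "h C \<ge> 0" for C using N r0 by (auto simp: h_def intro!: divide_nonneg_nonneg sum_nonneg)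
  have mj[measurable]: "(\<lambda>C. C j) \<in> ?P \<rightarrow>\<^sub>M A" if "j \<in> I" for j
    using that J by (intro measurable_component_singleton) auto
  have [measurable]: "h \<in> borel_measurable (?P)" unfolding h_def by measurable
  \<comment> \<open>Adding \<open>2 * h C\<close> turns the left side into
    \<open>h * ln h + h + 1\<close> and keeps every term nonnegative; since \<open>h\<close> has
    mean 1, the two units cancel at the end.\<close>
  have pt: "relF (h C) + 2 * h C \<le> (\<Sum>j\<in>I. r (C j) * ln (c (C j)) / N) + (\<Sum>j\<in>I. \<Sum>i\<in>I. (r (C j) / c (C j) / N) * (r (C i) / N)) + 1" for C
  proof (cases "h C = 0")
    case True
    have "\<forall>j\<in>I. 0 \<le> r (C j) * ln (c (C j)) / N" "\<forall>j\<in>I. \<forall>i\<in>I. 0 \<le> (r (C j) / c (C j) / N) * (r (C i) / N)"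
      using r0 c N less_imp_le[OF less_le_trans[OF zero_less_one c]] by (auto intro!: divide_nonneg_nonneg mult_nonneg_nonneg)
    then show ?thesis using True by (auto simp: relF_def intro!: add_nonneg_nonneg sum_nonneg)
  next
    case False
    then have hp: "h C > 0" using h0[of C] by simp
    have "r (C j) / N * ln (h C) \<le> r (C j) * ln (c (C j)) / N + (r (C j) / c (C j) / N) * h C - r (C j) / N" for j
    proof -
      have "ln (h C / c (C j)) \<le> h C / c (C j) - 1" using hp c[of "C j"] by (intro ln_le_minus_one) auto
      then have "r (C j) / N * ln (h C) \<le> r (C j) / N * (ln (c (C j)) + h C / c (C j) - 1)"
        using r0 N hp c[of "C j"] by (intro mult_left_mono) (auto simp: ln_div)
      then show ?thesis by (simp add: algebra_simps diff_divide_distrib add_divide_distrib)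
    qed
    then have "(\<Sum>j\<in>I. r (C j) / N * ln (h C)) \<le> (\<Sum>j\<in>I. r (C j) * ln (c (C j)) / N + (r (C j) / c (C j) / N) * h C - r (C j) / N)"
      by (rule sum_mono)
    moreover have "(\<Sum>j\<in>I. r (C j) / N * ln (h C)) = h C * ln (h C)"
      by (simp add: h_def sum_distrib_right sum_divide_distrib)
    moreover have "(\<Sum>j\<in>I. r (C j) / N) = h C" by (simp add: h_def sum_divide_distrib)
    moreover have "(\<Sum>j\<in>I. (r (C j) / c (C j) / N) * h C) = (\<Sum>j\<in>I. \<Sum>i\<in>I. (r (C j) / c (C j) / N) * (r (C i) / N))"
      by (simp add: h_def sum_distrib_left sum_divide_distrib)
    ultimately show ?thesis by (simp add: relF_def sum.distrib sum_subtractf)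
  qed
  have rc0: "0 \<le> r u / c u / N" "0 \<le> r u / N" "0 \<le> r u * ln (c u) / N" for u
    using r0[of u] c[of u] N by auto
  have rc1: "0 \<le> r u / c u / N * (r v / N)" for u v by (intro mult_nonneg_nonneg rc0)
  define a where "a = (\<integral>\<^sup>+u. ennreal (r u / c u / N) \<partial>A)"
  define a2 where "a2 = (\<integral>\<^sup>+u. ennreal (r u / c u / N * (r u / N)) \<partial>A)"
  have rN: "(\<integral>\<^sup>+u. ennreal (r u / N) \<partial>A) = ennreal (1 / N)"
    using N r0 r1 by (simp add: divide_inverse mult.commute ennreal_mult nn_integral_cmult)
  have cardN: "of_nat (card I) = ennreal N" by (simp add: N_def ennreal_of_nat_eq_real_of_nat)
  have "(\<integral>\<^sup>+C. ennreal (relF (h C)) \<partial>?P) + (\<integral>\<^sup>+C. ennreal (2 * h C) \<partial>?P)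
     = (\<integral>\<^sup>+C. ennreal (relF (h C) + 2 * h C) \<partial>?P)"
    using h0 relF_nonneg[OF h0]
    by (subst nn_integral_add[symmetric]) auto
  also have "\<dots> \<le> (\<integral>\<^sup>+C. (\<Sum>j\<in>I. ennreal (r (C j) * ln (c (C j)) / N)) + (\<Sum>j\<in>I. \<Sum>i\<in>I. ennreal (r (C j) / c (C j) / N * (r (C i) / N))) + 1 \<partial>?P)"
  proof (intro nn_integral_mono)
    fix C
    have "(\<Sum>j\<in>I. ennreal (r (C j) * ln (c (C j)) / N)) + (\<Sum>j\<in>I. \<Sum>i\<in>I. ennreal (r (C j) / c (C j) / N * (r (C i) / N))) + 1
      = ennreal ((\<Sum>j\<in>I. r (C j) * ln (c (C j)) / N) + (\<Sum>j\<in>I. \<Sum>i\<in>I. (r (C j) / c (C j) / N) * (r (C i) / N)) + 1)"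
      by (simp only: sum_ennreal sum_nonneg rc0 rc1 add_nonneg_nonneg zero_le_one flip: ennreal_plus ennreal_1)
    then show "ennreal (relF (h C) + 2 * h C) \<le> (\<Sum>j\<in>I. ennreal (r (C j) * ln (c (C j)) / N)) + (\<Sum>j\<in>I. \<Sum>i\<in>I. ennreal (r (C j) / c (C j) / N * (r (C i) / N))) + 1"
      using pt[of C] by (simp add: ennreal_leI)
  qed
  also have "\<dots> = (\<Sum>j\<in>I. \<integral>\<^sup>+C. ennreal (r (C j) * ln (c (C j)) / N) \<partial>?P)
     + (\<Sum>j\<in>I. \<Sum>i\<in>I. ?X j i) + 1"
    by (simp add: nn_integral_add nn_integral_sum P.emeasure_space_1)
  also have "(\<Sum>j\<in>I. \<integral>\<^sup>+C. ennreal (r (C j) * ln (c (C j)) / N) \<partial>?P) = (\<integral>\<^sup>+u. ennreal (r u * ln (c u)) \<partial>A)"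
  proof -
    have "(\<integral>\<^sup>+C. ennreal (r (C j) * ln (c (C j)) / N) \<partial>?P) = (\<integral>\<^sup>+u. ennreal (r u * ln (c u) / N) \<partial>A)" if "j \<in> I" for j
      using that J by (intro nn_integral_PiM_component[where f="\<lambda>u. ennreal (r u * ln (c u) / N)"] A) auto
    then have "(\<Sum>j\<in>I. \<integral>\<^sup>+C. ennreal (r (C j) * ln (c (C j)) / N) \<partial>?P) = ennreal N * (\<integral>\<^sup>+u. ennreal (r u * ln (c u) / N) \<partial>A)"
      by (simp add: cardN)
    also have "\<dots> = (\<integral>\<^sup>+u. ennreal (r u * ln (c u)) \<partial>A)"
      using N by (subst nn_integral_cmult[symmetric]) (auto simp: rc0 simp flip: ennreal_mult)
    finally show ?thesis .
  qed
  \<comment> \<open>By independence the diagonal term for \<open>j\<close> is \<open>a2\<close> and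
    the other terms sum to at most \<open>a\<close>. As \<open>c = 1 + r / N\<close>, the integrands
    of \<open>a2\<close> and \<open>a\<close> add up to \<open>r / N\<close>, whose mean is exactly
    \<open>1 / N\<close>.\<close>
  also have "(\<Sum>j\<in>I. \<Sum>i\<in>I. ?X j i) \<le> 1"
  proof -
    have "(\<Sum>i\<in>I. ?X j i) \<le> a2 + a" if j: "j \<in> I" for j
    proof -
      have d: "(\<integral>\<^sup>+C. ennreal (r (C j) / c (C j) / N * (r (C j) / N)) \<partial>?P) = a2"
        unfolding a2_def using j J
        by (intro nn_integral_PiM_component[where f="\<lambda>u. ennreal (r u / c u / N * (r u / N))"] A) auto
      have o: "(?X j i) = a * ennreal (1 / N)" if "i \<in> I" "i \<noteq> j" for i
        using that j J rc0 nn_integral_PiM_pair[OF A, of J j i "\<lambda>u. ennreal (r u / c u / N)" "\<lambda>u. ennreal (r u / N)"]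
        by (auto simp: a_def rN subset_iff simp flip: ennreal_mult)
      have "(\<Sum>i\<in>I. ?X j i) = a2 + (\<Sum>i\<in>I-{j}. a * ennreal (1 / N))"
        unfolding sum.remove[OF fI j] d by (intro arg_cong2[where f="(+)"] refl sum.cong o) auto
      also have "\<dots> \<le> a2 + (\<Sum>i\<in>I. a * ennreal (1 / N))"
        using fI by (intro add_left_mono sum_mono2) auto
      also have "(\<Sum>i\<in>I. a * ennreal (1 / N)) = a * (ennreal N * ennreal (1 / N))" by (simp add: cardN ac_simps)
      also have "\<dots> = a" using N by (simp flip: ennreal_mult)
      finally show ?thesis .
    qed
    then have "(\<Sum>j\<in>I. \<Sum>i\<in>I. ?X j i) \<le> (\<Sum>j\<in>I. a2 + a)"
      by (rule sum_mono)
    also have "\<dots> = ennreal N * (a2 + a)" by (simp add: cardN)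
    also have "a2 + a = (\<integral>\<^sup>+u. ennreal (r u / N) \<partial>A)"
      unfolding a_def a2_def
    proof (subst nn_integral_add[symmetric], measurable, intro nn_integral_cong)
      fix u
      have "r u / c u / N * (r u / N) + r u / c u / N = r u / c u / N * c u"
        unfolding c_def[of u] by (simp only: distrib_left mult_1_right add.commute)
      also have "\<dots> = r u / N" using c[of u] by simp
      finally show "ennreal (r u / c u / N * (r u / N)) + ennreal (r u / c u / N) = ennreal (r u / N)"
        by (simp only: rc0 rc1 flip: ennreal_plus)
    qed
    also have "ennreal N * \<dots> = 1" unfolding rN using N by (simp flip: ennreal_mult)
    finally show ?thesis .
  qed
  finally have le: "(\<integral>\<^sup>+C. ennreal (relF (h C)) \<partial>?P) + (\<integral>\<^sup>+C. ennreal (2 * h C) \<partial>?P)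
     \<le> (\<integral>\<^sup>+u. ennreal (r u * ln (c u)) \<partial>A) + 1 + 1"
    by (simp add: add_left_mono add_right_mono)
  have "(\<integral>\<^sup>+C. ennreal (2 * h C) \<partial>?P) = (\<integral>\<^sup>+C. (\<Sum>j\<in>I. ennreal (2 / N) * ennreal (r (C j))) \<partial>?P)"
    using N r0 by (intro nn_integral_cong)
      (simp add: h_def sum_distrib_left sum_divide_distrib sum_ennreal flip: ennreal_mult)
  also have "\<dots> = (\<Sum>j\<in>I. ennreal (2 / N) * (\<integral>\<^sup>+C. ennreal (r (C j)) \<partial>?P))"
    by (simp add: nn_integral_sum nn_integral_cmult)
  also have "\<dots> = (\<Sum>j\<in>I. ennreal (2 / N))"
  proof (intro sum.cong refl)
    fix j assume "j \<in> I"
    then have "(\<integral>\<^sup>+C. ennreal (r (C j)) \<partial>?P) = 1"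
      using J r1 nn_integral_PiM_component[OF A J(1), of j "\<lambda>u. ennreal (r u)"] by auto
    then show "ennreal (2 / N) * (\<integral>\<^sup>+C. ennreal (r (C j)) \<partial>?P) = ennreal (2 / N)" by simp
  qed
  also have "\<dots> = ennreal N * ennreal (2 / N)" by (simp add: cardN)
  also have "\<dots> = 1 + 1" using N by (simp flip: ennreal_mult)
  finally have "(\<integral>\<^sup>+C. ennreal (relF (h C)) \<partial>?P) + (1 + 1) \<le> (\<integral>\<^sup>+u. ennreal (r u * ln (c u)) \<partial>A) + (1 + 1)"
    using le by (simp add: add.assoc)
  then show ?thesis
    by (simp add: h_def c_def N_def)
qed

text \<open>Exchanging the integrals reduces it to the bound at each \<open>z\<close>. The covering
  set \<open>I\<close> may be a part of the codebook \<open>J\<close>, so one random codebook serves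
  both the single bins, which cover the state, and the whole code, which covers the warden's
  output.\<close>

lemma soft_covering:
  fixes \<rho> :: "'a \<Rightarrow> 'b \<Rightarrow> real"
  assumes A: "prob_space A" and B: "prob_space B" and J: "finite J" "I \<subseteq> J" "I \<noteq> {}"
    and m [measurable]: "(\<lambda>(u, z). \<rho> u z) \<in> borel_measurable (A \<Otimes>\<^sub>M B)" and r0: "\<And>u z. 0 \<le> \<rho> u z"
    and r1: "\<And>z. z \<in> space B \<Longrightarrow> (\<integral>\<^sup>+u. ennreal (\<rho> u z) \<partial>A) = 1"
    and t: "0 < t" "t \<le> 1"
  shows "(\<integral>\<^sup>+C. \<integral>\<^sup>+z. ennreal (relF ((\<Sum>j\<in>I. \<rho> (C j) z) / real (card I))) \<partial>B \<partial>PiM J (\<lambda>_. A))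
    \<le> ennreal (real (card I) powr - t / t) * (\<integral>\<^sup>+z. \<integral>\<^sup>+u. ennreal (\<rho> u z powr (1 + t)) \<partial>A \<partial>B)"
proof -
  let ?P = "PiM J (\<lambda>_. A)"
  interpret A: prob_space A by fact
  interpret B: prob_space B by fact
  interpret P: prob_space "?P" by (intro prob_space_PiM A)
  interpret PB: pair_sigma_finite "?P" B ..
  have N: "real (card I) \<ge> 1" using J finite_subset[OF J(2,1)] by (simp add: card_gt_0_iff Suc_leI)
  have mj[measurable]: "(\<lambda>C. C j) \<in> ?P \<rightarrow>\<^sub>M A" if "j \<in> I" for j
    using that J by (intro measurable_component_singleton) auto
  have [measurable]: "(\<lambda>(C, z). \<rho> (C j) z) \<in> borel_measurable (?P \<Otimes>\<^sub>M B)" if "j \<in> I" for j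
    using that by measurable
  have "(\<integral>\<^sup>+C. \<integral>\<^sup>+z. ennreal (relF ((\<Sum>j\<in>I. \<rho> (C j) z) / real (card I))) \<partial>B \<partial>?P)
    = (\<integral>\<^sup>+z. \<integral>\<^sup>+C. ennreal (relF ((\<Sum>j\<in>I. \<rho> (C j) z) / real (card I))) \<partial>?P \<partial>B)"
    by (intro PB.Fubini'[symmetric]) (unfold relF_def, measurable)
  also have "\<dots> \<le> (\<integral>\<^sup>+z. ennreal (real (card I) powr - t / t) * (\<integral>\<^sup>+u. ennreal (\<rho> u z powr (1 + t)) \<partial>A) \<partial>B)"
  proof (intro nn_integral_mono)
    fix z assume z: "z \<in> space B"
    have [measurable]: "(\<lambda>u. \<rho> u z) \<in> borel_measurable A" using z by measurable
    have "(\<integral>\<^sup>+C. ennreal (relF ((\<Sum>j\<in>I. \<rho> (C j) z) / real (card I))) \<partial>?P)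
      \<le> (\<integral>\<^sup>+u. ennreal (\<rho> u z * ln (1 + \<rho> u z / real (card I))) \<partial>A)"
      using z by (intro soft_covering_point A J r0 r1) auto
    also have "\<dots> \<le> (\<integral>\<^sup>+u. ennreal (real (card I) powr - t / t) * ennreal (\<rho> u z powr (1 + t)) \<partial>A)"
    proof (intro nn_integral_mono)
      fix u
      have "\<rho> u z * ln (1 + \<rho> u z / real (card I)) \<le> \<rho> u z * ((\<rho> u z / real (card I)) powr t / t)"
        using N r0 t by (intro mult_left_mono ln_add_one_le_powr) auto
      also have "\<dots> = real (card I) powr - t / t * (\<rho> u z powr (1 + t))"
        using N r0[of u z] by (simp add: powr_divide powr_minus powr_add field_simps)
      finally show "ennreal (\<rho> u z * ln (1 + \<rho> u z / real (card I))) \<le> ennreal (real (card I) powr - t / t) * ennreal (\<rho> u z powr (1 + t))"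
        using t by (simp add: ennreal_leI flip: ennreal_mult)
    qed
    also have "\<dots> = ennreal (real (card I) powr - t / t) * (\<integral>\<^sup>+u. ennreal (\<rho> u z powr (1 + t)) \<partial>A)"
      by (intro nn_integral_cmult) measurable
    finally show "(\<integral>\<^sup>+C. ennreal (relF ((\<Sum>j\<in>I. \<rho> (C j) z) / real (card I))) \<partial>?P)
      \<le> ennreal (real (card I) powr - t / t) * (\<integral>\<^sup>+u. ennreal (\<rho> u z powr (1 + t)) \<partial>A)" .
  qed
  also have "\<dots> = ennreal (real (card I) powr - t / t) * (\<integral>\<^sup>+z. \<integral>\<^sup>+u. ennreal (\<rho> u z powr (1 + t)) \<partial>A \<partial>B)"
    by (intro nn_integral_cmult) measurable
  finally show ?thesis .
qed

text \<open>Counts the causes of an error of the threshold test: the sent codeword fails it, or some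
  rival passes it. A count in place of an indicator builds in the union bound.\<close>

abbreviation penalty :: "real \<Rightarrow> 'j set \<Rightarrow> ('j \<Rightarrow> real) \<Rightarrow> 'j \<Rightarrow> ennreal" where
  "penalty \<theta> I a j \<equiv> (if a j \<le> \<theta> then 1 else 0) + (\<Sum>i\<in>I. if a i > \<theta> then 1 else 0)"

text \<open>The weight \<open>\<rho> (C j) z\<close> changes the reference law into the output law
  of codeword \<open>j\<close>. A miss is handled by a Chernoff bound with exponent
  \<open>t\<close>. A rival is independent of the sent codeword and its ratio has mean 1, so by
  Markov's inequality it passes with probability at most \<open>1 / \<theta>\<close>.\<close>

lemma threshold_decoding:
  fixes \<rho> :: "'a \<Rightarrow> 'b \<Rightarrow> real"
  assumes A: "prob_space A" and B: "prob_space B" and J: "finite J" "j \<in> J" "I \<subseteq> J - {j}"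
    and m [measurable]: "(\<lambda>(u, z). \<rho> u z) \<in> borel_measurable (A \<Otimes>\<^sub>M B)" and r0: "\<And>u z. 0 \<le> \<rho> u z"
    and r1: "\<And>z. z \<in> space B \<Longrightarrow> (\<integral>\<^sup>+u. ennreal (\<rho> u z) \<partial>A) = 1"
    and t: "0 < t" "\<theta> > 0"
  shows "(\<integral>\<^sup>+C. \<integral>\<^sup>+z. ennreal (\<rho> (C j) z) * penalty \<theta> I (\<lambda>i. \<rho> (C i) z) j \<partial>B \<partial>PiM J (\<lambda>_. A))
    \<le> ennreal (\<theta> powr t) * (\<integral>\<^sup>+z. \<integral>\<^sup>+u. ennreal (\<rho> u z powr (1 - t)) \<partial>A \<partial>B) + ennreal (real (card I) / \<theta>)"
proof -
  let ?P = "PiM J (\<lambda>_. A)" and ?f = "\<lambda>C z. ennreal (\<rho> (C j) z) * penalty \<theta> I (\<lambda>i. \<rho> (C i) z) j"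
  interpret A: prob_space A by fact
  interpret B: prob_space B by fact
  interpret P: prob_space "?P" by (intro prob_space_PiM A)
  interpret PB: pair_sigma_finite "?P" B ..
  have mj[measurable]: "(\<lambda>C. C j) \<in> ?P \<rightarrow>\<^sub>M A" if "j \<in> J" for j
    using that J by (intro measurable_component_singleton) auto
  have mr[measurable]: "(\<lambda>(C, z). \<rho> (C j) z) \<in> borel_measurable (?P \<Otimes>\<^sub>M B)" if "j \<in> J" for j
    using that by measurable
  have jJ[measurable]: "(\<lambda>(C, z). \<rho> (C j) z) \<in> borel_measurable (?P \<Otimes>\<^sub>M B)" by (rule mr[OF J(2)])
  have iJ[measurable]: "(\<lambda>(C, z). \<rho> (C i) z) \<in> borel_measurable (?P \<Otimes>\<^sub>M B)" if "i \<in> I" for i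
    using that J by (intro mr) auto
  have "(\<integral>\<^sup>+C. \<integral>\<^sup>+z. ?f C z \<partial>B \<partial>?P)
    = (\<integral>\<^sup>+z. \<integral>\<^sup>+C. ?f C z \<partial>?P \<partial>B)"
    by (intro PB.Fubini'[symmetric]) measurable
  also have "\<dots> \<le> (\<integral>\<^sup>+z. ennreal (\<theta> powr t) * (\<integral>\<^sup>+u. ennreal (\<rho> u z powr (1 - t)) \<partial>A) + ennreal (real (card I) / \<theta>) \<partial>B)"
  proof (intro nn_integral_mono)
    fix z assume z: "z \<in> space B"
    have mz[measurable]: "(\<lambda>u. \<rho> u z) \<in> borel_measurable A" using z by measurable
    have mjz[measurable]: "(\<lambda>C. \<rho> (C j) z) \<in> borel_measurable (?P)"
      using measurable_compose[OF mj[OF J(2)] mz] .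
    have miz[measurable]: "(\<lambda>C. \<rho> (C i) z) \<in> borel_measurable (?P)" if "i \<in> I" for i
      using that J measurable_compose[OF mj mz] by blast
    have "(\<integral>\<^sup>+C. ?f C z \<partial>?P)
      \<le> (\<integral>\<^sup>+C. ennreal (\<theta> powr t) * ennreal (\<rho> (C j) z powr (1 - t)) + (\<Sum>i\<in>I. ennreal (\<rho> (C j) z) * ennreal (\<rho> (C i) z / \<theta>)) \<partial>?P)"
    proof (intro nn_integral_mono)
      fix C
      have 1: "ennreal (\<rho> (C j) z) * (if \<rho> (C j) z \<le> \<theta> then 1 else 0) \<le> ennreal (\<theta> powr t) * ennreal (\<rho> (C j) z powr (1 - t))"
      proof (cases "\<rho> (C j) z \<le> \<theta>")
        case True
        have "\<rho> (C j) z = \<rho> (C j) z powr t * \<rho> (C j) z powr (1 - t)" using r0[of "C j" z] by (simp flip: powr_add)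
        also have "\<dots> \<le> \<theta> powr t * \<rho> (C j) z powr (1 - t)" using True r0 t by (intro mult_right_mono powr_mono2) auto
        finally show ?thesis using True by (simp add: ennreal_leI flip: ennreal_mult)
      qed simp
      have 2: "(\<Sum>i\<in>I. if \<rho> (C i) z > \<theta> then 1 else 0) \<le> (\<Sum>i\<in>I. ennreal (\<rho> (C i) z / \<theta>))"
      proof (intro sum_mono)
        fix i show "(if \<rho> (C i) z > \<theta> then 1 else 0) \<le> ennreal (\<rho> (C i) z / \<theta>)"
          using t ennreal_leI[of 1 "\<rho> (C i) z / \<theta>"] by auto
      qed
      show "?f C z
        \<le> ennreal (\<theta> powr t) * ennreal (\<rho> (C j) z powr (1 - t)) + (\<Sum>i\<in>I. ennreal (\<rho> (C j) z) * ennreal (\<rho> (C i) z / \<theta>))"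
        unfolding distrib_left sum_distrib_left[symmetric] by (intro add_mono 1 mult_left_mono 2) simp
    qed
    also have "\<dots> = ennreal (\<theta> powr t) * (\<integral>\<^sup>+C. ennreal (\<rho> (C j) z powr (1 - t)) \<partial>?P) + (\<Sum>i\<in>I. \<integral>\<^sup>+C. ennreal (\<rho> (C j) z) * ennreal (\<rho> (C i) z / \<theta>) \<partial>?P)"
      by (simp add: nn_integral_add nn_integral_sum nn_integral_cmult)
    also have "(\<integral>\<^sup>+C. ennreal (\<rho> (C j) z powr (1 - t)) \<partial>?P) = (\<integral>\<^sup>+u. ennreal (\<rho> u z powr (1 - t)) \<partial>A)"
      using J by (intro nn_integral_PiM_component[where f="\<lambda>u. ennreal (\<rho> u z powr (1 - t))"] A) auto
    also have "(\<Sum>i\<in>I. \<integral>\<^sup>+C. ennreal (\<rho> (C j) z) * ennreal (\<rho> (C i) z / \<theta>) \<partial>?P) = (\<Sum>i\<in>I. ennreal (1 / \<theta>))"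
    proof (intro sum.cong refl)
      fix i assume i: "i \<in> I"
      have "(\<integral>\<^sup>+u. ennreal (\<rho> u z / \<theta>) \<partial>A) = ennreal (1 / \<theta>)"
        using t r0 r1[OF z] by (simp add: divide_inverse mult.commute ennreal_mult nn_integral_cmult)
      then show "(\<integral>\<^sup>+C. ennreal (\<rho> (C j) z) * ennreal (\<rho> (C i) z / \<theta>) \<partial>?P) = ennreal (1 / \<theta>)"
        using J i r1[OF z] nn_integral_PiM_pair[OF A J(1), of j i "\<lambda>u. ennreal (\<rho> u z)" "\<lambda>u. ennreal (\<rho> u z / \<theta>)"]
        by auto
    qed
    also have "\<dots> = ennreal (real (card I) / \<theta>)"
      using t by (simp add: ennreal_of_nat_eq_real_of_nat flip: ennreal_mult)
    finally show "(\<integral>\<^sup>+C. ?f C z \<partial>?P)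
      \<le> ennreal (\<theta> powr t) * (\<integral>\<^sup>+u. ennreal (\<rho> u z powr (1 - t)) \<partial>A) + ennreal (real (card I) / \<theta>)" .
  qed
  also have "\<dots> = ennreal (\<theta> powr t) * (\<integral>\<^sup>+z. \<integral>\<^sup>+u. ennreal (\<rho> u z powr (1 - t)) \<partial>A \<partial>B) + ennreal (real (card I) / \<theta>)"
    by (simp add: nn_integral_add nn_integral_cmult B.emeasure_space_1)
  finally show ?thesis .
qed

section \<open>The randomised binning encoder\<close>

lemma add_noise_kernel:
  assumes f: "\<And>i. i < n \<Longrightarrow> (\<lambda>x. f x i) \<in> borel_measurable M" and v: "v > 0"
  shows "(\<lambda>x. add_noise n v (f x)) \<in> M \<rightarrow>\<^sub>M prob_algebra (vspace n)"
  unfolding add_noise_def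
proof (rule measurable_distr_prob_space2)
  show "(\<lambda>x. gauss_iid n v) \<in> M \<rightarrow>\<^sub>M prob_algebra (vspace n)"
    using v by (intro measurable_const) (simp add: space_prob_algebra prob_space_gauss_iid)
  have "(\<lambda>p. \<lambda>i\<in>{..<n}. f (fst p) i + snd p i) \<in> M \<Otimes>\<^sub>M vspace n \<rightarrow>\<^sub>M vspace n"
    by (intro vspace_restrict_measurable borel_measurable_add measurable_compose[OF measurable_fst f] vspace_nth[OF measurable_snd]) auto
  then show "(\<lambda>(x, w). \<lambda>i\<in>{..<n}. f x i + w i) \<in> M \<Otimes>\<^sub>M vspace n \<rightarrow>\<^sub>M vspace n"
    by (simp add: case_prod_unfold)
qed

lemma sets_add_noise[simp, measurable_cong]: "sets (add_noise n v u) = sets (vspace n)"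
  by (simp add: add_noise_def)

lemma add_noise_cong: "(\<And>i. i < n \<Longrightarrow> u i = u' i) \<Longrightarrow> add_noise n v u = add_noise n v u'"
  unfolding add_noise_def by (intro distr_cong) (auto simp: restrict_def)

lemma LR_measurable_scaled[measurable (raw)]:
  "f \<in> M \<rightarrow>\<^sub>M vspace n \<Longrightarrow> g \<in> M \<rightarrow>\<^sub>M vspace n \<Longrightarrow> (\<lambda>x. LR n v w (\<lambda>i. \<beta> * f x i) (g x)) \<in> borel_measurable M"
  by (intro LR_measurable vspace_nth borel_measurable_times borel_measurable_const)

lemma out_dist_kernel:
  assumes E: "K \<in> vspace n \<rightarrow>\<^sub>M prob_algebra (vspace n)" and v: "v > 0"
  shows "(\<lambda>s. bind (K s) (\<lambda>x. add_noise n v (\<lambda>i. x i + s i))) \<in> vspace n \<rightarrow>\<^sub>M prob_algebra (vspace n)"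
proof (rule measurable_bind_prob_space2[OF E])
  show "(\<lambda>(s, x). add_noise n v (\<lambda>i. x i + s i)) \<in> vspace n \<Otimes>\<^sub>M vspace n \<rightarrow>\<^sub>M prob_algebra (vspace n)"
    unfolding case_prod_unfold
    by (intro add_noise_kernel v borel_measurable_add vspace_nth[OF measurable_fst] vspace_nth[OF measurable_snd]) auto
qed

lemma prob_space_out_dist:
  assumes "enc m k \<in> vspace n \<rightarrow>\<^sub>M prob_algebra (vspace n)" "v > 0" "T > 0"
  shows "prob_space (out_dist n T v enc m k)" "sets (out_dist n T v enc m k) = sets (vspace n)"
proof -
  have "gauss_iid n T \<in> space (prob_algebra (vspace n))"
    using assms by (simp add: space_prob_algebra prob_space_gauss_iid)
  then have "(\<lambda>_::nat. gauss_iid n T) \<in> count_space UNIV \<rightarrow>\<^sub>M prob_algebra (vspace n)" by simp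
  from measurable_space[OF measurable_bind_prob_space[OF this out_dist_kernel[of "enc m k", OF assms(1,2)]], of 0]
  have "out_dist n T v enc m k \<in> space (prob_algebra (vspace n))" unfolding out_dist_def by simp
  then show "prob_space (out_dist n T v enc m k)" "sets (out_dist n T v enc m k) = sets (vspace n)"
    by (auto simp: space_prob_algebra)
qed

lemma nn_integral_out_dist:
  assumes E: "enc m k \<in> vspace n \<rightarrow>\<^sub>M prob_algebra (vspace n)" and v: "v > 0" and f: "f \<in> borel_measurable (vspace n)"
  shows "(\<integral>\<^sup>+y. f y \<partial>out_dist n T v enc m k) =
    (\<integral>\<^sup>+s. \<integral>\<^sup>+x. \<integral>\<^sup>+y. f y \<partial>add_noise n v (\<lambda>i. x i + s i) \<partial>enc m k s \<partial>gauss_iid n T)"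
proof -
  have "(\<integral>\<^sup>+y. f y \<partial>out_dist n T v enc m k) =
    (\<integral>\<^sup>+s. \<integral>\<^sup>+y. f y \<partial>bind (enc m k s) (\<lambda>x. add_noise n v (\<lambda>i. x i + s i)) \<partial>gauss_iid n T)"
    unfolding out_dist_def
    using measurable_prob_algebraD[OF out_dist_kernel[of "enc m k", OF E v]] f by (intro nn_integral_bind[where B="vspace n"]) auto
  also have "\<dots> = (\<integral>\<^sup>+s. \<integral>\<^sup>+x. \<integral>\<^sup>+y. f y \<partial>add_noise n v (\<lambda>i. x i + s i) \<partial>enc m k s \<partial>gauss_iid n T)"
  proof (intro nn_integral_cong)
    fix s assume "s \<in> space (gauss_iid n T)"
    then have "enc m k s \<in> space (prob_algebra (vspace n))"
      using measurable_space[OF E] by simp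
    then have sets: "sets (enc m k s) = sets (vspace n)" by (simp add: space_prob_algebra)
    have "(\<lambda>x. add_noise n v (\<lambda>i. x i + s i)) \<in> vspace n \<rightarrow>\<^sub>M prob_algebra (vspace n)"
      by (intro add_noise_kernel v borel_measurable_add borel_measurable_const vspace_component)
    then have "(\<lambda>x. add_noise n v (\<lambda>i. x i + s i)) \<in> enc m k s \<rightarrow>\<^sub>M subprob_algebra (vspace n)"
      by (subst measurable_cong_sets[OF sets refl]) (rule measurable_prob_algebraD)
    then show "(\<integral>\<^sup>+y. f y \<partial>bind (enc m k s) (\<lambda>x. add_noise n v (\<lambda>i. x i + s i))) =
       (\<integral>\<^sup>+x. \<integral>\<^sup>+y. f y \<partial>add_noise n v (\<lambda>i. x i + s i) \<partial>enc m k s)"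
      by (rule nn_integral_bind[OF f])
  qed
  finally show ?thesis .
qed

text \<open>The weights \<open>\<rho> l s / L\<close> may sum to more than 1, hence the maximum in the denominator.
  Index \<open>L\<close> takes the leftover mass and stands for sending 0.\<close>

definition bin_weight :: "nat \<Rightarrow> (nat \<Rightarrow> 'a \<Rightarrow> real) \<Rightarrow> nat \<Rightarrow> 'a \<Rightarrow> real" where
  "bin_weight L \<rho> l s = (if l < L then \<rho> l s / max (real L) (\<Sum>j<L. \<rho> j s)
     else 1 - (\<Sum>j<L. \<rho> j s) / max (real L) (\<Sum>j<L. \<rho> j s))"

definition bin_input :: "nat \<Rightarrow> nat \<Rightarrow> real \<Rightarrow> (nat \<Rightarrow> nat \<Rightarrow> real) \<Rightarrow> nat \<Rightarrow> (nat \<Rightarrow> real) \<Rightarrow> nat \<Rightarrow> real" where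
  "bin_input n L c u l s = (\<lambda>i\<in>{..<n}. if l < L then u l i - c * s i else 0)"

definition bin_encoder :: "nat \<Rightarrow> nat \<Rightarrow> real \<Rightarrow> (nat \<Rightarrow> nat \<Rightarrow> real) \<Rightarrow> (nat \<Rightarrow> (nat \<Rightarrow> real) \<Rightarrow> real) \<Rightarrow> (nat \<Rightarrow> real) \<Rightarrow> (nat \<Rightarrow> real) measure" where
  "bin_encoder n L c u \<rho> s = distr (density (count_space {..L}) (\<lambda>l. ennreal (bin_weight L \<rho> l s))) (vspace n) (\<lambda>l. bin_input n L c u l s)"

lemma bin_weight_nonneg:
  assumes "L \<ge> 1" "\<And>l. \<rho> l s \<ge> 0" shows "bin_weight L \<rho> l s \<ge> 0"
  using assms by (auto simp: bin_weight_def intro!: divide_nonneg_nonneg)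

lemma bin_weight_sum:
  assumes "L \<ge> 1" shows "(\<Sum>l\<le>L. bin_weight L \<rho> l s) = 1"
proof -
  have "(\<Sum>l\<le>L. bin_weight L \<rho> l s) = (\<Sum>l<L. bin_weight L \<rho> l s) + bin_weight L \<rho> L s"
    by (simp flip: lessThan_Suc_atMost)
  also have "(\<Sum>l<L. bin_weight L \<rho> l s) = (\<Sum>j<L. \<rho> j s) / max (real L) (\<Sum>j<L. \<rho> j s)"
    by (simp add: bin_weight_def sum_divide_distrib)
  finally show ?thesis by (simp add: bin_weight_def)
qed

text \<open>Dividing by the maximum, and not by the sum of the ratios, makes this domination hold
  for every state; a fully normalised likelihood encoder would exceed the bound whenever the sum
  falls below \<open>L\<close>.\<close>

lemma bin_weight_le:
  assumes "L \<ge> 1" "\<And>l. \<rho> l s \<ge> 0" "l < L" shows "bin_weight L \<rho> l s \<le> \<rho> l s / real L"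
  using assms by (auto simp: bin_weight_def intro!: divide_left_mono)

text \<open>The fallback takes exactly the mass missing from the covering of the state by the bin,
  which is the quantity bounded by \<open>pos_part_le_relF\<close>.\<close>

lemma bin_weight_last:
  assumes "L \<ge> 1" shows "bin_weight L \<rho> L s = max 0 (1 - (\<Sum>j<L. \<rho> j s) / real L)"
  using assms by (auto simp: bin_weight_def max_def field_simps)

lemma bin_weight_measurable[measurable (raw)]:
  assumes [measurable]: "\<And>l. \<rho> l \<in> borel_measurable M"
  shows "bin_weight L \<rho> l \<in> borel_measurable M"
  unfolding bin_weight_def[abs_def] by measurable

lemma bin_input_measurable: "bin_input n L c u l \<in> vspace n \<rightarrow>\<^sub>M vspace n"
  unfolding bin_input_def[abs_def]
  by (cases "l < L"; intro vspace_restrict_measurable) (auto intro!: borel_measurable_diff borel_measurable_times vspace_component)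

lemma bin_input_space: "bin_input n L c u l s \<in> space (vspace n)"
  by (auto simp: bin_input_def vspace_def space_PiM)

lemma nn_integral_bin_encoder:
  assumes "f \<in> borel_measurable (vspace n)"
  shows "(\<integral>\<^sup>+x. f x \<partial>bin_encoder n L c u \<rho> s) = (\<Sum>l\<le>L. ennreal (bin_weight L \<rho> l s) * f (bin_input n L c u l s))"
  unfolding bin_encoder_def using assms bin_input_space
  by (subst nn_integral_distr) (auto simp: nn_integral_density nn_integral_count_space_finite)

lemma sets_bin_encoder[simp]: "sets (bin_encoder n L c u \<rho> s) = sets (vspace n)"
  by (simp add: bin_encoder_def)

lemma bin_encoder_kernel:
  assumes L: "L \<ge> 1" and \<rho>[measurable]: "\<And>l. \<rho> l \<in> borel_measurable (vspace n)" and \<rho>0: "\<And>l s. \<rho> l s \<ge> 0"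
  shows "bin_encoder n L c u \<rho> \<in> vspace n \<rightarrow>\<^sub>M prob_algebra (vspace n)"
proof (rule measurable_prob_algebraI)
  have em: "emeasure (bin_encoder n L c u \<rho> s) A = (\<Sum>l\<le>L. ennreal (bin_weight L \<rho> l s) * indicator A (bin_input n L c u l s))"
    if "A \<in> sets (vspace n)" for A s
    using that nn_integral_bin_encoder[of "indicator A" n L c u \<rho> s] by simp
  show p: "prob_space (bin_encoder n L c u \<rho> s)" for s
  proof
    have "emeasure (bin_encoder n L c u \<rho> s) (space (bin_encoder n L c u \<rho> s)) = (\<Sum>l\<le>L. ennreal (bin_weight L \<rho> l s))"
      using em[of "space (vspace n)" s] sets_eq_imp_space_eq[OF sets_bin_encoder] bin_input_space by simp
    also have "\<dots> = 1"
      using bin_weight_sum[OF L, of \<rho> s] bin_weight_nonneg[OF L, of \<rho>] \<rho>0 by (simp add: sum_ennreal)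
    finally show "emeasure (bin_encoder n L c u \<rho> s) (space (bin_encoder n L c u \<rho> s)) = 1" .
  qed
  show "bin_encoder n L c u \<rho> \<in> vspace n \<rightarrow>\<^sub>M subprob_algebra (vspace n)"
  proof (rule measurable_subprob_algebra)
    show "subprob_space (bin_encoder n L c u \<rho> s)" for s using p by (rule prob_space_imp_subprob_space)
    fix A assume A: "A \<in> sets (vspace n)"
    then have "(\<lambda>s. indicator A (bin_input n L c u l s) :: ennreal) \<in> borel_measurable (vspace n)" for l
      using measurable_compose[OF bin_input_measurable borel_measurable_indicator] by blast
    then show "(\<lambda>s. emeasure (bin_encoder n L c u \<rho> s) A) \<in> borel_measurable (vspace n)"
      unfolding em[OF A] by (intro borel_measurable_sum borel_measurable_times) auto
  qed simp
qed

text \<open>If the fallback is chosen the input is 0, so the output density of that part with respect to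
  the no-transmission output distribution is at most 1.\<close>

lemma bin_encoder_output:
  assumes L: "L \<ge> 1" and T: "T > 0" and v: "v > 0" and vS: "vS > 0"
    and enc: "enc m k = bin_encoder n L c u (\<lambda>l. LR n vS T (\<lambda>i. \<beta> * u l i))"
  obtains g b where "g \<in> borel_measurable (vspace n)" "b \<in> borel_measurable (vspace n)"
    "out_dist n T v enc m k = density (gauss_iid n (T + v)) (\<lambda>z. g z + b z)"
    "\<And>z. g z \<le> ennreal ((\<Sum>l<L. LR n (v + (1 - c)\<^sup>2 * vS) (T + v) (\<lambda>i. (1 + (1 - c) * \<beta>) * u l i) z) / real L)"
    "\<And>z. b z \<le> 1"
    "(\<integral>\<^sup>+z. b z \<partial>gauss_iid n (T + v)) =
      (\<integral>\<^sup>+s. ennreal (max 0 (1 - (\<Sum>l<L. LR n vS T (\<lambda>i. \<beta> * u l i) s) / real L)) \<partial>gauss_iid n T)"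
proof -
  let ?Q = "gauss_iid n (T + v)" and ?G = "gauss_iid n T"
    and ?L = "\<lambda>l z. LR n (v + (1 - c)\<^sup>2 * vS) (T + v) (\<lambda>i. (1 + (1 - c) * \<beta>) * u l i) z"
  define \<rho> where "\<rho> l = LR n vS T (\<lambda>i. \<beta> * u l i)" for l
  have \<rho>m[measurable]: "\<rho> l \<in> borel_measurable (vspace n)" for l unfolding \<rho>_def by measurable
  have \<rho>0: "\<rho> l s \<ge> 0" for l s unfolding \<rho>_def by (intro less_imp_le LR_pos vS T)
  have w: "T + v > 0" using T v by simp
  define W where "W l s = ennreal (bin_weight L \<rho> l s)" for l s
  have Wm[measurable]: "W l \<in> borel_measurable (vspace n)" for l
    unfolding W_def by (intro measurable_compose[OF bin_weight_measurable measurable_ennreal] \<rho>m)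
  \<comment> \<open>Mean of the output given index and state: \<open>u - c * s + s\<close>, or just
    \<open>s\<close> for the fallback.\<close>
  define D where "D l s = (\<lambda>i. if l < L then u l i + (1 - c) * s i else s i)" for l and s :: "nat \<Rightarrow> real"
  define R where "R l s z = ennreal (LR n v (T + v) (D l s) z)" for l s z
  have Rm: "(\<lambda>p. R l (fst p) (snd p)) \<in> borel_measurable (vspace n \<Otimes>\<^sub>M vspace n)" for l
    unfolding R_def D_def
    by (cases "l < L"; intro measurable_compose[OF LR_measurable measurable_ennreal] vspace_nth[OF measurable_snd])
      (auto intro!: borel_measurable_add borel_measurable_times vspace_nth[OF measurable_fst])
  have Rm'[measurable]: "(\<lambda>(s, z). R l s z) \<in> borel_measurable (vspace n \<Otimes>\<^sub>M vspace n)" for l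
    using Rm by (simp add: case_prod_unfold)
  interpret GT: prob_space "?G" by (rule prob_space_gauss_iid[OF T])
  interpret Gw: prob_space "?Q" by (rule prob_space_gauss_iid[OF w])
  interpret PS: pair_sigma_finite "?G" "?Q" ..
  \<comment> \<open>Output density, relative to the law without transmission, contributed by index
    \<open>l\<close>.\<close>
  define q where "q l z = (\<integral>\<^sup>+s. W l s * R l s z \<partial>?G)" for l z
  have qm[measurable]: "q l \<in> borel_measurable (vspace n)" for l
    unfolding q_def by measurable
  define g where "g z = (\<Sum>l<L. q l z)" for z
  define b where "b z = q L z" for z
  have E: "enc m k \<in> vspace n \<rightarrow>\<^sub>M prob_algebra (vspace n)"
    unfolding enc \<rho>_def[symmetric] by (intro bin_encoder_kernel L \<rho>m \<rho>0)
  have gb: "g z + b z = (\<Sum>l\<le>L. q l z)" for z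
    by (simp add: g_def b_def flip: lessThan_Suc_atMost)
  show thesis
  proof
    show "g \<in> borel_measurable (vspace n)" "b \<in> borel_measurable (vspace n)"
      unfolding g_def b_def by measurable
    show "out_dist n T v enc m k = density (?Q) (\<lambda>z. g z + b z)"
    proof (rule measure_eqI)
      show "sets (out_dist n T v enc m k) = sets (density (?Q) (\<lambda>z. g z + b z))"
        using prob_space_out_dist[where enc=enc, OF E v T] by simp
      fix A assume "A \<in> sets (out_dist n T v enc m k)"
      then have A[measurable]: "A \<in> sets (vspace n)" using prob_space_out_dist[where enc=enc, OF E v T] by simp
      have iA: "(\<lambda>x. emeasure (add_noise n v (\<lambda>i. x i + s i)) A) \<in> borel_measurable (vspace n)" for s
        by (intro measurable_compose[OF measurable_prob_algebraD measurable_emeasure_subprob_algebra[OF A]]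
          add_noise_kernel v borel_measurable_add borel_measurable_const vspace_component)
      have "emeasure (out_dist n T v enc m k) A = (\<integral>\<^sup>+y. indicator A y \<partial>out_dist n T v enc m k)"
        using prob_space_out_dist[where enc=enc, OF E v T] A by simp
      also have "\<dots> = (\<integral>\<^sup>+s. \<integral>\<^sup>+x. \<integral>\<^sup>+y. indicator A y \<partial>add_noise n v (\<lambda>i. x i + s i) \<partial>enc m k s \<partial>?G)"
        by (intro nn_integral_out_dist E v) auto
      also have "\<dots> = (\<integral>\<^sup>+s. \<integral>\<^sup>+z. (\<Sum>l\<le>L. W l s * R l s z) * indicator A z \<partial>?Q \<partial>?G)"
      proof (intro nn_integral_cong)
        fix s assume s: "s \<in> space (?G)"
        have Rs[measurable]: "(\<lambda>z. R l s z) \<in> borel_measurable (vspace n)" for l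
          unfolding R_def by measurable
        have "(\<integral>\<^sup>+x. \<integral>\<^sup>+y. indicator A y \<partial>add_noise n v (\<lambda>i. x i + s i) \<partial>enc m k s) =
           (\<integral>\<^sup>+x. emeasure (add_noise n v (\<lambda>i. x i + s i)) A \<partial>enc m k s)" by simp
        also have "\<dots> = (\<Sum>l\<le>L. W l s * emeasure (add_noise n v (\<lambda>i. bin_input n L c u l s i + s i)) A)"
          unfolding enc \<rho>_def[symmetric] W_def by (intro nn_integral_bin_encoder iA)
        also have "\<dots> = (\<Sum>l\<le>L. W l s * (\<integral>\<^sup>+z. R l s z * indicator A z \<partial>?Q))"
        proof (intro sum.cong refl arg_cong2[where f="(*)"])
          fix l
          have "add_noise n v (\<lambda>i. bin_input n L c u l s i + s i) = add_noise n v (D l s)"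
            by (intro add_noise_cong) (auto simp: bin_input_def D_def algebra_simps)
          then show "emeasure (add_noise n v (\<lambda>i. bin_input n L c u l s i + s i)) A = (\<integral>\<^sup>+z. R l s z * indicator A z \<partial>?Q)"
            by (simp add: add_noise_density[OF v w] emeasure_density R_def)
        qed
        also have "\<dots> = (\<Sum>l\<le>L. \<integral>\<^sup>+z. W l s * (R l s z * indicator A z) \<partial>?Q)"
          by (intro sum.cong refl nn_integral_cmult[symmetric]) measurable
        also have "\<dots> = (\<integral>\<^sup>+z. (\<Sum>l\<le>L. W l s * (R l s z * indicator A z)) \<partial>?Q)"
          by (intro nn_integral_sum[symmetric]) measurable
        finally show "(\<integral>\<^sup>+x. \<integral>\<^sup>+y. indicator A y \<partial>add_noise n v (\<lambda>i. x i + s i) \<partial>enc m k s) =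
          (\<integral>\<^sup>+z. (\<Sum>l\<le>L. W l s * R l s z) * indicator A z \<partial>?Q)"
          by (simp add: sum_distrib_right mult.assoc)
      qed
      also have "\<dots> = (\<integral>\<^sup>+z. \<integral>\<^sup>+s. (\<Sum>l\<le>L. W l s * R l s z) * indicator A z \<partial>?G \<partial>?Q)"
        by (intro PS.Fubini'[symmetric]) measurable
      also have "\<dots> = (\<integral>\<^sup>+z. (g z + b z) * indicator A z \<partial>?Q)"
      proof (intro nn_integral_cong)
        fix z assume "z \<in> space (?Q)"
        then have [measurable]: "(\<lambda>s. R l s z) \<in> borel_measurable (vspace n)" for l by simp
        have "(\<integral>\<^sup>+s. (\<Sum>l\<le>L. W l s * R l s z) * indicator A z \<partial>?G) = (\<integral>\<^sup>+s. (\<Sum>l\<le>L. W l s * R l s z) \<partial>?G) * indicator A z"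
          by (intro nn_integral_multc) measurable
        also have "(\<integral>\<^sup>+s. (\<Sum>l\<le>L. W l s * R l s z) \<partial>?G) = (\<Sum>l\<le>L. q l z)"
          unfolding q_def by (intro nn_integral_sum) measurable
        finally show "(\<integral>\<^sup>+s. (\<Sum>l\<le>L. W l s * R l s z) * indicator A z \<partial>?G) = (g z + b z) * indicator A z"
          by (simp add: gb)
      qed
      also have "\<dots> = emeasure (density (?Q) (\<lambda>z. g z + b z)) A"
        unfolding gb by (subst emeasure_density) auto
      finally show "emeasure (out_dist n T v enc m k) A = emeasure (density (?Q) (\<lambda>z. g z + b z)) A" .
    qed
    show "g z \<le> ennreal ((\<Sum>l<L. ?L l z) / real L)" for z
    proof -
      have "q l z \<le> ennreal (?L l z / real L)" if l: "l < L" for l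
      proof -
        \<comment> \<open>Under the dominating weight the state has its Gaussian law conditioned on
          the codeword, so the integral over the state is a convolution with a closed form.\<close>
        have "q l z \<le> (\<integral>\<^sup>+s. ennreal (1 / real L) * (ennreal (LR n vS T (\<lambda>i. \<beta> * u l i) s) * ennreal (LR n v (T + v) (\<lambda>i. u l i + (1 - c) * s i) z)) \<partial>?G)"
          unfolding q_def
        proof (intro nn_integral_mono)
          fix s
          have "W l s \<le> ennreal (\<rho> l s / real L)"
            unfolding W_def using bin_weight_le[OF L, of \<rho> s l] \<rho>0 l by (intro ennreal_leI) auto
          also have "\<dots> = ennreal (1 / real L) * ennreal (\<rho> l s)"
            using \<rho>0[of l s] by (simp flip: ennreal_mult)
          finally have "W l s \<le> ennreal (1 / real L) * ennreal (\<rho> l s)" .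
          then have "W l s * R l s z \<le> ennreal (1 / real L) * ennreal (\<rho> l s) * R l s z" by (rule mult_right_mono) simp
          then show "W l s * R l s z \<le> ennreal (1 / real L) * (ennreal (LR n vS T (\<lambda>i. \<beta> * u l i) s) * ennreal (LR n v (T + v) (\<lambda>i. u l i + (1 - c) * s i) z))"
            using l by (simp add: R_def D_def \<rho>_def mult.assoc)
        qed
        also have "\<dots> = ennreal (1 / real L) * ennreal (LR n (v + (1 - c)\<^sup>2 * vS) (T + v) (\<lambda>i. u l i + (1 - c) * (\<beta> * u l i)) z)"
        proof (subst nn_integral_cmult)
          have "(\<lambda>s. LR n v (T + v) (\<lambda>i. u l i + (1 - c) * s i) z) \<in> borel_measurable (vspace n)"
            by (intro LR_measurable) (auto intro!: borel_measurable_add borel_measurable_times vspace_component)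
          then show "(\<lambda>s. ennreal (LR n vS T (\<lambda>i. \<beta> * u l i) s) * ennreal (LR n v (T + v) (\<lambda>i. u l i + (1 - c) * s i) z)) \<in> borel_measurable (?G)"
            by simp
        qed (simp add: LR_conv[OF T vS v w])
        also have "\<dots> = ennreal (?L l z / real L)"
          using LR_pos[of "v + (1 - c)\<^sup>2 * vS" "T + v" n] v vS w
          by (simp add: algebra_simps add_pos_nonneg less_imp_le flip: ennreal_mult)
        finally show ?thesis .
      qed
      then have "g z \<le> (\<Sum>l<L. ennreal (?L l z / real L))"
        unfolding g_def by (intro sum_mono) auto
      also have "\<dots> = ennreal ((\<Sum>l<L. ?L l z) / real L)"
        using v vS w
        by (subst sum_ennreal) (auto simp: sum_divide_distrib intro!: divide_nonneg_nonneg less_imp_le[OF LR_pos] add_pos_nonneg)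
      finally show ?thesis .
    qed
    have WL: "W L s = ennreal (max 0 (1 - (\<Sum>l<L. \<rho> l s) / real L))" for s
      by (simp add: W_def bin_weight_last[OF L])
    \<comment> \<open>With input 0 the output is state plus noise; in this form the state takes the
      place of a codeword with factor 1, so the ratio averages to 1 over the state.\<close>
    have RL: "R L s z = ennreal (LR n v (v + 1\<^sup>2 * T) (\<lambda>i. 1 * s i) z)" for s z
      by (simp add: R_def D_def add.commute)
    show "b z \<le> 1" for z
    proof -
      have "W L s \<le> 1" for s
        unfolding WL using \<rho>0 by (auto simp: max_def intro!: divide_nonneg_nonneg sum_nonneg)
      then have "b z \<le> (\<integral>\<^sup>+s. R L s z \<partial>?G)"
        unfolding b_def q_def by (intro nn_integral_mono) (metis mult_1 mult_right_mono zero_le)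
      also have "\<dots> = 1" unfolding RL by (rule nn_integral_LR_input[OF T v])
      finally show ?thesis .
    qed
    have "(\<integral>\<^sup>+z. b z \<partial>?Q) = (\<integral>\<^sup>+s. \<integral>\<^sup>+z. W L s * R L s z \<partial>?Q \<partial>?G)"
      unfolding b_def q_def by (intro PS.Fubini') measurable
    also have "\<dots> = (\<integral>\<^sup>+s. W L s \<partial>?G)"
    proof (intro nn_integral_cong)
      fix s
      have "(\<integral>\<^sup>+z. W L s * R L s z \<partial>?Q) = W L s * (\<integral>\<^sup>+z. R L s z \<partial>?Q)"
        by (intro nn_integral_cmult) (simp add: R_def)
      also have "(\<integral>\<^sup>+z. R L s z \<partial>?Q) = 1"
        unfolding R_def by (rule nn_integral_LR_output[OF v w])
      finally show "(\<integral>\<^sup>+z. W L s * R L s z \<partial>?Q) = W L s" by simp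
    qed
    finally show "(\<integral>\<^sup>+z. b z \<partial>?Q) =
      (\<integral>\<^sup>+s. ennreal (max 0 (1 - (\<Sum>l<L. LR n vS T (\<lambda>i. \<beta> * u l i) s) / real L)) \<partial>?G)"
      by (simp add: WL \<rho>_def)
  qed
qed

text \<open>The dominating weights make the state Gaussian with mean \<open>\<beta> * u\<close> and
  variance \<open>vS\<close>, and the fallback costs no power. Writing the input as
  \<open>- c * (s - u / c)\<close>, with \<open>c\<close> nonzero, reduces the power to a second
  moment about \<open>u / c\<close>.\<close>

lemma bin_encoder_power:
  assumes L: "L \<ge> 1" and n: "n \<ge> 1" and T: "T > 0" and vS: "vS > 0" and c: "c \<noteq> 0"
  shows "(\<integral>\<^sup>+s. \<integral>\<^sup>+x. ennreal ((\<Sum>i<n. (x i)\<^sup>2) / real n) \<partial>bin_encoder n L c u (\<lambda>l. LR n vS T (\<lambda>i. \<beta> * u l i)) s \<partial>gauss_iid n T)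
    \<le> ennreal ((\<Sum>l<L. (1 - c * \<beta>)\<^sup>2 * ((\<Sum>i<n. (u l i)\<^sup>2) / real n) + c\<^sup>2 * vS) / real L)"
proof -
  let ?G = "gauss_iid n T" and ?d = "\<lambda>l s. ennreal (\<Sum>i<n. (s i - u l i / c)\<^sup>2)"
    and ?p = "\<lambda>l. (1 - c * \<beta>)\<^sup>2 * ((\<Sum>i<n. (u l i)\<^sup>2) / real n) + c\<^sup>2 * vS"
  define \<rho> where "\<rho> l = LR n vS T (\<lambda>i. \<beta> * u l i)" for l
  have \<rho>m[measurable]: "\<rho> l \<in> borel_measurable (vspace n)" for l unfolding \<rho>_def by measurable
  have \<rho>0: "\<rho> l s \<ge> 0" for l s unfolding \<rho>_def by (intro less_imp_le LR_pos vS T)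
  have pm: "(\<lambda>x. ennreal ((\<Sum>i<n. (x i)\<^sup>2) / real n)) \<in> borel_measurable (vspace n)"
    by (intro measurable_compose[OF _ measurable_ennreal] borel_measurable_divide borel_measurable_sum borel_measurable_power borel_measurable_const vspace_component) auto
  have sm[measurable]: "(\<lambda>s. \<Sum>i<n. (s i - u l i / c)\<^sup>2) \<in> borel_measurable (vspace n)" for l
    by (intro borel_measurable_sum borel_measurable_power borel_measurable_diff borel_measurable_const vspace_component) auto
  have "(\<integral>\<^sup>+s. \<integral>\<^sup>+x. ennreal ((\<Sum>i<n. (x i)\<^sup>2) / real n) \<partial>bin_encoder n L c u \<rho> s \<partial>?G)
    = (\<integral>\<^sup>+s. (\<Sum>l\<le>L. ennreal (bin_weight L \<rho> l s) * ennreal ((\<Sum>i<n. (bin_input n L c u l s i)\<^sup>2) / real n)) \<partial>?G)"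
    by (simp add: nn_integral_bin_encoder[OF pm])
  also have "\<dots> \<le> (\<integral>\<^sup>+s. (\<Sum>l<L. ennreal (c\<^sup>2 / (real n * real L)) * (ennreal (\<rho> l s) * ?d l s)) \<partial>?G)"
  proof (intro nn_integral_mono)
    fix s
    have "ennreal (bin_weight L \<rho> l s) * ennreal ((\<Sum>i<n. (bin_input n L c u l s i)\<^sup>2) / real n)
      \<le> ennreal (c\<^sup>2 / (real n * real L)) * (ennreal (\<rho> l s) * ?d l s)" if l: "l < L" for l
    proof -
      have "(\<Sum>i<n. (bin_input n L c u l s i)\<^sup>2) = (\<Sum>i<n. c\<^sup>2 * (s i - u l i / c)\<^sup>2)"
        using l c by (intro sum.cong refl) (auto simp: bin_input_def power2_eq_square field_simps)
      then have eq: "(\<Sum>i<n. (bin_input n L c u l s i)\<^sup>2) = c\<^sup>2 * (\<Sum>i<n. (s i - u l i / c)\<^sup>2)"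
        by (simp add: sum_distrib_left)
      have S0: "0 \<le> (\<Sum>i<n. (s i - u l i / c)\<^sup>2)" by (intro sum_nonneg) auto
      have "ennreal (bin_weight L \<rho> l s) * ennreal ((\<Sum>i<n. (bin_input n L c u l s i)\<^sup>2) / real n)
         \<le> ennreal (\<rho> l s / real L) * ennreal (c\<^sup>2 * (\<Sum>i<n. (s i - u l i / c)\<^sup>2) / real n)"
        unfolding eq using bin_weight_le[OF L, of \<rho> s l] \<rho>0 l by (intro mult_right_mono ennreal_leI) auto
      also have "\<dots> = ennreal (c\<^sup>2 / (real n * real L)) * (ennreal (\<rho> l s) * ?d l s)"
        using S0 \<rho>0[of l s] by (simp add: field_simps flip: ennreal_mult)
      finally show ?thesis .
    qed
    moreover have "(\<Sum>i<n. (bin_input n L c u L s i)\<^sup>2) = 0"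
      by (intro sum.neutral) (auto simp: bin_input_def)
    ultimately show "(\<Sum>l\<le>L. ennreal (bin_weight L \<rho> l s) * ennreal ((\<Sum>i<n. (bin_input n L c u l s i)\<^sup>2) / real n))
      \<le> (\<Sum>l<L. ennreal (c\<^sup>2 / (real n * real L)) * (ennreal (\<rho> l s) * ?d l s))"
      by (auto simp flip: lessThan_Suc_atMost intro!: sum_mono)
  qed
  also have "\<dots> = (\<Sum>l<L. ennreal (c\<^sup>2 / (real n * real L)) * (\<integral>\<^sup>+s. ennreal (\<rho> l s) * ?d l s \<partial>?G))"
    by (simp add: nn_integral_sum nn_integral_cmult)
  also have "\<dots> = (\<Sum>l<L. ennreal ((?p l) / real L))"
  proof (intro sum.cong refl)
    fix l
    have "(\<integral>\<^sup>+s. ennreal (\<rho> l s) * ?d l s \<partial>?G)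
      = (\<integral>\<^sup>+s. ?d l s \<partial>add_noise n vS (\<lambda>i. \<beta> * u l i))"
      unfolding add_noise_density[OF vS T] \<rho>_def[symmetric] by (subst nn_integral_density) auto
    also have "\<dots> = ennreal ((\<Sum>i<n. (\<beta> * u l i - u l i / c)\<^sup>2) + real n * vS)"
      by (rule second_moment_add_noise[OF vS])
    finally have I: "(\<integral>\<^sup>+s. ennreal (\<rho> l s) * ?d l s \<partial>?G)
      = ennreal ((\<Sum>i<n. (\<beta> * u l i - u l i / c)\<^sup>2) + real n * vS)" .
    have "ennreal (c\<^sup>2 / (real n * real L)) * (\<integral>\<^sup>+s. ennreal (\<rho> l s) * ?d l s \<partial>?G)
      = ennreal (c\<^sup>2 / (real n * real L) * ((\<Sum>i<n. (\<beta> * u l i - u l i / c)\<^sup>2) + real n * vS))"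
      unfolding I using vS by (intro ennreal_mult[symmetric]) (auto intro!: add_nonneg_nonneg sum_nonneg)
    also have "(\<Sum>i<n. (\<beta> * u l i - u l i / c)\<^sup>2) = (1 - c * \<beta>)\<^sup>2 / c\<^sup>2 * (\<Sum>i<n. (u l i)\<^sup>2)"
      unfolding sum_distrib_left using c by (intro sum.cong refl) (simp add: power2_eq_square field_simps)
    also have "c\<^sup>2 / (real n * real L) * ((1 - c * \<beta>)\<^sup>2 / c\<^sup>2 * (\<Sum>i<n. (u l i)\<^sup>2) + real n * vS)
      = (?p l) / real L"
      using c n L by (simp add: field_simps)
    finally show "ennreal (c\<^sup>2 / (real n * real L)) * (\<integral>\<^sup>+s. ennreal (\<rho> l s) * ?d l s \<partial>?G)
      = ennreal ((?p l) / real L)" .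
  qed
  also have "\<dots> = ennreal (\<Sum>l<L. (?p l) / real L)"
    using vS by (intro sum_ennreal) (auto intro!: divide_nonneg_nonneg add_nonneg_nonneg mult_nonneg_nonneg sum_nonneg)
  finally show ?thesis unfolding \<rho>_def[abs_def] sum_divide_distrib[symmetric] .
qed

section \<open>Random codebooks\<close>

text \<open>The finite branch of \<open>rel_entropy\<close> also requires an integrable log-ratio;
  this holds because \<open>relF (h x)\<close> and \<open>h\<close> are integrable. The lower bound
  is there to squeeze the divergence to 0 later.\<close>

lemma rel_entropy_density:
  fixes h :: "'a \<Rightarrow> real"
  assumes Q: "prob_space Q" and h[measurable]: "h \<in> borel_measurable Q" and h0: "\<And>x. 0 \<le> h x"
    and h1: "(\<integral>\<^sup>+x. ennreal (h x) \<partial>Q) = 1" and B: "(\<integral>\<^sup>+x. ennreal (relF (h x)) \<partial>Q) \<le> ennreal B" "0 \<le> B"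
  shows "0 \<le> rel_entropy (density Q (\<lambda>x. ennreal (h x))) Q" "rel_entropy (density Q (\<lambda>x. ennreal (h x))) Q \<le> ereal B"
proof -
  interpret Q: prob_space Q by fact
  define N where "N = density Q (\<lambda>x. ennreal (h x))"
  have iF: "integrable Q (\<lambda>x. relF (h x))"
    using B relF_nonneg[OF h0] by (intro integrableI_nonneg) (auto intro: le_less_trans[OF B(1)])
  have ih: "integrable Q h" using h0 h1 by (intro integrableI_nonneg) auto
  have eh: "(\<integral>x. h x \<partial>Q) = 1" using h0 h1 by (simp add: integral_eq_nn_integral)
  have eq: "h x * ln (h x) = relF (h x) + h x - 1" for x by (simp add: relF_def)
  have iln: "integrable Q (\<lambda>x. h x * ln (h x))" unfolding eq using iF ih by auto
  have "(\<integral>x. h x * ln (h x) \<partial>Q) = (\<integral>x. relF (h x) \<partial>Q) + 1 - 1"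
    unfolding eq using iF ih eh by (simp add: Q.prob_space)
  then have int: "(\<integral>x. h x * ln (h x) \<partial>Q) = (\<integral>x. relF (h x) \<partial>Q)" by simp
  have AE: "AE x in Q. ennreal (h x) = RN_deriv Q N x"
    by (rule Q.RN_deriv_unique) (auto simp: N_def)
  have "integrable N (entropy_density (exp 1) Q N)"
    unfolding N_def
  proof (subst integrable_density)
    show "integrable Q (\<lambda>x. h x *\<^sub>R entropy_density (exp 1) Q (density Q (\<lambda>x. ennreal (h x))) x)"
    proof (rule integrable_cong_AE_imp[OF iln])
      show "AE x in Q. h x * ln (h x) = h x *\<^sub>R entropy_density (exp 1) Q (density Q (\<lambda>x. ennreal (h x))) x"
        using AE
      proof eventually_elim
        case (elim x)
        then have "enn2real (RN_deriv Q N x) = h x" using h0[of x] by (metis enn2real_ennreal)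
        then show ?case by (simp add: entropy_density_def N_def log_def)
      qed
    qed measurable
  qed (use h0 in auto)
  moreover have "absolutely_continuous Q N" unfolding N_def
    by (rule absolutely_continuousI_density) measurable
  moreover have "KL_divergence (exp 1) Q N = (\<integral>x. relF (h x) \<partial>Q)"
    unfolding N_def using h0 int by (subst Q.KL_density) (auto simp: log_def)
  ultimately have re: "rel_entropy N Q = ereal (\<integral>x. relF (h x) \<partial>Q)"
    by (simp add: rel_entropy_def N_def)
  show "0 \<le> rel_entropy (density Q (\<lambda>x. ennreal (h x))) Q"
    using re relF_nonneg[OF h0] by (simp add: N_def)
  have "ennreal (\<integral>x. relF (h x) \<partial>Q) \<le> ennreal B"
    using B iF relF_nonneg[OF h0] by (subst nn_integral_eq_integral[symmetric]) auto
  then show "rel_entropy (density Q (\<lambda>x. ennreal (h x))) Q \<le> ereal B"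
    using re B by (simp add: N_def)
qed

text \<open>Integrated form of \<open>relF_perturb\<close>. Both \<open>g\<close> and
  \<open>f + b\<close> have mass 1, so the deficit integrates to the mass of \<open>b\<close>, at
  most \<delta>.\<close>

lemma relF_density_perturb:
  assumes Q: "prob_space Q" and [measurable]: "g \<in> borel_measurable Q" "f \<in> borel_measurable Q" "b \<in> borel_measurable Q"
    and g0: "\<And>x. 0 \<le> g x" and g1: "(\<integral>\<^sup>+x. ennreal (g x) \<partial>Q) = 1"
    and f: "\<And>x. f x \<le> ennreal (g x)" and b: "\<And>x. b x \<le> 1"
    and fb1: "(\<integral>\<^sup>+x. f x + b x \<partial>Q) = 1" and \<delta>: "(\<integral>\<^sup>+x. b x \<partial>Q) \<le> ennreal \<delta>" "0 \<le> \<delta>"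
    and D: "(\<integral>\<^sup>+x. ennreal (relF (g x)) \<partial>Q) \<le> ennreal D" "0 \<le> D"
    and \<eta>: "\<eta> > 0" and c: "c \<ge> 1"
  shows "(\<integral>\<^sup>+x. ennreal (relF (enn2real (f x + b x))) \<partial>Q) \<le> ennreal (D + \<delta> * ln c + (1 + \<delta>) / c + \<delta> + \<eta> + D / (2 * \<eta>))"
proof -
  interpret Q: prob_space Q by fact
  have fin: "f x < top" "b x < top" for x
    using f[of x] b[of x] by (auto intro: le_less_trans[of _ "ennreal (g x)"] le_less_trans[of _ 1])
  define h where "h x = enn2real (f x + b x)" for x
  have h: "ennreal (h x) = f x + b x" for x using fin[of x] by (simp add: h_def)
  define b' where "b' x = enn2real (b x)" for x
  have b': "ennreal (b' x) = b x" for x using fin[of x] by (simp add: b'_def)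
  have [measurable]: "h \<in> borel_measurable Q" "b' \<in> borel_measurable Q" unfolding h_def b'_def by measurable
  have h0: "0 \<le> h x" "0 \<le> b' x" for x by (auto simp: h_def b'_def)
  have b1: "b' x \<le> 1" for x using b[of x] h0[of x] by (simp flip: b')
  have hgb: "h x \<le> g x + b' x" for x
  proof -
    have "ennreal (h x) \<le> ennreal (g x) + ennreal (b' x)" unfolding h b' using f by (intro add_right_mono)
    then show ?thesis using h0[of x] g0[of x] by (simp flip: ennreal_plus)
  qed
  \<comment> \<open>The subtracted \<open>h\<close> is moved to the left; its integral 1 is
    cancelled at the end.\<close>
  have pt: "relF (h x) + h x \<le> relF (g x) * (1 + 1 / (2 * \<eta>)) + b' x * ln c + (g x + b' x) * (1 / c) + g x + b' x + \<eta>" for x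
    using relF_perturb[OF h0(1) g0 h0(2) b1 hgb \<eta> c, of x] by (simp add: algebra_simps add_divide_distrib)
  have lc: "0 \<le> ln c" using c by simp
  have "(\<integral>\<^sup>+x. ennreal (relF (h x)) \<partial>Q) + 1 = (\<integral>\<^sup>+x. ennreal (relF (h x) + h x) \<partial>Q)"
    using h0 relF_nonneg[OF h0(1)] fb1 by (simp add: nn_integral_add h flip: h)
  also have "\<dots> \<le> (\<integral>\<^sup>+x. ennreal (relF (g x)) * ennreal (1 + 1 / (2 * \<eta>)) + ennreal (b' x) * ennreal (ln c)
     + (ennreal (g x) + ennreal (b' x)) * ennreal (1 / c) + ennreal (g x) + ennreal (b' x) + ennreal \<eta> \<partial>Q)"
  proof (intro nn_integral_mono)
    fix x
    have "ennreal (relF (g x)) * ennreal (1 + 1 / (2 * \<eta>)) + ennreal (b' x) * ennreal (ln c)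
     + (ennreal (g x) + ennreal (b' x)) * ennreal (1 / c) + ennreal (g x) + ennreal (b' x) + ennreal \<eta>
     = ennreal (relF (g x) * (1 + 1 / (2 * \<eta>)) + b' x * ln c + (g x + b' x) * (1 / c) + g x + b' x + \<eta>)"
      using h0[of x] g0[of x] relF_nonneg[OF g0] \<eta> c lc
      by (simp add: ennreal_mult[symmetric] ennreal_plus[symmetric] del: ennreal_plus)
    then show "ennreal (relF (h x) + h x) \<le> ennreal (relF (g x)) * ennreal (1 + 1 / (2 * \<eta>)) + ennreal (b' x) * ennreal (ln c)
     + (ennreal (g x) + ennreal (b' x)) * ennreal (1 / c) + ennreal (g x) + ennreal (b' x) + ennreal \<eta>"
      using pt[of x] by (simp add: ennreal_leI)
  qed
  also have "\<dots> = (\<integral>\<^sup>+x. ennreal (relF (g x)) \<partial>Q) * ennreal (1 + 1 / (2 * \<eta>)) + (\<integral>\<^sup>+x. b x \<partial>Q) * ennreal (ln c)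
     + (1 + (\<integral>\<^sup>+x. b x \<partial>Q)) * ennreal (1 / c) + 1 + (\<integral>\<^sup>+x. b x \<partial>Q) + ennreal \<eta>"
    by (simp add: nn_integral_add nn_integral_multc g1 b' Q.emeasure_space_1)
  also have "\<dots> \<le> ennreal D * ennreal (1 + 1 / (2 * \<eta>)) + ennreal \<delta> * ennreal (ln c)
     + (1 + ennreal \<delta>) * ennreal (1 / c) + 1 + ennreal \<delta> + ennreal \<eta>"
    using \<delta> D by (intro add_mono mult_right_mono order_refl) auto
  also have "\<dots> = ennreal (D * (1 + 1 / (2 * \<eta>)) + \<delta> * ln c + (1 + \<delta>) * (1 / c) + 1 + \<delta> + \<eta>)"
    using \<delta> D \<eta> c lc
    by (simp add: ennreal_mult[symmetric] ennreal_plus[symmetric] ennreal_1[symmetric] del: ennreal_plus ennreal_1)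
  also have "D * (1 + 1 / (2 * \<eta>)) + \<delta> * ln c + (1 + \<delta>) * (1 / c) + 1 + \<delta> + \<eta> = (D + \<delta> * ln c + (1 + \<delta>) / c + \<delta> + \<eta> + D / (2 * \<eta>)) + 1"
    by (simp add: algebra_simps)
  also have "ennreal \<dots> = ennreal (D + \<delta> * ln c + (1 + \<delta>) / c + \<delta> + \<eta> + D / (2 * \<eta>)) + 1"
    using \<delta> D \<eta> c lc by (subst ennreal_plus) auto
  finally show ?thesis by (simp add: h_def)
qed

text \<open>The exponent of \<open>LR_moment\<close>: \<open>cumulant v w t\<close> is the logarithmic moment per letter of the likelihood ratio under
  the joint law; to first order in \<open>t\<close> it is \<open>t\<close> times the mutual information \<open>ln (w / v) / 2\<close>.\<close>

definition cumulant :: "real \<Rightarrow> real \<Rightarrow> real \<Rightarrow> real" where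
  "cumulant v w t = t * (ln (w / v) / 2) - ln (1 - t\<^sup>2 * (1 - v / w)) / 2"

text \<open>Error bound given that codeword \<open>j\<close> is sent: its output law is rewritten as
  a ratio times the reference law, and \<open>I\<close> is the set of its rivals.\<close>

definition codeword_error :: "nat \<Rightarrow> real \<Rightarrow> real \<Rightarrow> real \<Rightarrow> real \<Rightarrow> 'j set \<Rightarrow> ('j \<Rightarrow> nat \<Rightarrow> real) \<Rightarrow> 'j \<Rightarrow> ennreal" where
  "codeword_error n v w \<beta> \<theta> I C j = (\<integral>\<^sup>+y. ennreal (LR n v w (\<lambda>i. \<beta> * C j i) y) *
     penalty \<theta> I (\<lambda>i. LR n v w (\<lambda>l. \<beta> * C i l) y) j \<partial>gauss_iid n w)"

text \<open>Relative entropy of the uniform mixture over the codewords in \<open>I\<close> with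
  respect to the reference. It is used for the state with single bins and for the warden's output
  with the whole codebook.\<close>

definition cover_div :: "nat \<Rightarrow> real \<Rightarrow> real \<Rightarrow> real \<Rightarrow> 'j set \<Rightarrow> ('j \<Rightarrow> nat \<Rightarrow> real) \<Rightarrow> ennreal" where
  "cover_div n v w \<beta> I C = (\<integral>\<^sup>+s. ennreal (relF ((\<Sum>j\<in>I. LR n v w (\<lambda>i. \<beta> * C j i) s) / real (card I))) \<partial>gauss_iid n w)"

lemma cover_div_expectation:
  assumes V: "V > 0" and v: "v > 0" and w: "w = v + \<beta>\<^sup>2 * V" and J: "finite J" "I \<subseteq> J" "I \<noteq> {}" and t: "0 < t" "t < 1"
  shows "(\<integral>\<^sup>+C. cover_div n v w \<beta> I C \<partial>PiM J (\<lambda>_. gauss_iid n V))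
    \<le> ennreal (real (card I) powr - t / t * exp (real n * cumulant v w t))"
proof -
  have w0: "w > 0" using V v w by (simp add: add_pos_nonneg)
  have "(\<integral>\<^sup>+C. cover_div n v w \<beta> I C \<partial>PiM J (\<lambda>_. gauss_iid n V))
    \<le> ennreal (real (card I) powr - t / t) * (\<integral>\<^sup>+z. \<integral>\<^sup>+u. ennreal (LR n v w (\<lambda>i. \<beta> * u i) z powr (1 + t)) \<partial>gauss_iid n V \<partial>gauss_iid n w)"
    unfolding cover_div_def
  proof (rule soft_covering[where \<rho>="\<lambda>u z. LR n v w (\<lambda>i. \<beta> * u i) z"])
    show "(\<lambda>(u, z). LR n v w (\<lambda>i. \<beta> * u i) z) \<in> borel_measurable (gauss_iid n V \<Otimes>\<^sub>M gauss_iid n w)"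
      unfolding case_prod_unfold by measurable
    show "(\<integral>\<^sup>+u. ennreal (LR n v w (\<lambda>i. \<beta> * u i) z) \<partial>gauss_iid n V) = 1" for z
      unfolding w using V v by (rule nn_integral_LR_input)
  qed (use V v w0 J t in \<open>auto intro!: prob_space_gauss_iid less_imp_le[OF LR_pos]\<close>)
  also have "\<dots> = ennreal (real (card I) powr - t / t) * ennreal (exp (real n * cumulant v w t))"
    using LR_moment[OF V v, of t n \<beta>] t unfolding w cumulant_def by simp
  finally show ?thesis using t by (subst ennreal_mult) auto
qed

lemma codeword_error_expectation:
  assumes V: "V > 0" and v: "v > 0" and w: "w = v + \<beta>\<^sup>2 * V" and J: "finite J" "j \<in> J" "I \<subseteq> J - {j}" and t: "0 < t" "t < 1"
    and \<theta>: "\<theta> > 0"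
  shows "(\<integral>\<^sup>+C. codeword_error n v w \<beta> \<theta> I C j \<partial>PiM J (\<lambda>_. gauss_iid n V))
    \<le> ennreal (\<theta> powr t * exp (real n * cumulant v w (- t)) + real (card I) / \<theta>)"
proof -
  have w0: "w > 0" using V v w by (simp add: add_pos_nonneg)
  have "(\<integral>\<^sup>+C. codeword_error n v w \<beta> \<theta> I C j \<partial>PiM J (\<lambda>_. gauss_iid n V))
    \<le> ennreal (\<theta> powr t) * (\<integral>\<^sup>+z. \<integral>\<^sup>+u. ennreal (LR n v w (\<lambda>i. \<beta> * u i) z powr (1 - t)) \<partial>gauss_iid n V \<partial>gauss_iid n w) + ennreal (real (card I) / \<theta>)"
    unfolding codeword_error_def
  proof (rule threshold_decoding[where \<rho>="\<lambda>u z. LR n v w (\<lambda>i. \<beta> * u i) z"])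
    show "(\<lambda>(u, z). LR n v w (\<lambda>i. \<beta> * u i) z) \<in> borel_measurable (gauss_iid n V \<Otimes>\<^sub>M gauss_iid n w)"
      unfolding case_prod_unfold by measurable
    show "(\<integral>\<^sup>+u. ennreal (LR n v w (\<lambda>i. \<beta> * u i) z) \<partial>gauss_iid n V) = 1" for z
      unfolding w using V v by (rule nn_integral_LR_input)
  qed (use V v w0 J t \<theta> in \<open>auto intro!: prob_space_gauss_iid less_imp_le[OF LR_pos]\<close>)
  also have "(\<integral>\<^sup>+z. \<integral>\<^sup>+u. ennreal (LR n v w (\<lambda>i. \<beta> * u i) z powr (1 - t)) \<partial>gauss_iid n V \<partial>gauss_iid n w) = ennreal (exp (real n * cumulant v w (- t)))"
    using LR_moment[OF V v, of "- t" n \<beta>] t unfolding w cumulant_def by simp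
  finally show ?thesis using \<theta> by (simp add: ennreal_mult)
qed

lemma codeword_power_expectation:
  assumes V: "V > 0" and n: "n \<ge> 1" and J: "finite J" "j \<in> J" and a: "0 \<le> a" "0 \<le> d"
  shows "(\<integral>\<^sup>+C. ennreal (a * ((\<Sum>i<n. (C j i)\<^sup>2) / real n) + d) \<partial>PiM J (\<lambda>_. gauss_iid n V)) = ennreal (a * V + d)"
proof -
  interpret G: prob_space "gauss_iid n V" by (rule prob_space_gauss_iid[OF V])
  have [measurable]: "(\<lambda>u. \<Sum>i<n. (u i)\<^sup>2) \<in> borel_measurable (vspace n)"
    by (intro borel_measurable_sum borel_measurable_power vspace_component) auto
  have "(\<integral>\<^sup>+C. ennreal (a * ((\<Sum>i<n. (C j i)\<^sup>2) / real n) + d) \<partial>PiM J (\<lambda>_. gauss_iid n V))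
    = (\<integral>\<^sup>+u. ennreal (a * ((\<Sum>i<n. (u i)\<^sup>2) / real n) + d) \<partial>gauss_iid n V)"
    using J by (intro nn_integral_PiM_component[where f="\<lambda>u. ennreal (a * ((\<Sum>i<n. (u i)\<^sup>2) / real n) + d)"] prob_space_gauss_iid V) auto
  also have "\<dots> = (\<integral>\<^sup>+u. ennreal (a / real n) * ennreal (\<Sum>i<n. (u i)\<^sup>2) + ennreal d \<partial>gauss_iid n V)"
    using a by (intro nn_integral_cong) (simp add: sum_nonneg ennreal_mult[symmetric])
  also have "\<dots> = ennreal (a / real n) * (\<integral>\<^sup>+u. ennreal (\<Sum>i<n. (u i)\<^sup>2) \<partial>gauss_iid n V) + ennreal d"
    by (simp add: nn_integral_add nn_integral_cmult G.emeasure_space_1[simplified])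
  also have "(\<integral>\<^sup>+u. ennreal (\<Sum>i<n. (u i)\<^sup>2) \<partial>gauss_iid n V) = ennreal (real n * V)"
    using second_moment_add_noise[OF V, of n "\<lambda>_. 0" "\<lambda>_. 0"] by (simp add: add_noise_zero[OF V])
  finally show ?thesis using a n V by (simp add: ennreal_mult[symmetric])
qed

lemma codebook_measurable:
  assumes J: "j \<in> J" and f: "f \<in> M \<rightarrow>\<^sub>M PiM J (\<lambda>_. gauss_iid n V)"
  shows "(\<lambda>x. f x j) \<in> M \<rightarrow>\<^sub>M vspace n"
proof -
  have "(\<lambda>C. C j) \<in> PiM J (\<lambda>_. gauss_iid n V) \<rightarrow>\<^sub>M gauss_iid n V" using J by (rule measurable_component_singleton)
  then have "(\<lambda>C. C j) \<in> PiM J (\<lambda>_. gauss_iid n V) \<rightarrow>\<^sub>M vspace n" by (simp add: measurable_cong_sets[OF refl sets_gauss_iid])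
  with f show ?thesis by (rule measurable_compose)
qed

lemma codebook_functionals_measurable:
  assumes w: "w > 0" and J: "I \<subseteq> J"
  shows "cover_div n v w \<beta> I \<in> borel_measurable (PiM J (\<lambda>_. gauss_iid n V))"
    and "j \<in> J \<Longrightarrow> (\<lambda>C. codeword_error n v w \<beta> \<theta> I C j) \<in> borel_measurable (PiM J (\<lambda>_. gauss_iid n V))"
    and "j \<in> J \<Longrightarrow> (\<lambda>C. ennreal (a * ((\<Sum>i<n. (C j i)\<^sup>2) / real n) + d)) \<in> borel_measurable (PiM J (\<lambda>_. gauss_iid n V))"
proof -
  interpret G: prob_space "gauss_iid n w" by (rule prob_space_gauss_iid[OF w])
  have "snd \<in> PiM J (\<lambda>_. gauss_iid n V) \<Otimes>\<^sub>M gauss_iid n w \<rightarrow>\<^sub>M gauss_iid n w" by (rule measurable_snd)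
  then have sn: "snd \<in> PiM J (\<lambda>_. gauss_iid n V) \<Otimes>\<^sub>M gauss_iid n w \<rightarrow>\<^sub>M vspace n"
    by (simp add: measurable_cong_sets[OF refl sets_gauss_iid])
  have m: "(\<lambda>p. LR n v w (\<lambda>l. \<beta> * fst p i l) (snd p)) \<in> borel_measurable (PiM J (\<lambda>_. gauss_iid n V) \<Otimes>\<^sub>M gauss_iid n w)" if "i \<in> J" for i
    by (intro LR_measurable_scaled[where f="\<lambda>p. fst p i" and g=snd] codebook_measurable[OF that measurable_fst] sn)
  then have [measurable]: "(\<lambda>(C, y). LR n v w (\<lambda>l. \<beta> * C i l) y) \<in> borel_measurable (PiM J (\<lambda>_. gauss_iid n V) \<Otimes>\<^sub>M gauss_iid n w)" if "i \<in> J" for i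
    using that by (simp add: case_prod_unfold)
  have [measurable]: "(\<lambda>(C, y). LR n v w (\<lambda>l. \<beta> * C i l) y) \<in> borel_measurable (PiM J (\<lambda>_. gauss_iid n V) \<Otimes>\<^sub>M gauss_iid n w)" if "i \<in> I" for i
    using that J m by (auto simp: case_prod_unfold)
  show "cover_div n v w \<beta> I \<in> borel_measurable (PiM J (\<lambda>_. gauss_iid n V))"
    unfolding cover_div_def[abs_def] by measurable
  show "(\<lambda>C. codeword_error n v w \<beta> \<theta> I C j) \<in> borel_measurable (PiM J (\<lambda>_. gauss_iid n V))" if [simp]: "j \<in> J"
    unfolding codeword_error_def[abs_def] by measurable
  show "(\<lambda>C. ennreal (a * ((\<Sum>i<n. (C j i)\<^sup>2) / real n) + d)) \<in> borel_measurable (PiM J (\<lambda>_. gauss_iid n V))" if "j \<in> J"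
    by (intro measurable_compose[OF _ measurable_ennreal] borel_measurable_add borel_measurable_times borel_measurable_divide
      borel_measurable_sum borel_measurable_power borel_measurable_const vspace_nth[OF codebook_measurable[OF that, where f="\<lambda>C. C" and V=V]]) auto
qed

lemma exists_le_of_expectation:
  assumes "prob_space M" "f \<in> borel_measurable M" "(\<integral>\<^sup>+x. f x \<partial>M) < 1"
  shows "\<exists>x. f x < 1"
proof (rule ccontr)
  assume "\<not> ?thesis"
  then have "(\<integral>\<^sup>+x. 1 \<partial>M) \<le> (\<integral>\<^sup>+x. f x \<partial>M)" by (intro nn_integral_mono) (auto simp: not_less)
  then show False using assms prob_space.emeasure_space_1[OF assms(1)] by simp
qed

section \<open>Averages over messages, keys and bin indices\<close>

definition code_avg :: "nat \<Rightarrow> nat \<Rightarrow> (nat \<Rightarrow> nat \<Rightarrow> ennreal) \<Rightarrow> ennreal" where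
  "code_avg M K f = ennreal (1 / (real M * real K)) * (\<Sum>m\<in>{1..M}. \<Sum>k\<in>{1..K}. f m k)"

lemma code_avg_mono:
  "(\<And>m k. m \<in> {1..M} \<Longrightarrow> k \<in> {1..K} \<Longrightarrow> f m k \<le> g m k) \<Longrightarrow> code_avg M K f \<le> code_avg M K g"
  unfolding code_avg_def by (intro mult_left_mono sum_mono) auto

lemma code_avg_add: "code_avg M K (\<lambda>m k. f m k + g m k) = code_avg M K f + code_avg M K g"
  by (simp add: code_avg_def sum.distrib distrib_left)

lemma code_avg_cmult: "code_avg M K (\<lambda>m k. c * f m k) = c * code_avg M K f"
  by (simp add: code_avg_def sum_distrib_left[symmetric] mult.left_commute)

lemma code_avg_const:
  assumes "M \<ge> 1" "K \<ge> 1" "c \<ge> 0"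
  shows "code_avg M K (\<lambda>m k. ennreal c) = ennreal c"
  using assms by (simp add: code_avg_def ennreal_of_nat_eq_real_of_nat ennreal_mult[symmetric])

lemma code_avg_le:
  assumes "M \<ge> 1" "K \<ge> 1" "c \<ge> 0" "\<And>m k. m \<in> {1..M} \<Longrightarrow> k \<in> {1..K} \<Longrightarrow> f m k \<le> ennreal c"
  shows "code_avg M K f \<le> ennreal c"
  using code_avg_mono[of M K f "\<lambda>m k. ennreal c"] assms by (simp add: code_avg_const)

lemma nn_integral_code_avg:
  assumes "\<And>m k. m \<in> {1..M} \<Longrightarrow> k \<in> {1..K} \<Longrightarrow> f m k \<in> borel_measurable A"
  shows "(\<lambda>x. code_avg M K (\<lambda>m k. f m k x)) \<in> borel_measurable A"
    and "(\<integral>\<^sup>+x. code_avg M K (\<lambda>m k. f m k x) \<partial>A) = code_avg M K (\<lambda>m k. \<integral>\<^sup>+x. f m k x \<partial>A)"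
proof -
  have "(\<lambda>x. \<Sum>m\<in>{1..M}. \<Sum>k\<in>{1..K}. f m k x) \<in> borel_measurable A" using assms by (intro borel_measurable_sum) auto
  moreover have double: "(\<integral>\<^sup>+x. (\<Sum>m\<in>{1..M}. \<Sum>k\<in>{1..K}. f m k x) \<partial>A) = (\<Sum>m\<in>{1..M}. \<Sum>k\<in>{1..K}. \<integral>\<^sup>+x. f m k x \<partial>A)"
  proof -
    have "(\<integral>\<^sup>+x. (\<Sum>m\<in>{1..M}. \<Sum>k\<in>{1..K}. f m k x) \<partial>A) = (\<Sum>m\<in>{1..M}. \<integral>\<^sup>+x. (\<Sum>k\<in>{1..K}. f m k x) \<partial>A)"
      using assms by (intro nn_integral_sum borel_measurable_sum)
    also have "\<dots> = (\<Sum>m\<in>{1..M}. \<Sum>k\<in>{1..K}. \<integral>\<^sup>+x. f m k x \<partial>A)"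
      using assms by (intro sum.cong refl nn_integral_sum)
    finally show ?thesis .
  qed
  ultimately show "(\<lambda>x. code_avg M K (\<lambda>m k. f m k x)) \<in> borel_measurable A"
    "(\<integral>\<^sup>+x. code_avg M K (\<lambda>m k. f m k x) \<partial>A) = code_avg M K (\<lambda>m k. \<integral>\<^sup>+x. f m k x \<partial>A)"
    using double unfolding code_avg_def by (simp_all add: nn_integral_cmult)
qed

definition code_index :: "nat \<Rightarrow> nat \<Rightarrow> nat \<Rightarrow> (nat \<times> nat \<times> nat) set" where
  "code_index M K L = {1..M} \<times> {1..K} \<times> {..<L}"

definition bin_index :: "nat \<Rightarrow> nat \<Rightarrow> nat \<Rightarrow> (nat \<times> nat \<times> nat) set" where
  "bin_index L m k = (\<lambda>l. (m, k, l)) ` {..<L}"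

text \<open>Rivals carry another message under the same key: the decoder knows the key, and
  confusing codewords within a bin causes no message error. So the number of rivals, and with it the
  decoding condition, does not grow with the key.\<close>

definition rival_index :: "nat \<Rightarrow> nat \<Rightarrow> nat \<times> nat \<times> nat \<Rightarrow> (nat \<times> nat \<times> nat) set" where
  "rival_index M L j = ({1..M} - {fst j}) \<times> {fst (snd j)} \<times> {..<L}"

definition index_avg :: "nat \<Rightarrow> nat \<Rightarrow> nat \<Rightarrow> (nat \<times> nat \<times> nat \<Rightarrow> ennreal) \<Rightarrow> ennreal" where
  "index_avg M K L f = code_avg M K (\<lambda>m k. ennreal (1 / real L) * (\<Sum>l<L. f (m, k, l)))"

lemma card_code_index: "card (code_index M K L) = M * K * L"
  by (simp add: code_index_def card_cartesian_product mult.assoc)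

lemma card_bin_index: "card (bin_index L m k) = L"
  unfolding bin_index_def by (subst card_image) (auto simp: inj_on_def)

lemma sum_bin_index: "(\<Sum>j\<in>bin_index L m k. f j) = (\<Sum>l<L. f (m, k, l))"
  unfolding bin_index_def by (subst sum.reindex) (auto simp: inj_on_def)

lemma card_rival_index: "card (rival_index M L j) \<le> M * L"
  unfolding rival_index_def card_cartesian_product by (auto simp: card_Diff_singleton_if)

text \<open>The nested average follows the structure of the code; the flat one is the mixture over
  the whole codebook that the warden sees.\<close>

lemma index_avg_eq: "index_avg M K L f = ennreal (1 / real (card (code_index M K L))) * (\<Sum>j\<in>code_index M K L. f j)"
proof -
  have "(\<Sum>m\<in>{1..M}. \<Sum>k\<in>{1..K}. \<Sum>l<L. f (m, k, l)) = (\<Sum>j\<in>code_index M K L. f j)"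
    by (simp add: code_index_def sum.cartesian_product case_prod_unfold)
  moreover have "ennreal (1 / real (card (code_index M K L))) = ennreal (1 / (real M * real K)) * ennreal (1 / real L)"
    by (simp add: card_code_index ennreal_mult[symmetric])
  ultimately show ?thesis
    by (simp add: index_avg_def code_avg_def sum_distrib_left[symmetric] mult.assoc)
qed

lemma index_avg_le:
  assumes "M \<ge> 1" "K \<ge> 1" "L \<ge> 1" "x \<ge> 0" "\<And>j. j \<in> code_index M K L \<Longrightarrow> f j \<le> ennreal x"
  shows "index_avg M K L f \<le> ennreal x"
  unfolding index_avg_def
proof (intro code_avg_le assms)
  fix m k assume "m \<in> {1..M}" "k \<in> {1..K}"
  then have "ennreal (1 / real L) * (\<Sum>l<L. f (m, k, l)) \<le> ennreal (1 / real L) * (\<Sum>l<L. ennreal x)"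
    by (intro mult_left_mono sum_mono assms(5)) (auto simp: code_index_def)
  also have "\<dots> = ennreal x"
    using assms by (simp add: ennreal_of_nat_eq_real_of_nat ennreal_mult[symmetric] mult.assoc[symmetric])
  finally show "ennreal (1 / real L) * (\<Sum>l<L. f (m, k, l)) \<le> ennreal x" .
qed

lemma nn_integral_index_avg:
  assumes "\<And>j. j \<in> code_index M K L \<Longrightarrow> f j \<in> borel_measurable A"
  shows "(\<lambda>x. index_avg M K L (\<lambda>j. f j x)) \<in> borel_measurable A"
    and "(\<integral>\<^sup>+x. index_avg M K L (\<lambda>j. f j x) \<partial>A) = index_avg M K L (\<lambda>j. \<integral>\<^sup>+x. f j x \<partial>A)"
  unfolding index_avg_eq using assms by (simp_all add: nn_integral_cmult nn_integral_sum)

text \<open>First-moment argument for one weighted sum of four functionals. The power must end at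
  most at \<open>P\<close> itself, without loss of a constant factor, so it gets weight
  \<open>1 / P\<close> and uses up \<open>1 - 4 * \<kappa>\<close>; the other three get weight
  \<open>\<kappa> / e\<close> and contribute \<kappa> each. The mean is at most
  \<open>1 - \<kappa>\<close>, so some codebook keeps every weighted term below 1.\<close>

lemma exists_codebook:
  fixes n M K L :: nat and V vS vY vZ T wY wZ \<beta> \<beta>z c P \<theta> e tS tY tZ :: real
  assumes V: "V > 0" and n: "n \<ge> 1" and size: "M \<ge> 1" "K \<ge> 1" "L \<ge> 1"
    and v: "vS > 0" "vY > 0" "vZ > 0" and w: "T = vS + \<beta>\<^sup>2 * V" "wY = vY + \<beta>z\<^sup>2 * V" "wZ = vZ + \<beta>z\<^sup>2 * V"
    and t: "0 < tS" "tS < 1" "0 < tY" "tY < 1" "0 < tZ" "tZ < 1" and \<theta>: "\<theta> > 0" and e: "e > 0"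
    and eS: "real L powr - tS / tS * exp (real n * cumulant vS T tS) \<le> e"
    and eZ: "real (M * K * L) powr - tZ / tZ * exp (real n * cumulant vZ wZ tZ) \<le> e"
    and eY: "\<theta> powr tY * exp (real n * cumulant vY wY (- tY)) + real (M * L) / \<theta> \<le> e"
    and a: "0 \<le> a" "0 \<le> d" and P: "a * V + d < P"
  defines "J \<equiv> code_index M K L" and "\<kappa> \<equiv> (1 - (a * V + d) / P) / 4"
  shows "\<exists>C. index_avg M K L (\<lambda>j. ennreal (a * ((\<Sum>i<n. (C j i)\<^sup>2) / real n) + d)) \<le> ennreal P
    \<and> code_avg M K (\<lambda>m k. cover_div n vS T \<beta> (bin_index L m k) C) \<le> ennreal (e / \<kappa>)
    \<and> cover_div n vZ wZ \<beta>z J C \<le> ennreal (e / \<kappa>)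
    \<and> index_avg M K L (\<lambda>j. codeword_error n vY wY \<beta>z \<theta> (rival_index M L j) C j) \<le> ennreal (e / \<kappa>)"
proof -
  have w0: "T > 0" "wY > 0" "wZ > 0" using V v w by (auto simp: add_pos_nonneg)
  have P0: "P > 0" using P a V by (smt (verit) mult_nonneg_nonneg)
  have k: "\<kappa> > 0" using P P0 by (simp add: \<kappa>_def)
  have fJ: "finite J" "J \<noteq> {}" using size by (auto simp: J_def code_index_def lessThan_empty_iff)
  have bJ: "bin_index L m k \<subseteq> J" if "m \<in> {1..M}" "k \<in> {1..K}" for m k using that by (auto simp: bin_index_def J_def code_index_def)
  have rJ: "rival_index M L j \<subseteq> J - {j}" if "j \<in> J" for j using that by (auto simp: rival_index_def J_def code_index_def)
  then have rJ': "rival_index M L j \<subseteq> J" if "j \<in> J" for j using that by blast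
  let ?PJ = "PiM J (\<lambda>_. gauss_iid n V)"
  interpret PJ: prob_space ?PJ by (intro prob_space_PiM prob_space_gauss_iid V)
  define F1 where "F1 C = index_avg M K L (\<lambda>j. ennreal (a * ((\<Sum>i<n. (C j i)\<^sup>2) / real n) + d))" for C :: "nat \<times> nat \<times> nat \<Rightarrow> nat \<Rightarrow> real"
  define F2 where "F2 C = code_avg M K (\<lambda>m k. cover_div n vS T \<beta> (bin_index L m k) C)" for C
  define F3 where "F3 C = cover_div n vZ wZ \<beta>z J C" for C
  define F4 where "F4 C = index_avg M K L (\<lambda>j. codeword_error n vY wY \<beta>z \<theta> (rival_index M L j) C j)" for C
  note I1 = nn_integral_index_avg[of M K L "\<lambda>j C. ennreal (a * ((\<Sum>i<n. (C j i)\<^sup>2) / real n) + d)" ?PJ,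
    OF codebook_functionals_measurable(3)[OF w0(1) order_refl], folded J_def]
  note I2 = nn_integral_code_avg[of M K "\<lambda>m k. cover_div n vS T \<beta> (bin_index L m k)" ?PJ, OF codebook_functionals_measurable(1)[OF w0(1) bJ]]
  note I4 = nn_integral_index_avg[of M K L "\<lambda>j C. codeword_error n vY wY \<beta>z \<theta> (rival_index M L j) C j" ?PJ, folded J_def,
    OF codebook_functionals_measurable(2)[OF w0(2) rJ']]
  have [measurable]: "F1 \<in> borel_measurable ?PJ" "F2 \<in> borel_measurable ?PJ" "F3 \<in> borel_measurable ?PJ" "F4 \<in> borel_measurable ?PJ"
    unfolding F1_def[abs_def] F2_def[abs_def] F3_def[abs_def] F4_def[abs_def]
    using I1(1) I2(1) I4(1) codebook_functionals_measurable(1)[OF w0(3) order_refl] by auto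
  have E1: "(\<integral>\<^sup>+C. F1 C \<partial>?PJ) \<le> ennreal (a * V + d)"
    unfolding F1_def
  proof (subst I1(2))
    show "index_avg M K L (\<lambda>j. \<integral>\<^sup>+C. ennreal (a * ((\<Sum>i<n. (C j i)\<^sup>2) / real n) + d) \<partial>?PJ) \<le> ennreal (a * V + d)"
    proof (intro index_avg_le size)
      fix j assume "j \<in> code_index M K L"
      then show "(\<integral>\<^sup>+C. ennreal (a * ((\<Sum>i<n. (C j i)\<^sup>2) / real n) + d) \<partial>?PJ) \<le> ennreal (a * V + d)"
        using codeword_power_expectation[OF V n fJ(1) _ a, of j] by (simp only: J_def order_refl)
    qed (use a V in simp)
  qed
  have E2: "(\<integral>\<^sup>+C. F2 C \<partial>?PJ) \<le> ennreal e"
    unfolding F2_def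
  proof (subst I2(2))
    show "code_avg M K (\<lambda>m k. \<integral>\<^sup>+C. cover_div n vS T \<beta> (bin_index L m k) C \<partial>?PJ) \<le> ennreal e"
    proof (intro code_avg_le size less_imp_le[OF e])
      fix m k assume p: "m \<in> {1..M}" "k \<in> {1..K}"
      have "(\<integral>\<^sup>+C. cover_div n vS T \<beta> (bin_index L m k) C \<partial>?PJ) \<le> ennreal (real (card (bin_index L m k)) powr - tS / tS * exp (real n * cumulant vS T tS))"
        using size t by (intro cover_div_expectation V v w fJ bJ p) (auto simp: bin_index_def lessThan_empty_iff)
      then show "(\<integral>\<^sup>+C. cover_div n vS T \<beta> (bin_index L m k) C \<partial>?PJ) \<le> ennreal e"
        unfolding card_bin_index using eS by (auto intro: order.trans ennreal_leI)
    qed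
  qed
  have E3: "(\<integral>\<^sup>+C. F3 C \<partial>?PJ) \<le> ennreal e"
    unfolding F3_def using cover_div_expectation[OF V v(3) w(3) fJ(1) order_refl fJ(2) t(5,6), of n] eZ
    unfolding J_def card_code_index by (auto intro: order.trans ennreal_leI)
  have E4: "(\<integral>\<^sup>+C. F4 C \<partial>?PJ) \<le> ennreal e"
    unfolding F4_def
  proof (subst I4(2))
    show "index_avg M K L (\<lambda>j. \<integral>\<^sup>+C. codeword_error n vY wY \<beta>z \<theta> (rival_index M L j) C j \<partial>?PJ) \<le> ennreal e"
    proof (intro index_avg_le size less_imp_le[OF e])
      fix j assume j: "j \<in> code_index M K L"
      then have "(\<integral>\<^sup>+C. codeword_error n vY wY \<beta>z \<theta> (rival_index M L j) C j \<partial>?PJ)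
        \<le> ennreal (\<theta> powr tY * exp (real n * cumulant vY wY (- tY)) + real (card (rival_index M L j)) / \<theta>)"
        by (intro codeword_error_expectation V v w fJ rJ t \<theta>) (simp_all add: J_def)
      also have "\<dots> \<le> ennreal (\<theta> powr tY * exp (real n * cumulant vY wY (- tY)) + real (M * L) / \<theta>)"
        using \<theta> card_rival_index[of M L j] by (intro ennreal_leI add_left_mono divide_right_mono) (auto simp del: of_nat_mult)
      also have "\<dots> \<le> ennreal e" using eY by (rule ennreal_leI)
      finally show "(\<integral>\<^sup>+C. codeword_error n vY wY \<beta>z \<theta> (rival_index M L j) C j \<partial>?PJ) \<le> ennreal e" .
    qed
  qed
  define F where "F C = ennreal (1 / P) * F1 C + ennreal (\<kappa> / e) * F2 C + ennreal (\<kappa> / e) * F3 C + ennreal (\<kappa> / e) * F4 C" for C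
  have [measurable]: "F \<in> borel_measurable ?PJ" unfolding F_def[abs_def] by measurable
  have "(\<integral>\<^sup>+C. F C \<partial>?PJ) = ennreal (1 / P) * (\<integral>\<^sup>+C. F1 C \<partial>?PJ) + ennreal (\<kappa> / e) * (\<integral>\<^sup>+C. F2 C \<partial>?PJ) + ennreal (\<kappa> / e) * (\<integral>\<^sup>+C. F3 C \<partial>?PJ) + ennreal (\<kappa> / e) * (\<integral>\<^sup>+C. F4 C \<partial>?PJ)"
    unfolding F_def by (simp add: nn_integral_add nn_integral_cmult)
  also have "\<dots> \<le> ennreal (1 / P) * ennreal (a * V + d) + ennreal (\<kappa> / e) * ennreal e + ennreal (\<kappa> / e) * ennreal e + ennreal (\<kappa> / e) * ennreal e"
    by (intro add_mono mult_left_mono E1 E2 E3 E4) auto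
  also have "\<dots> = ennreal (1 / P * (a * V + d) + \<kappa> / e * e + \<kappa> / e * e + \<kappa> / e * e)"
    using P0 a V k e by (simp add: ennreal_mult[symmetric] ennreal_plus[symmetric] del: ennreal_plus)
  also have "\<dots> < 1"
  proof -
    have "1 / P * (a * V + d) + \<kappa> / e * e + \<kappa> / e * e + \<kappa> / e * e = (a * V + d) / P + 3 * \<kappa>" using e by simp
    also have "\<dots> < 1"
    proof -
      have "x + 3 * ((1 - x) / 4) < 1" if "(1 - x) / 4 > 0" for x :: real using that by (simp add: field_simps)
      then show ?thesis using k unfolding \<kappa>_def by blast
    qed
    finally show ?thesis by (simp add: ennreal_less_one_iff)
  qed
  finally obtain C where C: "F C < 1" using exists_le_of_expectation[OF PJ.prob_space_axioms, of F] by auto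
  have bound: "G \<le> ennreal y" if "ennreal x * G \<le> F C" "x * y = 1" "x > 0" for G x y
  proof -
    have y: "y > 0" using that by (smt (verit) mult_nonneg_nonpos)
    have "G = ennreal (y * x) * G" using that by (simp add: mult.commute)
    also have "\<dots> = ennreal y * (ennreal x * G)" using y that by (simp add: ennreal_mult mult.assoc)
    also have "\<dots> \<le> ennreal y * 1" using that C by (intro mult_left_mono) auto
    finally show ?thesis by simp
  qed
  have le: "ennreal (1 / P) * F1 C \<le> F C" "ennreal (\<kappa> / e) * F2 C \<le> F C" "ennreal (\<kappa> / e) * F3 C \<le> F C" "ennreal (\<kappa> / e) * F4 C \<le> F C"
    unfolding F_def by (simp_all add: add_increasing add_increasing2)
  show ?thesis
    using bound[OF le(1), of P] bound[OF le(2), of "e / \<kappa>"] bound[OF le(3), of "e / \<kappa>"] bound[OF le(4), of "e / \<kappa>"] P0 k e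
    by (intro exI[of _ C]) (simp add: F1_def F2_def F3_def F4_def del: of_nat_mult)
qed

section \<open>Codes from codebooks\<close>

lemma set_size_pos: "set_size n R \<ge> 1"
  unfolding set_size_def by (simp add: Suc_le_eq)

lemma set_size_ge: "2 powr (real n * R) \<le> real (set_size n R)"
  unfolding set_size_def by (simp add: of_nat_ceiling)

text \<open>For \<open>R \<ge> 0\<close> the exact size is at least 1, so rounding up at most
  doubles it.\<close>

lemma set_size_le: "R \<ge> 0 \<Longrightarrow> real (set_size n R) \<le> 2 * 2 powr (real n * R)"
proof -
  assume "R \<ge> 0"
  then have 1: "1 \<le> 2 powr (real n * R)" by (intro ge_one_powr_ge_zero) auto
  have "real (set_size n R) = of_int \<lceil>2 powr (real n * R)\<rceil>"
    unfolding set_size_def by (simp add: of_nat_nat order.trans[OF _ 1])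
  then show ?thesis using 1 of_int_ceiling_le_add_one[of "2 powr (real n * R)"] by linarith
qed

text \<open>The bound of \<open>relF_density_perturb\<close> with \<open>D = x\<close>, \<open>\<delta> = 3 / 2 * sqrt x\<close>, \<open>\<eta> = sqrt x\<close> and \<open>c = 1 / sqrt x\<close>.\<close>

definition kl_bound :: "real \<Rightarrow> real" where
  "kl_bound x = x + 3 / 2 * sqrt x * ln (1 / sqrt x) + (1 + 3 / 2 * sqrt x) / (1 / sqrt x) + 3 / 2 * sqrt x + sqrt x + x / (2 * sqrt x)"

lemma kl_bound_tendsto: "(kl_bound \<longlongrightarrow> 0) (at_right 0)"
  unfolding kl_bound_def by real_asymp

text \<open>\<open>pos_part_le_relF\<close> integrated over the state; it converts the covering
  quality of a bin into a bound on the probability of sending 0.\<close>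

lemma fallback_bound:
  assumes w: "w > 0" and v: "v > 0" and L: "L \<ge> 1" and \<eta>: "\<eta> > 0"
  shows "(\<integral>\<^sup>+s. ennreal (max 0 (1 - (\<Sum>l<L. LR n v w (\<lambda>i. \<beta> * C (m, k, l) i) s) / real L)) \<partial>gauss_iid n w)
    \<le> ennreal \<eta> + ennreal (1 / (2 * \<eta>)) * cover_div n v w \<beta> (bin_index L m k) C"
proof -
  interpret G: prob_space "gauss_iid n w" by (rule prob_space_gauss_iid[OF w])
  define r where "r s = (\<Sum>l<L. LR n v w (\<lambda>i. \<beta> * C (m, k, l) i) s) / real L" for s
  have [measurable]: "r \<in> borel_measurable (vspace n)" unfolding r_def by measurable
  have r0: "r s \<ge> 0" for s unfolding r_def by (intro divide_nonneg_nonneg sum_nonneg less_imp_le[OF LR_pos] v w) simp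
  have "(\<integral>\<^sup>+s. ennreal (max 0 (1 - r s)) \<partial>gauss_iid n w) \<le> (\<integral>\<^sup>+s. ennreal \<eta> + ennreal (1 / (2 * \<eta>)) * ennreal (relF (r s)) \<partial>gauss_iid n w)"
  proof (intro nn_integral_mono)
    fix s
    have "ennreal (max 0 (1 - r s)) \<le> ennreal (\<eta> + 1 / (2 * \<eta>) * relF (r s))"
      using pos_part_le_relF[OF r0 \<eta>, of s] by (intro ennreal_leI) (simp add: mult.commute)
    also have "\<dots> = ennreal \<eta> + ennreal (1 / (2 * \<eta>)) * ennreal (relF (r s))"
      using \<eta> relF_nonneg[OF r0] by (simp add: ennreal_mult[symmetric])
    finally show "ennreal (max 0 (1 - r s)) \<le> ennreal \<eta> + ennreal (1 / (2 * \<eta>)) * ennreal (relF (r s))" .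
  qed
  also have "\<dots> = ennreal \<eta> + ennreal (1 / (2 * \<eta>)) * (\<integral>\<^sup>+s. ennreal (relF (r s)) \<partial>gauss_iid n w)"
    by (simp add: nn_integral_add nn_integral_cmult G.emeasure_space_1[simplified])
  also have "(\<integral>\<^sup>+s. ennreal (relF (r s)) \<partial>gauss_iid n w) = cover_div n v w \<beta> (bin_index L m k) C"
    by (simp add: cover_div_def r_def sum_bin_index card_bin_index)
  finally show ?thesis by (simp add: r_def)
qed

text \<open>If the sent codeword passes, the \<open>LEAST\<close> is attained, so a wrong decision
  exhibits a passing codeword of another message; otherwise the first summand of the penalty is
  already 1.\<close>

lemma decoding_error_pointwise:
  fixes \<rho> :: "nat \<times> nat \<times> nat \<Rightarrow> real"
  assumes m: "m \<in> {1..M}" and l: "l < L" and \<rho>0: "0 \<le> \<rho> (m, k, l)"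
    and err: "(LEAST m. m \<in> {1..M} \<and> (\<exists>l<L. \<rho> (m, k, l) > \<theta>)) \<noteq> m"
  shows "1 \<le> penalty \<theta> (rival_index M L (m, k, l)) \<rho> (m, k, l)"
proof (cases "\<rho> (m, k, l) \<le> \<theta>")
  case False
  define Q where "Q m \<longleftrightarrow> m \<in> {1..M} \<and> (\<exists>l<L. \<rho> (m, k, l) > \<theta>)" for m
  have "Q m" using m l False by (auto simp: Q_def)
  then have "Q (LEAST m. Q m)" by (rule LeastI)
  moreover have "(LEAST m. Q m) \<noteq> m" using err by (simp add: Q_def)
  ultimately obtain l' where l': "(LEAST m. Q m) \<in> {1..M}" "l' < L" "\<rho> (LEAST m. Q m, k, l') > \<theta>"
    "(LEAST m. Q m, k, l') \<in> rival_index M L (m, k, l)"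
    by (auto simp: Q_def rival_index_def)
  have "finite (rival_index M L (m, k, l))" by (simp add: rival_index_def)
  then have "(\<Sum>i\<in>{(LEAST m. Q m, k, l')}. if \<rho> i > \<theta> then 1 else (0::ennreal)) \<le> (\<Sum>i\<in>rival_index M L (m, k, l). if \<rho> i > \<theta> then 1 else 0)"
    using l' by (intro sum_mono2) auto
  then show ?thesis using l' False by simp
qed simp

lemma nn_integral_warden_dist:
  assumes enc: "\<And>m k. enc m k \<in> vspace n \<rightarrow>\<^sub>M prob_algebra (vspace n)" and T: "T > 0" and \<sigma>2: "\<sigma>2 > 0"
  shows "f \<in> borel_measurable (vspace n) \<Longrightarrow> (\<integral>\<^sup>+z. f z \<partial>warden_dist n T \<sigma>2 R RK enc) = code_avg (set_size n R) (set_size n RK) (\<lambda>m k. \<integral>\<^sup>+z. f z \<partial>out_dist n T \<sigma>2 enc m k)"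
    and "prob_space (warden_dist n T \<sigma>2 R RK enc)"
proof -
  define M where "M = set_size n R"
  define K where "K = set_size n RK"
  have MK: "M \<ge> 1" "K \<ge> 1" unfolding M_def K_def by (rule set_size_pos)+
  define P2 where "P2 = {1..M} \<times> {1..K}"
  have fP2: "finite P2" "P2 \<noteq> {}" "card P2 = M * K" using MK by (auto simp: P2_def card_cartesian_product)
  have ker: "(\<lambda>(m, k). out_dist n T \<sigma>2 enc m k) \<in> measure_pmf (pmf_of_set P2) \<rightarrow>\<^sub>M subprob_algebra (vspace n)"
    using prob_space_out_dist[where enc=enc, OF enc \<sigma>2 T]
    by (auto simp: space_subprob_algebra intro!: prob_space_imp_subprob_space)
  have Wd: "warden_dist n T \<sigma>2 R RK enc = bind (measure_pmf (pmf_of_set P2)) (\<lambda>(m, k). out_dist n T \<sigma>2 enc m k)"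
    by (simp add: warden_dist_def P2_def M_def K_def)
  show "prob_space (warden_dist n T \<sigma>2 R RK enc)" unfolding Wd
    using prob_space_out_dist[where enc=enc, OF enc \<sigma>2 T]
    by (intro measure_pmf.prob_space_bind[OF _ ker]) auto
  assume f: "f \<in> borel_measurable (vspace n)"
  have "(\<integral>\<^sup>+z. f z \<partial>warden_dist n T \<sigma>2 R RK enc) = (\<integral>\<^sup>+p. \<integral>\<^sup>+z. f z \<partial>out_dist n T \<sigma>2 enc (fst p) (snd p) \<partial>measure_pmf (pmf_of_set P2))"
    unfolding Wd by (subst nn_integral_bind[OF f ker]) (auto simp: case_prod_unfold)
  also have "\<dots> = code_avg M K (\<lambda>m k. \<integral>\<^sup>+z. f z \<partial>out_dist n T \<sigma>2 enc m k)"
    using fP2 MK unfolding code_avg_def sum.cartesian_product P2_def[symmetric]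
    by (subst nn_integral_pmf_of_set)
      (simp_all add: divide_ennreal_def inverse_ennreal ennreal_of_nat_eq_real_of_nat inverse_eq_divide mult.commute case_prod_unfold flip: of_nat_mult)
  finally show "(\<integral>\<^sup>+z. f z \<partial>warden_dist n T \<sigma>2 R RK enc) = code_avg (set_size n R) (set_size n RK) (\<lambda>m k. \<integral>\<^sup>+z. f z \<partial>out_dist n T \<sigma>2 enc m k)"
    by (simp add: M_def K_def)
qed

text \<open>Codewords \<open>C j\<close> have variance \<open>V\<close>, the state given the codeword has mean \<open>\<beta> * C j\<close> and variance \<open>vS\<close>, and the input is
  \<open>C j - c * S\<close>. The second equation for \<open>T\<close> says that \<open>X + S\<close> has the same variance as \<open>S\<close>, which is covertness.\<close>

context
  fixes n L :: nat and V vS T \<beta> c R RK :: real and C :: "nat \<times> nat \<times> nat \<Rightarrow> nat \<Rightarrow> real"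
  assumes n: "n \<ge> 1" and L: "L \<ge> 1" and V: "V > 0" and vS: "vS > 0"
    and T: "T = vS + \<beta>\<^sup>2 * V" "T = (1 - c)\<^sup>2 * vS + (1 + (1 - c) * \<beta>)\<^sup>2 * V" and c: "c \<noteq> 0"
begin

private abbreviation (input) M where "M \<equiv> set_size n R"
private abbreviation (input) K where "K \<equiv> set_size n RK"
private abbreviation (input) J where "J \<equiv> code_index M K L"
private abbreviation (input) \<beta>z where "\<beta>z \<equiv> 1 + (1 - c) * \<beta>"
private abbreviation (input) outvar where "outvar v \<equiv> v + (1 - c)\<^sup>2 * vS"

definition encoder where
  "encoder m k = bin_encoder n L c (\<lambda>l. C (m, k, l)) (\<lambda>l. LR n vS T (\<lambda>i. \<beta> * C (m, k, l) i))"

text \<open>By \<open>bin_weight_last\<close>, the probability that 0 is sent for this message and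
  key.\<close>

definition fallback where
  "fallback m k = (\<integral>\<^sup>+s. ennreal (max 0 (1 - (\<Sum>l<L. LR n vS T (\<lambda>i. \<beta> * C (m, k, l) i) s) / real L)) \<partial>gauss_iid n T)"

text \<open>Codeword \<open>j\<close> seen through noise of variance \<open>v\<close>: the receiver
  has \<open>v = 1\<close>, the warden \<open>v = \<sigma>2\<close>. The uncertainty about the state
  that remains given the codeword adds \<open>(1 - c)\<^sup>2 * vS\<close> to the noise.\<close>

definition out_ratio where "out_ratio v j z = LR n (outvar v) (T + v) (\<lambda>i. \<beta>z * C j i) z"

text \<open>If no message passes, \<open>LEAST\<close> is an unspecified number. This is harmless:
  the sent codeword has then failed the test and is charged as an error.\<close>

definition decoder where
  "decoder \<theta> y k = (LEAST m. m \<in> {1..M} \<and> (\<exists>l<L. out_ratio 1 (m, k, l) y > \<theta>))"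

lemma T_pos: "T > 0" using vS V by (simp add: T(1) add_pos_nonneg)

lemma outvar_pos: "v > 0 \<Longrightarrow> outvar v > 0" using vS by (simp add: add_pos_nonneg)

lemma out_ratio_nonneg: "v > 0 \<Longrightarrow> 0 \<le> out_ratio v j z"
  unfolding out_ratio_def using T_pos by (intro less_imp_le[OF LR_pos] outvar_pos) auto

lemma out_ratio_measurable[measurable]: "out_ratio v j \<in> borel_measurable (vspace n)"
  unfolding out_ratio_def[abs_def] by measurable

lemma encoder_kernel: "encoder m k \<in> vspace n \<rightarrow>\<^sub>M prob_algebra (vspace n)"
  unfolding encoder_def using L by (intro bin_encoder_kernel) (auto intro!: less_imp_le[OF LR_pos] vS T_pos)

lemma decoder_measurable: "(\<lambda>y. decoder \<theta> y k) \<in> vspace n \<rightarrow>\<^sub>M count_space UNIV"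
  unfolding decoder_def by measurable

lemma average_ratio:
  assumes "v > 0" shows "ennreal (1 / real L * (\<Sum>l<L. out_ratio v (m, k, l) z)) = ennreal (1 / real L) * (\<Sum>l<L. ennreal (out_ratio v (m, k, l) z))"
  using out_ratio_nonneg[OF assms] by (simp add: sum_ennreal sum_nonneg ennreal_mult[symmetric])

lemma encoder_output:
  assumes v: "v > 0"
  shows "\<exists>g b. g \<in> borel_measurable (vspace n) \<and> b \<in> borel_measurable (vspace n) \<and>
    out_dist n T v encoder m k = density (gauss_iid n (T + v)) (\<lambda>z. g z + b z) \<and>
    (\<forall>z. g z \<le> ennreal (1 / real L) * (\<Sum>l<L. ennreal (out_ratio v (m, k, l) z))) \<and>
    (\<forall>z. b z \<le> 1) \<and> (\<integral>\<^sup>+z. b z \<partial>gauss_iid n (T + v)) = fallback m k"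
  unfolding average_ratio[OF v, symmetric]
  by (rule bin_encoder_output[OF L T_pos v vS, of encoder m k n c "\<lambda>l. C (m, k, l)" \<beta>])
    (auto simp: encoder_def fallback_def out_ratio_def)

lemma encoder_power:
  "avg_power n T R RK encoder \<le> index_avg M K L (\<lambda>j. ennreal ((1 - c * \<beta>)\<^sup>2 * ((\<Sum>i<n. (C j i)\<^sup>2) / real n) + c\<^sup>2 * vS))"
  unfolding avg_power_def code_avg_def[symmetric] index_avg_def
proof (intro code_avg_mono)
  fix m k
  define p where "p l = (1 - c * \<beta>)\<^sup>2 * ((\<Sum>i<n. (C (m, k, l) i)\<^sup>2) / real n) + c\<^sup>2 * vS" for l
  have nn: "0 \<le> p l" for l
    unfolding p_def using vS by (intro add_nonneg_nonneg mult_nonneg_nonneg divide_nonneg_nonneg sum_nonneg) auto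
  have "(\<integral>\<^sup>+ s. \<integral>\<^sup>+ x. ennreal ((\<Sum>i<n. (x i)\<^sup>2) / real n) \<partial>(encoder m k s) \<partial>(gauss_iid n T)) \<le> ennreal ((\<Sum>l<L. p l) / real L)"
    unfolding encoder_def p_def by (rule bin_encoder_power[OF L n T_pos vS c])
  also have "\<dots> = ennreal (1 / real L) * (\<Sum>l<L. ennreal (p l))"
    using nn by (simp add: sum_ennreal sum_nonneg ennreal_mult[symmetric])
  finally show "(\<integral>\<^sup>+ s. \<integral>\<^sup>+ x. ennreal ((\<Sum>i<n. (x i)\<^sup>2) / real n) \<partial>(encoder m k s) \<partial>(gauss_iid n T))
    \<le> ennreal (1 / real L) * (\<Sum>l<L. ennreal ((1 - c * \<beta>)\<^sup>2 * ((\<Sum>i<n. (C (m, k, l) i)\<^sup>2) / real n) + c\<^sup>2 * vS))"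
    unfolding p_def .
qed

text \<open>With \<open>sqrt x\<close> for the free parameter, both terms of
  \<open>fallback_bound\<close> have order \<open>sqrt x\<close>: they are \<open>sqrt x\<close> and
  half of it.\<close>

lemma fallback_average:
  assumes cov: "code_avg M K (\<lambda>m k. cover_div n vS T \<beta> (bin_index L m k) C) \<le> ennreal x" and x: "x > 0"
  shows "code_avg M K fallback \<le> ennreal (3 / 2 * sqrt x)"
proof -
  have sx: "sqrt x > 0" using x by simp
  have "code_avg M K fallback \<le> code_avg M K (\<lambda>m k. ennreal (sqrt x) + ennreal (1 / (2 * sqrt x)) * cover_div n vS T \<beta> (bin_index L m k) C)"
    unfolding fallback_def[abs_def] by (intro code_avg_mono fallback_bound T_pos vS L sx)
  also have "\<dots> = ennreal (sqrt x) + ennreal (1 / (2 * sqrt x)) * code_avg M K (\<lambda>m k. cover_div n vS T \<beta> (bin_index L m k) C)"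
    by (simp only: code_avg_add code_avg_cmult code_avg_const set_size_pos less_imp_le[OF sx])
  also have "\<dots> \<le> ennreal (sqrt x) + ennreal (1 / (2 * sqrt x)) * ennreal x"
    by (intro add_left_mono mult_left_mono cov) simp
  also have "\<dots> = ennreal (sqrt x + 1 / (2 * sqrt x) * x)"
    using sx x by (simp add: ennreal_mult[symmetric] ennreal_plus[symmetric] del: ennreal_plus)
  also have "sqrt x + 1 / (2 * sqrt x) * x = 3 / 2 * sqrt x"
    using x by (simp add: real_div_sqrt)
  finally show ?thesis .
qed

text \<open>The dominated part of the output density is tested codeword by codeword; the fallback
  part is counted as an error in full.\<close>

lemma decoder_error:
  "ennreal (err_prob n T R RK encoder (decoder \<theta>))
    \<le> index_avg M K L (\<lambda>j. codeword_error n (outvar 1) (T + 1) \<beta>z \<theta> (rival_index M L j) C j) + code_avg M K fallback"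
proof -
  have "ennreal (err_prob n T R RK encoder (decoder \<theta>)) = code_avg M K (\<lambda>m k. emeasure (out_dist n T 1 encoder m k) {y \<in> space (vspace n). decoder \<theta> y k \<noteq> m})"
  proof -
    have "emeasure (out_dist n T 1 encoder m k) A = ennreal (measure (out_dist n T 1 encoder m k) A)" for m k A
      using prob_space_out_dist(1)[where enc=encoder, OF encoder_kernel _ T_pos, of 1 m k]
      by (simp add: finite_measure.emeasure_eq_measure prob_space.finite_measure)
    then show ?thesis by (simp add: err_prob_def code_avg_def sum_ennreal sum_nonneg ennreal_mult[symmetric])
  qed
  also have "\<dots> \<le> code_avg M K (\<lambda>m k. ennreal (1 / real L) * (\<Sum>l<L. codeword_error n (outvar 1) (T + 1) \<beta>z \<theta> (rival_index M L (m, k, l)) C (m, k, l)) + fallback m k)"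
  proof (rule code_avg_mono)
    fix m k assume m: "m \<in> {1..M}"
    let ?G = "gauss_iid n (T + 1)"
    define \<rho> where "\<rho> = out_ratio 1"
    obtain g b where gb[measurable]: "g \<in> borel_measurable (vspace n)" "b \<in> borel_measurable (vspace n)"
      and od: "out_dist n T 1 encoder m k = density ?G (\<lambda>z. g z + b z)"
      and g: "\<And>z. g z \<le> ennreal (1 / real L) * (\<Sum>l<L. ennreal (\<rho> (m, k, l) z))"
      and b: "(\<integral>\<^sup>+z. b z \<partial>?G) = fallback m k"
      using encoder_output[of 1 m k] unfolding \<rho>_def by auto
    have [measurable]: "\<rho> j \<in> borel_measurable (vspace n)" for j unfolding \<rho>_def by measurable
    let ?E = "{y \<in> space (vspace n). decoder \<theta> y k \<noteq> m}" and ?I = "\<lambda>l. rival_index M L (m, k, l)"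
    have [measurable]: "?E \<in> sets (vspace n)" using decoder_measurable[of \<theta> k] by measurable
    have "emeasure (out_dist n T 1 encoder m k) ?E = (\<integral>\<^sup>+z. (g z + b z) * indicator ?E z \<partial>?G)"
      unfolding od by (subst emeasure_density) auto
    also have "\<dots> \<le> (\<integral>\<^sup>+z. ennreal (1 / real L) * (\<Sum>l<L. ennreal (\<rho> (m, k, l) z) * penalty \<theta> (?I l) (\<lambda>j. \<rho> j z) (m, k, l)) + b z \<partial>?G)"
    proof (intro nn_integral_mono, goal_cases)
      case (1 z)
      show ?case
      proof (cases "z \<in> ?E")
        case True
        have "ennreal (\<rho> (m, k, l) z) \<le> ennreal (\<rho> (m, k, l) z) * penalty \<theta> (?I l) (\<lambda>j. \<rho> j z) (m, k, l)" if "l \<in> {..<L}" for l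
        proof -
          have "1 \<le> penalty \<theta> (?I l) (\<lambda>j. \<rho> j z) (m, k, l)"
            using m True that out_ratio_nonneg[of 1] by (intro decoding_error_pointwise) (auto simp: decoder_def \<rho>_def)
          from mult_left_mono[OF this, of "ennreal (\<rho> (m, k, l) z)"] show ?thesis by simp
        qed
        then have "ennreal (1 / real L) * (\<Sum>l<L. ennreal (\<rho> (m, k, l) z)) \<le>
            ennreal (1 / real L) * (\<Sum>l<L. ennreal (\<rho> (m, k, l) z) * penalty \<theta> (?I l) (\<lambda>j. \<rho> j z) (m, k, l))"
          by (intro mult_left_mono sum_mono) auto
        with g[of z] True show ?thesis by (auto intro!: add_right_mono intro: order.trans)
      qed simp
    qed
    also have "\<dots> = ennreal (1 / real L) * (\<Sum>l<L. \<integral>\<^sup>+z. ennreal (\<rho> (m, k, l) z) * penalty \<theta> (?I l) (\<lambda>j. \<rho> j z) (m, k, l) \<partial>?G) + fallback m k"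
      unfolding b[symmetric] by (simp add: nn_integral_add nn_integral_cmult nn_integral_sum)
    finally show "emeasure (out_dist n T 1 encoder m k) ?E \<le>
       ennreal (1 / real L) * (\<Sum>l<L. codeword_error n (outvar 1) (T + 1) \<beta>z \<theta> (?I l) C (m, k, l)) + fallback m k"
      unfolding codeword_error_def \<rho>_def out_ratio_def .
  qed
  also have "\<dots> = index_avg M K L (\<lambda>j. codeword_error n (outvar 1) (T + 1) \<beta>z \<theta> (rival_index M L j) C j) + code_avg M K fallback"
    by (simp only: index_avg_def code_avg_add)
  finally show ?thesis .
qed

text \<open>The decompositions of the outputs are averaged over messages and keys: the main parts
  stay below the mixture of all codewords, whose divergence is \<open>cover_div\<close>, and the
  fallback parts have small mass. \<open>relF_density_perturb\<close> then compares the two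
  densities.\<close>

lemma warden_divergence:
  assumes \<sigma>2: "\<sigma>2 > 0" and x: "0 < x" "x \<le> 1"
    and covS: "code_avg M K (\<lambda>m k. cover_div n vS T \<beta> (bin_index L m k) C) \<le> ennreal x"
    and covZ: "cover_div n (outvar \<sigma>2) (T + \<sigma>2) \<beta>z J C \<le> ennreal x"
  shows "0 \<le> rel_entropy (warden_dist n T \<sigma>2 R RK encoder) (gauss_iid n (T + \<sigma>2))"
    and "rel_entropy (warden_dist n T \<sigma>2 R RK encoder) (gauss_iid n (T + \<sigma>2)) \<le> ereal (kl_bound x)"
proof -
  let ?Q = "gauss_iid n (T + \<sigma>2)" and ?W = "warden_dist n T \<sigma>2 R RK encoder"
  have w: "T + \<sigma>2 > 0" using T_pos \<sigma>2 by simp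
  interpret Q: prob_space ?Q by (rule prob_space_gauss_iid[OF w])
  \<comment> \<open>Packs the decomposition into one predicate, so that it can be chosen for all
    messages and keys at once and then averaged.\<close>
  define good where "good p gb \<longleftrightarrow> fst gb \<in> borel_measurable (vspace n) \<and> snd gb \<in> borel_measurable (vspace n) \<and>
    out_dist n T \<sigma>2 encoder (fst p) (snd p) = density ?Q (\<lambda>z. fst gb z + snd gb z) \<and>
    (\<forall>z. fst gb z \<le> ennreal (1 / real L) * (\<Sum>l<L. ennreal (out_ratio \<sigma>2 (fst p, snd p, l) z))) \<and>
    (\<forall>z. snd gb z \<le> 1) \<and> (\<integral>\<^sup>+z. snd gb z \<partial>?Q) = fallback (fst p) (snd p)" for p gb
  have "\<forall>p. \<exists>gb. good p gb"
  proof
    fix p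
    from encoder_output[OF \<sigma>2, of "fst p" "snd p"] obtain g b where "good p (g, b)" by (auto simp: good_def)
    then show "\<exists>gb. good p gb" by blast
  qed
  from choice[OF this] obtain gb where gb: "\<And>p. good p (gb p)" by blast
  define g where "g m k = fst (gb (m, k))" for m k
  define b where "b m k = snd (gb (m, k))" for m k
  have "good (m, k) (g m k, b m k)" for m k using gb[of "(m, k)"] by (simp add: g_def b_def)
  note gb' = this[unfolded good_def fst_conv snd_conv]
  have gm[measurable]: "\<And>m k. g m k \<in> borel_measurable (vspace n)" and bm[measurable]: "\<And>m k. b m k \<in> borel_measurable (vspace n)"
    and od: "\<And>m k. out_dist n T \<sigma>2 encoder m k = density ?Q (\<lambda>z. g m k z + b m k z)"
    and g: "\<And>m k z. g m k z \<le> ennreal (1 / real L) * (\<Sum>l<L. ennreal (out_ratio \<sigma>2 (m, k, l) z))"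
    and b1: "\<And>m k z. b m k z \<le> 1" and b: "\<And>m k. (\<integral>\<^sup>+z. b m k z \<partial>?Q) = fallback m k"
    using gb' by auto
  define f where "f z = code_avg M K (\<lambda>m k. g m k z)" for z
  define fb where "fb z = code_avg M K (\<lambda>m k. b m k z)" for z
  \<comment> \<open>The ideal output density, a uniform mixture over all codewords; its mass is
    exactly 1.\<close>
  define r where "r z = (\<Sum>j\<in>J. out_ratio \<sigma>2 j z) / real (card J)" for z
  have [measurable]: "f \<in> borel_measurable (vspace n)" "fb \<in> borel_measurable (vspace n)" "r \<in> borel_measurable (vspace n)"
    unfolding f_def fb_def code_avg_def r_def by measurable
  have r0: "r z \<ge> 0" for z unfolding r_def by (intro divide_nonneg_nonneg sum_nonneg out_ratio_nonneg \<sigma>2) simp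
  have rJ: "ennreal (r z) = index_avg M K L (\<lambda>j. ennreal (out_ratio \<sigma>2 j z))" for z
    using out_ratio_nonneg[OF \<sigma>2] by (simp add: r_def index_avg_eq sum_ennreal sum_nonneg ennreal_mult[symmetric])
  have r1: "(\<integral>\<^sup>+z. ennreal (r z) \<partial>?Q) = 1"
  proof -
    have "(\<integral>\<^sup>+z. ennreal (r z) \<partial>?Q) = index_avg M K L (\<lambda>j. \<integral>\<^sup>+z. ennreal (out_ratio \<sigma>2 j z) \<partial>?Q)"
      unfolding rJ by (rule nn_integral_index_avg(2)[where f="\<lambda>j z. ennreal (out_ratio \<sigma>2 j z)"]) simp
    also have "\<dots> = index_avg M K L (\<lambda>j. ennreal 1)"
      using nn_integral_LR_output[OF outvar_pos[OF \<sigma>2] w] by (simp add: out_ratio_def)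
    also have "\<dots> = 1" using L code_avg_const[OF set_size_pos[of n R] set_size_pos[of n RK], of 1]
      by (simp add: index_avg_def ennreal_of_nat_eq_real_of_nat ennreal_mult[symmetric])
    finally show ?thesis .
  qed
  have out_int: "(\<integral>\<^sup>+z. h z \<partial>?W) = (\<integral>\<^sup>+z. (f z + fb z) * h z \<partial>?Q)" if [measurable]: "h \<in> borel_measurable (vspace n)" for h
  proof -
    have "(\<integral>\<^sup>+z. h z \<partial>?W) = code_avg M K (\<lambda>m k. \<integral>\<^sup>+z. (g m k z + b m k z) * h z \<partial>?Q)"
      unfolding nn_integral_warden_dist(1)[where enc=encoder, OF encoder_kernel T_pos \<sigma>2 that] od by (simp add: nn_integral_density that)
    also have "\<dots> = (\<integral>\<^sup>+z. code_avg M K (\<lambda>m k. (g m k z + b m k z) * h z) \<partial>?Q)"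
      by (rule nn_integral_code_avg(2)[where f="\<lambda>m k z. (g m k z + b m k z) * h z", symmetric]) simp
    also have "\<dots> = (\<integral>\<^sup>+z. (f z + fb z) * h z \<partial>?Q)"
      unfolding f_def fb_def code_avg_add[symmetric] by (simp add: code_avg_def sum_distrib_right mult.assoc)
    finally show ?thesis .
  qed
  interpret W: prob_space ?W by (rule nn_integral_warden_dist(2)[where enc=encoder, OF encoder_kernel T_pos \<sigma>2])
  have sW: "sets ?W = sets (vspace n)"
    unfolding warden_dist_def by (intro sets_bind) (auto simp: prob_space_out_dist[where enc=encoder, OF encoder_kernel \<sigma>2 T_pos])
  have W: "?W = density ?Q (\<lambda>z. f z + fb z)"
  proof (rule measure_eqI)
    fix A assume "A \<in> sets ?W"
    then show "emeasure ?W A = emeasure (density ?Q (\<lambda>z. f z + fb z)) A"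
      using out_int[of "indicator A"] by (simp add: sW emeasure_density)
  qed (simp add: sW)
  have total: "(\<integral>\<^sup>+z. f z + fb z \<partial>?Q) = 1"
    using out_int[of "\<lambda>_. 1"] W.emeasure_space_1 by simp
  have fr: "f z \<le> ennreal (r z)" for z
    unfolding f_def rJ index_avg_def by (intro code_avg_mono g)
  have fb1: "fb z \<le> 1" for z
    using code_avg_le[OF set_size_pos[of n R] set_size_pos[of n RK], of 1 "\<lambda>m k. b m k z"] b1 by (simp add: fb_def)
  have fb\<delta>: "(\<integral>\<^sup>+z. fb z \<partial>?Q) \<le> ennreal (3 / 2 * sqrt x)"
    unfolding fb_def using fallback_average[OF covS x(1)] by (subst nn_integral_code_avg(2)) (simp_all add: b)
  have "(\<integral>\<^sup>+z. ennreal (relF (enn2real (f z + fb z))) \<partial>?Q) \<le> ennreal (x + 3 / 2 * sqrt x * ln (1 / sqrt x) + (1 + 3 / 2 * sqrt x) / (1 / sqrt x) + 3 / 2 * sqrt x + sqrt x + x / (2 * sqrt x))"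
  proof (rule relF_density_perturb[where g=r])
    show "(\<integral>\<^sup>+z. ennreal (relF (r z)) \<partial>?Q) \<le> ennreal x"
      using covZ unfolding cover_div_def r_def out_ratio_def .
  qed (use r0 r1 fr fb1 total fb\<delta> x in \<open>auto simp: Q.prob_space_axioms\<close>)
  then have F: "(\<integral>\<^sup>+z. ennreal (relF (enn2real (f z + fb z))) \<partial>?Q) \<le> ennreal (kl_bound x)"
    by (simp add: kl_bound_def)
  have "f z + fb z < top" for z
    using fr[of z] fb1[of z] by (auto intro: le_less_trans[of _ "ennreal (r z)"] le_less_trans[of _ 1])
  then have ee: "ennreal (enn2real (f z + fb z)) = f z + fb z" for z by simp
  have kb: "0 \<le> kl_bound x"
    unfolding kl_bound_def using x by (intro add_nonneg_nonneg mult_nonneg_nonneg divide_nonneg_nonneg) auto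
  have "0 \<le> rel_entropy (density ?Q (\<lambda>z. ennreal (enn2real (f z + fb z)))) ?Q"
    "rel_entropy (density ?Q (\<lambda>z. ennreal (enn2real (f z + fb z)))) ?Q \<le> ereal (kl_bound x)"
    by (rule rel_entropy_density; use F kb total in \<open>simp add: ee Q.prob_space_axioms\<close>)+
  then show "0 \<le> rel_entropy ?W ?Q" "rel_entropy ?W ?Q \<le> ereal (kl_bound x)"
    unfolding ee W .
qed

end

text \<open>Translates the codebook bounds into the requirements on a code; error and divergence are
  bounded by functions of the single quantity \<open>x\<close> that tend to 0 with it.\<close>

lemma exists_code:
  fixes n L :: nat and V vS T \<beta> c P \<theta> e tS tY tZ \<sigma>2 R RK :: real
  assumes V: "V > 0" and n: "n \<ge> 1" and L: "L \<ge> 1" and vS: "vS > 0" and \<sigma>2: "\<sigma>2 > 0"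
    and T: "T = vS + \<beta>\<^sup>2 * V" "T = (1 - c)\<^sup>2 * vS + (1 + (1 - c) * \<beta>)\<^sup>2 * V" and c: "c \<noteq> 0"
    and t: "0 < tS" "tS < 1" "0 < tY" "tY < 1" "0 < tZ" "tZ < 1" and \<theta>: "\<theta> > 0" and e: "e > 0"
    and eS: "real L powr - tS / tS * exp (real n * cumulant vS T tS) \<le> e"
    and eZ: "real (set_size n R * set_size n RK * L) powr - tZ / tZ * exp (real n * cumulant (\<sigma>2 + (1 - c)\<^sup>2 * vS) (T + \<sigma>2) tZ) \<le> e"
    and eY: "\<theta> powr tY * exp (real n * cumulant (1 + (1 - c)\<^sup>2 * vS) (T + 1) (- tY)) + real (set_size n R * L) / \<theta> \<le> e"
    and P: "(1 - c * \<beta>)\<^sup>2 * V + c\<^sup>2 * vS < P"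
  defines "x \<equiv> e / ((1 - ((1 - c * \<beta>)\<^sup>2 * V + c\<^sup>2 * vS) / P) / 4)"
  assumes x1: "x \<le> 1"
  shows "\<exists>enc dec. nc_code n enc dec \<and> avg_power n T R RK enc \<le> ennreal P \<and> 0 \<le> err_prob n T R RK enc dec
    \<and> err_prob n T R RK enc dec \<le> x + 3 / 2 * sqrt x
    \<and> 0 \<le> rel_entropy (warden_dist n T \<sigma>2 R RK enc) (gauss_iid n (T + \<sigma>2))
    \<and> rel_entropy (warden_dist n T \<sigma>2 R RK enc) (gauss_iid n (T + \<sigma>2)) \<le> ereal (kl_bound x)"
proof -
  have v0: "1 + (1 - c)\<^sup>2 * vS > 0" "\<sigma>2 + (1 - c)\<^sup>2 * vS > 0" using vS \<sigma>2 by (simp_all add: add_pos_nonneg)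
  have w: "T + 1 = 1 + (1 - c)\<^sup>2 * vS + (1 + (1 - c) * \<beta>)\<^sup>2 * V" "T + \<sigma>2 = \<sigma>2 + (1 - c)\<^sup>2 * vS + (1 + (1 - c) * \<beta>)\<^sup>2 * V"
    by (simp_all add: T(2))
  have "(1 - c * \<beta>)\<^sup>2 * V + c\<^sup>2 * vS \<ge> 0" using V vS by simp
  then have "P > 0" using P by simp
  then have x0: "x > 0" unfolding x_def using e P by simp
  let ?M = "set_size n R" and ?K = "set_size n RK"
  obtain C where pow: "index_avg ?M ?K L (\<lambda>j. ennreal ((1 - c * \<beta>)\<^sup>2 * ((\<Sum>i<n. (C j i)\<^sup>2) / real n) + c\<^sup>2 * vS)) \<le> ennreal P"
    and cov: "code_avg ?M ?K (\<lambda>m k. cover_div n vS T \<beta> (bin_index L m k) C) \<le> ennreal x"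
      "cover_div n (\<sigma>2 + (1 - c)\<^sup>2 * vS) (T + \<sigma>2) (1 + (1 - c) * \<beta>) (code_index ?M ?K L) C \<le> ennreal x"
    and err: "index_avg ?M ?K L (\<lambda>j. codeword_error n (1 + (1 - c)\<^sup>2 * vS) (T + 1) (1 + (1 - c) * \<beta>) \<theta> (rival_index ?M L j) C j) \<le> ennreal x"
    using exists_codebook[OF V n set_size_pos[of n R] set_size_pos[of n RK] L vS v0 T(1) w t \<theta> e eS eZ eY _ _ P] vS
    unfolding x_def by auto
  note ctx = n L V vS T c
  define enc where "enc = encoder n L vS T \<beta> c C"
  define dec where "dec = decoder n L vS T \<beta> c R C \<theta>"
  have "nc_code n enc dec"
    unfolding nc_code_def enc_def dec_def using encoder_kernel[OF ctx] decoder_measurable[OF ctx] by blast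
  moreover have "avg_power n T R RK enc \<le> ennreal P"
    unfolding enc_def by (rule order.trans[OF encoder_power[OF ctx] pow])
  moreover have "ennreal (err_prob n T R RK enc dec) \<le> ennreal x + ennreal (3 / 2 * sqrt x)"
    unfolding enc_def dec_def by (rule order.trans[OF decoder_error[OF ctx] add_mono[OF err fallback_average[OF ctx cov(1) x0]]])
  then have "err_prob n T R RK enc dec \<le> x + 3 / 2 * sqrt x"
    using x0 by (subst (asm) ennreal_plus[symmetric]) (auto simp del: ennreal_plus)
  moreover have "0 \<le> err_prob n T R RK enc dec" unfolding err_prob_def by (intro divide_nonneg_nonneg sum_nonneg) auto
  ultimately show ?thesis
    using warden_divergence[OF ctx \<sigma>2 x0 x1 cov] unfolding enc_def by blast
qed

section \<open>Achievable rates\<close>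

text \<open>Mutual information in bits between \<open>X' + \<alpha> * S'\<close> and
  \<open>X' + S' + N\<close> for independent centred Gaussians of variances \<open>p\<close>, \<tau>
  and \<open>v\<close>: the numerator is the squared covariance, the denominator the determinant of
  the covariance matrix.\<close>

definition info_term :: "real \<Rightarrow> real \<Rightarrow> real \<Rightarrow> real \<Rightarrow> real" where
  "info_term p \<tau> v \<alpha> = 1/2 * log 2 (1 + (p + \<alpha> * \<tau>)\<^sup>2 / ((p + \<alpha>\<^sup>2 * \<tau>) * (p + \<tau> + v) - (p + \<alpha> * \<tau>)\<^sup>2))"

lemma info_denominator_pos:
  fixes p \<tau> v \<alpha> :: real
  assumes "p > 0" "\<tau> \<ge> 0" "v > 0"
  shows "(p + \<alpha>\<^sup>2 * \<tau>) * (p + \<tau> + v) - (p + \<alpha> * \<tau>)\<^sup>2 > 0"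
proof -
  have "(p + \<alpha>\<^sup>2 * \<tau>) * (p + \<tau> + v) - (p + \<alpha> * \<tau>)\<^sup>2 = p * \<tau> * (1 - \<alpha>)\<^sup>2 + v * (p + \<alpha>\<^sup>2 * \<tau>)"
    by (simp add: algebra_simps power2_eq_square)
  also have "\<dots> > 0" using assms by (intro add_nonneg_pos mult_nonneg_nonneg mult_pos_pos add_pos_nonneg) auto
  finally show ?thesis .
qed

text \<open>The logarithmic term of \<open>cumulant\<close> is quadratic in \<open>t\<close>, so for
  small \<open>t\<close> it costs at most half of a linear slack \<open>t * \<epsilon>\<close>.
  Uniformity in the squared correlation \<kappa> lets one \<open>t\<close> serve state, receiver and
  warden.\<close>

lemma small_exponent:
  fixes \<epsilon> :: real
  assumes "\<epsilon> > 0"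
  shows "\<exists>t. 0 < t \<and> t \<le> 1 / 2 \<and> (\<forall>\<kappa>. 0 \<le> \<kappa> \<longrightarrow> \<kappa> \<le> 1 \<longrightarrow> t * \<epsilon> / 2 \<le> t * \<epsilon> + ln (1 - t\<^sup>2 * \<kappa>) / 2)"
proof -
  \<comment> \<open>\<open>t \<le> 1 / 2\<close> gives \<open>y \<le> 1 / 4\<close>, so
    \<open>- ln (1 - y) \<le> 2 * y \<le> 2 * t\<^sup>2\<close>; and
    \<open>t \<le> \<epsilon> / 2\<close> makes this at most \<open>t * \<epsilon>\<close>.\<close>
  define t where "t = min (1 / 2) (\<epsilon> / 2)"
  have t: "0 < t" "t \<le> 1 / 2" using assms by (auto simp: t_def)
  have "t * \<epsilon> / 2 \<le> t * \<epsilon> + ln (1 - t\<^sup>2 * \<kappa>) / 2" if k: "0 \<le> \<kappa>" "\<kappa> \<le> 1" for \<kappa>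
  proof -
    define y where "y = t\<^sup>2 * \<kappa>"
    have y: "0 \<le> y" "y \<le> t\<^sup>2" using k t by (auto simp: y_def mult_left_le)
    have "t\<^sup>2 \<le> (1 / 2)\<^sup>2" using t by (intro power_mono) auto
    then have y4: "y \<le> 1 / 4" using y by (simp add: power2_eq_square)
    then have "- y - 2 * y\<^sup>2 \<le> ln (1 - y)" using y by (intro ln_one_minus_pos_lower_bound) auto
    moreover have "2 * y\<^sup>2 \<le> y" using y y4 mult_right_mono[of "2 * y" 1 y] by (simp add: power2_eq_square)
    moreover have "t\<^sup>2 \<le> t * (\<epsilon> / 2)" unfolding power2_eq_square using t by (intro mult_left_mono) (auto simp: t_def)
    ultimately show ?thesis using y unfolding y_def[symmetric] by linarith
  qed
  with t show ?thesis by blast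
qed

lemma cumulant_le:
  assumes "0 < v" "v \<le> w" "t * \<epsilon> / 2 \<le> t * \<epsilon> + ln (1 - t\<^sup>2 * (1 - v / w)) / 2"
  shows "cumulant v w t \<le> t * (ln (w / v) / 2) + t * \<epsilon> / 2"
    and "cumulant v w (- t) \<le> - t * (ln (w / v) / 2) + t * \<epsilon> / 2"
  using assms(3) unfolding cumulant_def power2_minus mult_minus_left by linarith+

text \<open>A rate exceeding the information \<open>I\<close> by \<epsilon> gains
  \<open>t * \<epsilon>\<close> in the exponent, of which the quadratic part of the moment exponent
  may consume half.\<close>

lemma covering_exponent:
  assumes N: "exp (real n * \<rho>) \<le> N" and \<rho>: "I + \<epsilon> \<le> \<rho>" and t: "0 < t" and \<Lambda>: "\<Lambda> \<le> t * I + t * \<epsilon> / 2"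
  shows "N powr - t / t * exp (real n * \<Lambda>) \<le> exp (- real n * (t * \<epsilon> / 2)) / t"
proof -
  have "N powr - t \<le> exp (real n * \<rho>) powr - t" using N t by (intro powr_mono2') auto
  also have "\<dots> = exp (- t * (real n * \<rho>))" by (simp add: powr_def)
  finally have "N powr - t * exp (real n * \<Lambda>) \<le> exp (- t * (real n * \<rho>)) * exp (real n * \<Lambda>)"
    by (intro mult_right_mono) auto
  also have "\<dots> = exp (real n * (\<Lambda> - t * \<rho>))" by (simp add: algebra_simps flip: exp_add)
  also have "\<dots> \<le> exp (real n * (- (t * \<epsilon> / 2)))"
  proof -
    have "t * (I + \<epsilon>) \<le> t * \<rho>" using \<rho> t by (intro mult_left_mono) auto
    then have "\<Lambda> - t * \<rho> \<le> - (t * \<epsilon> / 2)" using \<Lambda> by (simp add: distrib_left)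
    then show ?thesis by (intro iffD2[OF exp_le_cancel_iff] mult_left_mono) auto
  qed
  finally show ?thesis using t by (simp add: divide_right_mono)
qed

text \<open>\<open>nc_achievable\<close> asks for a code at every length; this one fills the lengths
  where the random coding bound is not yet useful.\<close>

lemma trivial_code: "\<exists>enc dec. nc_code n enc dec"
proof (intro exI)
  show "nc_code n (\<lambda>_ _ _. gauss_iid n 1) (\<lambda>_ _. 0)"
    unfolding nc_code_def by (auto intro!: measurable_const simp: space_prob_algebra prob_space_gauss_iid)
qed

text \<open>In nats, the bin rate \<open>r'\<close> must exceed \<open>IS\<close> so that a bin
  covers the state, \<open>r + r'\<close> must stay below \<open>IY\<close> for decoding, and
  \<open>r + rk + r'\<close> must exceed \<open>IZ\<close> so that the code covers the warden's
  output. Taking \<open>r'\<close> just under \<open>IY - r\<close> turns these conditions into the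
  two rate hypotheses.\<close>

lemma achievable_rate:
  fixes T \<sigma>2 P RK R V vS \<beta> c :: real
  assumes \<sigma>2: "\<sigma>2 > 0" and V: "V > 0" and vS: "vS > 0" and c: "c \<noteq> 0"
    and T: "T = vS + \<beta>\<^sup>2 * V" "T = (1 - c)\<^sup>2 * vS + (1 + (1 - c) * \<beta>)\<^sup>2 * V"
    and P: "(1 - c * \<beta>)\<^sup>2 * V + c\<^sup>2 * vS < P"
  defines "IS \<equiv> ln (T / vS) / 2" and "IY \<equiv> ln ((T + 1) / (1 + (1 - c)\<^sup>2 * vS)) / 2" and "IZ \<equiv> ln ((T + \<sigma>2) / (\<sigma>2 + (1 - c)\<^sup>2 * vS)) / 2"
  assumes R: "0 < R" "R * ln 2 < IY - IS" and RK: "RK * ln 2 > IZ - IY"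
  shows "nc_achievable T \<sigma>2 P RK R"
proof -
  define p0 where "p0 = (1 - c * \<beta>)\<^sup>2 * V + c\<^sup>2 * vS"
  have p0: "0 \<le> p0" "p0 < P" using V vS P by (auto simp: p0_def)
  define \<kappa> where "\<kappa> = (1 - p0 / P) / 4"
  have \<kappa>: "\<kappa> > 0" using p0 by (simp add: \<kappa>_def)
  define r where "r = R * ln 2"
  define rk where "rk = RK * ln 2"
  \<comment> \<open>A quarter of the smaller slack: \<open>r'\<close> gives up
    \<open>2 * \<epsilon>\<close>, and both covering conditions still hold with margin.\<close>
  define \<epsilon> where "\<epsilon> = min ((IY - IS - r) / 4) ((rk - (IZ - IY)) / 4)"
  have \<epsilon>1: "\<epsilon> \<le> (IY - IS - r) / 4" unfolding \<epsilon>_def by (rule min.cobounded1)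
  have \<epsilon>2: "\<epsilon> \<le> (rk - (IZ - IY)) / 4" unfolding \<epsilon>_def by (rule min.cobounded2)
  have \<epsilon>: "\<epsilon> > 0" "4 * \<epsilon> \<le> IY - IS - r" "4 * \<epsilon> \<le> rk - (IZ - IY)"
    using \<epsilon>1 \<epsilon>2 R RK by (auto simp: \<epsilon>_def r_def rk_def)
  have T0: "T > 0" using vS V by (simp add: T(1) add_pos_nonneg)
  have vST: "vS \<le> T" using V by (simp add: T(1))
  have IS0: "IS \<ge> 0" unfolding IS_def using vST vS by simp
  have vY: "0 < 1 + (1 - c)\<^sup>2 * vS" "1 + (1 - c)\<^sup>2 * vS \<le> T + 1" using vS V by (auto simp: T(2) add_pos_nonneg)
  have vZ: "0 < \<sigma>2 + (1 - c)\<^sup>2 * vS" "\<sigma>2 + (1 - c)\<^sup>2 * vS \<le> T + \<sigma>2" using vS V \<sigma>2 by (auto simp: T(2) add_pos_nonneg)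
  obtain t where t: "0 < t" "t \<le> 1 / 2" and tk: "\<And>\<kappa>. 0 \<le> \<kappa> \<Longrightarrow> \<kappa> \<le> 1 \<Longrightarrow> t * \<epsilon> / 2 \<le> t * \<epsilon> + ln (1 - t\<^sup>2 * \<kappa>) / 2"
    using small_exponent[OF \<epsilon>(1)] by blast
  define \<zeta> where "\<zeta> = t * \<epsilon> / 2"
  have \<zeta>: "\<zeta> > 0" "\<zeta> \<le> \<epsilon>" using t \<epsilon> mult_right_mono[of t 1 \<epsilon>] by (auto simp: \<zeta>_def)
  have ratio: "0 \<le> 1 - v / w" "1 - v / w \<le> 1" if "0 < v" "v \<le> w" for v w :: real using that by auto
  \<comment> \<open>Staying \<open>2 * \<epsilon>\<close> below the decoding limit leaves room for a
    threshold between \<open>r + r'\<close> and \<open>IY\<close>.\<close>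
  define r' where "r' = IY - r - 2 * \<epsilon>"
  define R' where "R' = r' / ln 2"
  have r'0: "r' \<ge> IS + 2 * \<epsilon>" using \<epsilon> by (simp add: r'_def)
  have R': "R' \<ge> 0" unfolding R'_def using r'0 IS0 \<epsilon> by simp
  have rr': "R' * ln 2 = r'" by (simp add: R'_def)
  have pw: "2 powr (real n * x) = exp (real n * (x * ln 2))" for n x by (simp add: powr_def)
  \<comment> \<open>\<open>1 / t\<close> comes from the covering bounds; 5 is 1 for a missed
    codeword plus 4 for the rivals, as each of two set sizes is rounded up by at most a factor
    2.\<close>
  define e where "e n = (1 / t + 5) * exp (- real n * \<zeta>)" for n
  have e0: "e n > 0" for n using t by (simp add: e_def add_pos_pos)
  have ET: "exp (- real n * \<zeta>) / t \<le> e n" for n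
    by (simp add: e_def distrib_right)
  have bS: "real (set_size n R') powr - t / t * exp (real n * cumulant vS T t) \<le> e n" for n
  proof -
    have "real (set_size n R') powr - t / t * exp (real n * cumulant vS T t) \<le> exp (- real n * \<zeta>) / t"
      unfolding \<zeta>_def
    proof (rule covering_exponent[OF _ _ t(1)])
      show "exp (real n * r') \<le> real (set_size n R')" using set_size_ge[of n R'] by (simp add: pw rr')
      show "IS + \<epsilon> \<le> r'" using r'0 \<epsilon> by simp
      show "cumulant vS T t \<le> t * IS + t * \<epsilon> / 2" unfolding IS_def using vS vST by (intro cumulant_le tk ratio)
    qed
    then show ?thesis using ET[of n] by simp
  qed
  have bZ: "real (set_size n R * set_size n RK * set_size n R') powr - t / t * exp (real n * cumulant (\<sigma>2 + (1 - c)\<^sup>2 * vS) (T + \<sigma>2) t) \<le> e n" for n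
  proof -
    have "real (set_size n R * set_size n RK * set_size n R') powr - t / t * exp (real n * cumulant (\<sigma>2 + (1 - c)\<^sup>2 * vS) (T + \<sigma>2) t) \<le> exp (- real n * \<zeta>) / t"
      unfolding \<zeta>_def
    proof (rule covering_exponent[OF _ _ t(1)])
      have "exp (real n * (r + rk + r')) = 2 powr (real n * R) * 2 powr (real n * RK) * 2 powr (real n * R')"
        unfolding pw rr' r_def rk_def exp_add[symmetric] by (simp add: algebra_simps)
      also have "\<dots> \<le> real (set_size n R) * real (set_size n RK) * real (set_size n R')"
        by (intro mult_mono set_size_ge) auto
      finally show "exp (real n * (r + rk + r')) \<le> real (set_size n R * set_size n RK * set_size n R')" by simp
      show "IZ + \<epsilon> \<le> r + rk + r'" using \<epsilon> by (simp add: r'_def)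
      show "cumulant (\<sigma>2 + (1 - c)\<^sup>2 * vS) (T + \<sigma>2) t \<le> t * IZ + t * \<epsilon> / 2" unfolding IZ_def using vZ by (intro cumulant_le tk ratio)
    qed
    then show ?thesis using ET[of n] by simp
  qed
  \<comment> \<open>The exponent lies \<epsilon> below \<open>IY\<close>, so that the sent codeword
    tends to pass, and \<epsilon> above \<open>r + r'\<close>, so that rivals tend to fail.\<close>
  define \<theta> where "\<theta> n = exp (real n * (IY - \<epsilon>))" for n
  have bY: "\<theta> n powr t * exp (real n * cumulant (1 + (1 - c)\<^sup>2 * vS) (T + 1) (- t)) + real (set_size n R * set_size n R') / \<theta> n \<le> e n" for n
  proof -
    have "cumulant (1 + (1 - c)\<^sup>2 * vS) (T + 1) (- t) \<le> - t * IY + \<zeta>"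
      unfolding IY_def \<zeta>_def using vY by (intro cumulant_le tk ratio)
    then have "exp (real n * cumulant (1 + (1 - c)\<^sup>2 * vS) (T + 1) (- t)) \<le> exp (real n * (- t * IY + \<zeta>))"
      by (intro iffD2[OF exp_le_cancel_iff] mult_left_mono) auto
    then have "\<theta> n powr t * exp (real n * cumulant (1 + (1 - c)\<^sup>2 * vS) (T + 1) (- t)) \<le> exp (t * (real n * (IY - \<epsilon>))) * exp (real n * (- t * IY + \<zeta>))"
      unfolding \<theta>_def by (intro mult_mono) (auto simp: powr_def)
    also have "\<dots> = exp (- real n * \<zeta>)" by (simp add: \<zeta>_def algebra_simps flip: exp_add)
    finally have 1: "\<theta> n powr t * exp (real n * cumulant (1 + (1 - c)\<^sup>2 * vS) (T + 1) (- t)) \<le> exp (- real n * \<zeta>)" .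
    have "real (set_size n R) * real (set_size n R') \<le> (2 * 2 powr (real n * R)) * (2 * 2 powr (real n * R'))"
      using R R' by (intro mult_mono set_size_le) auto
    also have "\<dots> = 4 * exp (real n * (r + r'))"
      unfolding pw rr' r_def distrib_left exp_add by simp
    finally have "real (set_size n R * set_size n R') / \<theta> n \<le> 4 * exp (real n * (r + r')) / \<theta> n"
      by (intro divide_right_mono) (auto simp: \<theta>_def)
    also have "\<dots> = 4 * exp (real n * (r + r') - real n * (IY - \<epsilon>))" by (simp add: \<theta>_def exp_diff)
    also have "real n * (r + r') - real n * (IY - \<epsilon>) = - real n * \<epsilon>" by (simp add: r'_def algebra_simps)
    also have "4 * exp (- real n * \<epsilon>) \<le> 4 * exp (- real n * \<zeta>)" using \<zeta> by (simp add: mult_left_mono)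
    finally have "real (set_size n R * set_size n R') / \<theta> n \<le> 4 * exp (- real n * \<zeta>)" .
    moreover have "5 * exp (- real n * \<zeta>) \<le> e n" using t by (simp add: e_def distrib_right)
    ultimately show ?thesis using 1 by linarith
  qed
  define x where "x n = e n / \<kappa>" for n
  have x0: "x n > 0" for n using e0 \<kappa> by (simp add: x_def)
  have "(\<lambda>n. exp (- real n * \<zeta>)) \<longlonglongrightarrow> 0" using \<zeta>(1) by real_asymp
  from tendsto_divide[OF tendsto_mult[OF tendsto_const[of "1 / t + 5"] this] tendsto_const[of \<kappa>]] \<kappa>
  have "(\<lambda>n. (1 / t + 5) * exp (- real n * \<zeta>) / \<kappa>) \<longlonglongrightarrow> 0" by simp
  then have xlim: "x \<longlonglongrightarrow> 0" unfolding x_def[abs_def] e_def .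
  then have xright: "filterlim x (at_right 0) sequentially" using x0 less_imp_neq[OF x0, symmetric] by (auto simp: filterlim_at)
  have ev: "eventually (\<lambda>n. n \<ge> 1 \<and> x n \<le> 1) sequentially"
    using eventually_conj[OF eventually_ge_at_top[of 1] order_tendstoD(2)[OF xlim zero_less_one]]
    by eventually_elim auto
  \<comment> \<open>Codes are chosen for all lengths at once; the estimates are demanded only where
    \<open>x n \<le> 1\<close>, which holds eventually.\<close>
  define good where "good n ed \<longleftrightarrow> nc_code n (fst ed) (snd ed) \<and> (n \<ge> 1 \<and> x n \<le> 1 \<longrightarrow>
      avg_power n T R RK (fst ed) \<le> ennreal P \<and> 0 \<le> err_prob n T R RK (fst ed) (snd ed)
    \<and> err_prob n T R RK (fst ed) (snd ed) \<le> x n + 3 / 2 * sqrt (x n)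
    \<and> 0 \<le> rel_entropy (warden_dist n T \<sigma>2 R RK (fst ed)) (gauss_iid n (T + \<sigma>2))
    \<and> rel_entropy (warden_dist n T \<sigma>2 R RK (fst ed)) (gauss_iid n (T + \<sigma>2)) \<le> ereal (kl_bound (x n)))" for n ed
  have "\<forall>n. \<exists>ed. good n ed"
  proof
    fix n
    show "\<exists>ed. good n ed"
    proof (cases "n \<ge> 1 \<and> x n \<le> 1")
      case True
      have "\<exists>enc dec. nc_code n enc dec \<and> avg_power n T R RK enc \<le> ennreal P \<and> 0 \<le> err_prob n T R RK enc dec
        \<and> err_prob n T R RK enc dec \<le> x n + 3 / 2 * sqrt (x n)
        \<and> 0 \<le> rel_entropy (warden_dist n T \<sigma>2 R RK enc) (gauss_iid n (T + \<sigma>2))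
        \<and> rel_entropy (warden_dist n T \<sigma>2 R RK enc) (gauss_iid n (T + \<sigma>2)) \<le> ereal (kl_bound (x n))"
        unfolding x_def \<kappa>_def p0_def
        by (rule exists_code[OF V _ set_size_pos vS \<sigma>2 T c _ _ _ _ _ _ _ e0 bS bZ bY P])
          (use True t in \<open>auto simp: \<theta>_def x_def \<kappa>_def p0_def\<close>)
      then obtain enc dec where "good n (enc, dec)" unfolding good_def by auto
      then show ?thesis by blast
    next
      case False
      obtain enc dec where "nc_code n enc dec" using trivial_code by blast
      then have "good n (enc, dec)" using False unfolding good_def by auto
      then show ?thesis by blast
    qed
  qed
  from choice[OF this] obtain ed where ed: "\<And>n. good n (ed n)" by blast
  define enc where "enc n = fst (ed n)" for n
  define dec where "dec n = snd (ed n)" for n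
  have nc: "nc_code n (enc n) (dec n)" for n using ed[of n] unfolding good_def enc_def dec_def by blast
  have G: "avg_power n T R RK (enc n) \<le> ennreal P" "0 \<le> err_prob n T R RK (enc n) (dec n)"
    "err_prob n T R RK (enc n) (dec n) \<le> x n + 3 / 2 * sqrt (x n)"
    "0 \<le> rel_entropy (warden_dist n T \<sigma>2 R RK (enc n)) (gauss_iid n (T + \<sigma>2))"
    "rel_entropy (warden_dist n T \<sigma>2 R RK (enc n)) (gauss_iid n (T + \<sigma>2)) \<le> ereal (kl_bound (x n))" if "n \<ge> 1 \<and> x n \<le> 1" for n
    using ed[of n] that unfolding good_def enc_def dec_def by blast+
  have "limsup (\<lambda>n. avg_power n T R RK (enc n)) \<le> ennreal P"
  proof (rule Limsup_bounded)
    show "eventually (\<lambda>n. avg_power n T R RK (enc n) \<le> ennreal P) sequentially"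
      using ev by eventually_elim (rule G(1))
  qed
  moreover have "(\<lambda>n. err_prob n T R RK (enc n) (dec n)) \<longlonglongrightarrow> 0"
  proof (rule tendsto_sandwich)
    show "eventually (\<lambda>n. 0 \<le> err_prob n T R RK (enc n) (dec n)) sequentially"
      using ev by eventually_elim (rule G(2))
    show "eventually (\<lambda>n. err_prob n T R RK (enc n) (dec n) \<le> x n + 3 / 2 * sqrt (x n)) sequentially"
      using ev by eventually_elim (rule G(3))
    have "(\<lambda>n. x n + 3 / 2 * sqrt (x n)) \<longlonglongrightarrow> 0 + 3 / 2 * sqrt 0" by (intro tendsto_intros xlim)
    then show "(\<lambda>n. x n + 3 / 2 * sqrt (x n)) \<longlonglongrightarrow> 0" by simp
  qed simp
  moreover have "(\<lambda>n. rel_entropy (warden_dist n T \<sigma>2 R RK (enc n)) (gauss_iid n (T + \<sigma>2))) \<longlonglongrightarrow> 0"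
  proof (rule tendsto_sandwich)
    show "eventually (\<lambda>n. 0 \<le> rel_entropy (warden_dist n T \<sigma>2 R RK (enc n)) (gauss_iid n (T + \<sigma>2))) sequentially"
      using ev by eventually_elim (rule G(4))
    show "eventually (\<lambda>n. rel_entropy (warden_dist n T \<sigma>2 R RK (enc n)) (gauss_iid n (T + \<sigma>2)) \<le> ereal (kl_bound (x n))) sequentially"
      using ev by eventually_elim (rule G(5))
    have "(\<lambda>n. kl_bound (x n)) \<longlonglongrightarrow> 0" by (rule filterlim_compose[OF kl_bound_tendsto xright])
    then show "(\<lambda>n. ereal (kl_bound (x n))) \<longlonglongrightarrow> 0" by (simp add: zero_ereal_def)
  qed simp
  ultimately show ?thesis unfolding nc_achievable_def using nc by blast
qed

text \<open>Costa's construction: of the state only \<open>a * S\<close> remains, the auxiliary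
  variable is \<open>U = X' + \<alpha> * a * S\<close>, and the input is \<open>U - c * S\<close>.
  Then \<open>V\<close>, \<beta> and \<open>vS\<close> are the variance of \<open>U\<close>, the
  regression coefficient of \<open>S\<close> on \<open>U\<close>, and the residual variance of
  \<open>S\<close>.\<close>

lemma dirty_paper_achievable:
  fixes T \<sigma>2 P RK R g :: real
  assumes T: "T > 0" and \<sigma>2: "\<sigma>2 > 0" and g: "0 < g" "g < 1" "2 * g * T < P"
  defines "\<tau> \<equiv> (1 - g)\<^sup>2 * T" and "p \<equiv> T - (1 - g)\<^sup>2 * T" and "\<alpha> \<equiv> (T - (1 - g)\<^sup>2 * T) / (T - (1 - g)\<^sup>2 * T + 1)"
  assumes R: "0 < R" "R < 1/2 * log 2 (1 + p)" and RK: "RK > info_term p \<tau> \<sigma>2 \<alpha> - info_term p \<tau> 1 \<alpha>"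
  shows "nc_achievable T \<sigma>2 P RK R"
proof -
  define a where "a = 1 - g"
  have a: "0 < a" "a < 1" using g by (auto simp: a_def)
  have \<alpha>: "\<alpha> = p / (p + 1)" by (simp add: \<alpha>_def p_def)
  have \<tau>a: "\<tau> = a\<^sup>2 * T" by (simp add: \<tau>_def a_def)
  have pT: "p + \<tau> = T" by (simp add: p_def \<tau>_def)
  have "a\<^sup>2 < 1" using a by (simp add: abs_square_less_1)
  then have p: "p > 0" using T pT \<tau>a by (smt (verit) mult_less_cancel_right2)
  have \<tau>: "\<tau> > 0" using a T by (simp add: \<tau>a)
  have \<alpha>0: "0 < \<alpha>" "\<alpha> < 1" using p by (auto simp: \<alpha>)
  define V where "V = p + \<alpha>\<^sup>2 * \<tau>"
  have V: "V > 0" using p \<tau> by (simp add: V_def add_pos_nonneg)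
  define \<beta> where "\<beta> = \<alpha> * a * T / V"
  define vS where "vS = T * p / V"
  define c where "c = \<alpha> * a + g"
  have vS: "vS > 0" using T p V by (simp add: vS_def)
  have c: "c > 0" using \<alpha>0 a g by (simp add: c_def add_pos_pos)
  have bV: "\<beta> * V = \<alpha> * a * T" using V by (simp add: \<beta>_def)
  have T1: "T = vS + \<beta>\<^sup>2 * V"
  proof -
    have "vS + \<beta>\<^sup>2 * V = (T * p + (\<alpha> * a * T)\<^sup>2) / V"
      using V by (simp add: vS_def \<beta>_def power2_eq_square field_simps)
    also have "T * p + (\<alpha> * a * T)\<^sup>2 = T * V" by (simp add: V_def \<tau>a power2_eq_square algebra_simps)
    finally show ?thesis using V by simp
  qed
  have c1: "1 - c = a * (1 - \<alpha>)" by (simp add: c_def a_def algebra_simps)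
  have bz: "1 + (1 - c) * \<beta> = (p + \<alpha> * \<tau>) / V"
  proof -
    have "1 + (1 - c) * \<beta> = (V + a * (1 - \<alpha>) * (\<alpha> * a * T)) / V" using V by (simp add: c1 \<beta>_def field_simps)
    also have "V + a * (1 - \<alpha>) * (\<alpha> * a * T) = p + \<alpha> * \<tau>" by (simp add: V_def \<tau>a power2_eq_square algebra_simps)
    finally show ?thesis .
  qed
  have bz2: "(1 + (1 - c) * \<beta>)\<^sup>2 * V = (p + \<alpha> * \<tau>)\<^sup>2 / V"
    unfolding bz using V by (simp add: power2_eq_square)
  have cv: "(1 - c)\<^sup>2 * vS = \<tau> * (1 - \<alpha>)\<^sup>2 * p / V" by (simp add: c1 vS_def \<tau>a power2_eq_square)
  have T2: "T = (1 - c)\<^sup>2 * vS + (1 + (1 - c) * \<beta>)\<^sup>2 * V"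
  proof -
    have "(1 - c)\<^sup>2 * vS + (1 + (1 - c) * \<beta>)\<^sup>2 * V = (\<tau> * (1 - \<alpha>)\<^sup>2 * p + (p + \<alpha> * \<tau>)\<^sup>2) / V"
      unfolding bz2 cv by (simp add: add_divide_distrib)
    also have "\<tau> * (1 - \<alpha>)\<^sup>2 * p + (p + \<alpha> * \<tau>)\<^sup>2 = (p + \<tau>) * V"
      by (simp add: V_def power2_eq_square algebra_simps)
    finally show ?thesis using V pT by simp
  qed
  have P: "(1 - c * \<beta>)\<^sup>2 * V + c\<^sup>2 * vS < P"
  proof -
    have "(1 - c * \<beta>)\<^sup>2 * V + c\<^sup>2 * vS = V - 2 * c * (\<beta> * V) + c\<^sup>2 * (vS + \<beta>\<^sup>2 * V)"
      by (simp add: power2_eq_square algebra_simps)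
    also have "\<dots> = V - 2 * c * (\<alpha> * a * T) + c\<^sup>2 * T" by (simp add: bV T1[symmetric])
    \<comment> \<open>Power of the independent part plus the power spent on cancelling
      \<open>g * S\<close>.\<close>
    also have "\<dots> = p + g\<^sup>2 * T" by (simp add: V_def \<tau>a c_def power2_eq_square algebra_simps)
    also have "\<dots> = 2 * g * T" by (simp add: p_def power2_eq_square algebra_simps)
    finally show ?thesis using g by simp
  qed
  have info: "info_term p \<tau> v \<alpha> * ln 2 = ln ((T + v) / (v + (1 - c)\<^sup>2 * vS)) / 2" if v: "v > 0" for v
  proof -
    define q where "q = v + (1 - c)\<^sup>2 * vS"
    have q: "q > 0" using v vS by (simp add: q_def add_pos_nonneg)
    have "q = T + v - (p + \<alpha> * \<tau>)\<^sup>2 / V" using T2 by (simp add: q_def bz2)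
    then have Vq: "V * q = V * (p + \<tau> + v) - (p + \<alpha> * \<tau>)\<^sup>2" using V pT by (simp add: field_simps)
    then have "1 + (p + \<alpha> * \<tau>)\<^sup>2 / (V * (p + \<tau> + v) - (p + \<alpha> * \<tau>)\<^sup>2) = (V * q + (p + \<alpha> * \<tau>)\<^sup>2) / (V * q)"
      unfolding Vq[symmetric] using V q by (simp add: field_simps)
    also have "V * q + (p + \<alpha> * \<tau>)\<^sup>2 = V * (T + v)" using Vq pT by simp
    also have "V * (T + v) / (V * q) = (T + v) / q" using V by simp
    finally show ?thesis unfolding info_term_def V_def[symmetric] q_def[symmetric] by (simp add: log_def)
  qed
  \<comment> \<open>Costa's identity: for \<alpha> equal to \<open>p / (p + 1)\<close> the net rate
    is that of a unit-noise channel without interference.\<close>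
  have IYS: "ln ((T + 1) / (1 + (1 - c)\<^sup>2 * vS)) / 2 - ln (T / vS) / 2 = ln (1 + p) / 2"
  proof -
    define q where "q = 1 + (1 - c)\<^sup>2 * vS"
    have q: "q > 0" using vS by (simp add: q_def add_pos_nonneg)
    have "V * q = V + \<tau> * (1 - \<alpha>)\<^sup>2 * p" unfolding q_def cv using V by (simp add: distrib_left)
    then have "V * q = p + \<alpha>\<^sup>2 * \<tau> + \<tau> * (1 - \<alpha>)\<^sup>2 * p" by (simp add: V_def)
    moreover have a1: "\<alpha> * (1 + p) = p" using p by (simp add: \<alpha> field_simps)
    have "(p + \<alpha>\<^sup>2 * \<tau> + \<tau> * (1 - \<alpha>)\<^sup>2 * p) * (1 + p) = p * (T + 1)"
    proof -
      have "(p + \<alpha>\<^sup>2 * \<tau> + \<tau> * (1 - \<alpha>)\<^sup>2 * p) * (1 + p) = p * (1 + p) + \<tau> * (\<alpha> * (\<alpha> * (1 + p)) + p * (1 - \<alpha>) * ((1 + p) - \<alpha> * (1 + p)))"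
        by (simp add: power2_eq_square algebra_simps)
      also have "\<dots> = p * (1 + p) + \<tau> * p" unfolding a1 by (simp add: algebra_simps)
      also have "\<dots> = p * (T + 1)" unfolding pT[symmetric] by (simp add: algebra_simps)
      finally show ?thesis .
    qed
    ultimately have "V * q * (1 + p) = p * (T + 1)" by simp
    then have eq: "(T + 1) / q / (T / vS) = 1 + p" using V q p T by (simp add: vS_def field_simps)
    have pos: "(T + 1) / q > 0" "T / vS > 0" using q T vS by auto
    have "ln (A / B) = ln A - ln B" if "A > 0" "B > 0" for A B :: real using that by (simp add: ln_div)
    from this[OF pos] have "ln (1 + p) = ln ((T + 1) / q) - ln (T / vS)" unfolding eq .
    then show ?thesis by (simp add: q_def diff_divide_distrib)
  qed
  show ?thesis
  proof (rule achievable_rate[OF \<sigma>2 V vS _ T1 T2 P R(1)])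
    show "c \<noteq> 0" using c by simp
    have "R * ln 2 < (1/2 * log 2 (1 + p)) * ln 2" using R(2) by (intro mult_strict_right_mono) auto
    then show "R * ln 2 < ln ((T + 1) / (1 + (1 - c)\<^sup>2 * vS)) / 2 - ln (T / vS) / 2"
      unfolding IYS by (simp add: log_def)
    have "(info_term p \<tau> \<sigma>2 \<alpha> - info_term p \<tau> 1 \<alpha>) * ln 2 < RK * ln 2" using RK by (intro mult_strict_right_mono) auto
    then show "ln ((T + \<sigma>2) / (\<sigma>2 + (1 - c)\<^sup>2 * vS)) / 2 - ln ((T + 1) / (1 + (1 - c)\<^sup>2 * vS)) / 2 < RK * ln 2"
      by (simp add: left_diff_distrib info \<sigma>2)
  qed
qed

text \<open>Working at a correlation parameter slightly below the optimal one leaves slack in the power constraint;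
  rate and key condition are continuous in this parameter.\<close>

lemma achievable_below_capacity:
  fixes T \<sigma>2 P RK R g :: real
  assumes T: "T > 0" and \<sigma>2: "\<sigma>2 > 0" and P: "P > 0"
  defines "g \<equiv> min 1 (P / (2 * T))"
  defines "\<tau> \<equiv> \<lambda>g. (1 - g)\<^sup>2 * T" and "p \<equiv> \<lambda>g. T - (1 - g)\<^sup>2 * T"
  assumes R: "0 < R" "R < 1/2 * log 2 (1 + p g)"
    and RK: "RK > info_term (p g) (\<tau> g) \<sigma>2 (p g / (p g + 1)) - info_term (p g) (\<tau> g) 1 (p g / (p g + 1))"
  shows "nc_achievable T \<sigma>2 P RK R"
proof -
  have g: "0 < g" "g \<le> 1" using T P by (auto simp: g_def)
  have "(1 - g)\<^sup>2 < 1" using g by (simp add: abs_square_less_1)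
  then have pg: "p g > 0" using T by (simp add: p_def)
  have \<tau>g: "\<tau> g \<ge> 0" using T by (simp add: \<tau>_def)
  \<comment> \<open>The determinant is positive also for \<open>g = 1\<close>, where
    \<open>\<tau> g = 0\<close>, so both regimes of the minimum are treated together.\<close>
  have cont: "isCont (\<lambda>g. info_term (p g) (\<tau> g) v (p g / (p g + 1))) g" if v: "v > 0" for v
  proof -
    have d: "(p g + (p g / (p g + 1))\<^sup>2 * \<tau> g) * (p g + \<tau> g + v) - (p g + p g / (p g + 1) * \<tau> g)\<^sup>2 > 0"
      by (rule info_denominator_pos[OF pg \<tau>g v])
    have p: "isCont p g" "isCont \<tau> g" unfolding p_def \<tau>_def by (intro continuous_intros)+
    have "1 + (p g + p g / (p g + 1) * \<tau> g)\<^sup>2 / ((p g + (p g / (p g + 1))\<^sup>2 * \<tau> g) * (p g + \<tau> g + v) - (p g + p g / (p g + 1) * \<tau> g)\<^sup>2) > 0"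
      using d by (intro add_pos_nonneg divide_nonneg_nonneg) auto
    then show ?thesis unfolding info_term_def log_def
      using d pg by (intro continuous_intros p isCont_ln) auto
  qed
  have c1: "isCont (\<lambda>g. 1/2 * log 2 (1 + p g)) g"
    unfolding log_def p_def using pg by (intro continuous_intros isCont_ln) (auto simp: p_def)
  have c2: "isCont (\<lambda>g. info_term (p g) (\<tau> g) \<sigma>2 (p g / (p g + 1)) - info_term (p g) (\<tau> g) 1 (p g / (p g + 1))) g"
    using \<sigma>2 by (intro continuous_intros cont) auto
  have "eventually (\<lambda>x. R < 1/2 * log 2 (1 + p x)) (at_left g)"
    using order_tendstoD(1)[OF isContD[OF c1] R(2)] by (rule filter_leD[OF at_le[OF subset_UNIV]])
  moreover have "eventually (\<lambda>x. info_term (p x) (\<tau> x) \<sigma>2 (p x / (p x + 1)) - info_term (p x) (\<tau> x) 1 (p x / (p x + 1)) < RK) (at_left g)"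
    using order_tendstoD(2)[OF isContD[OF c2] RK] by (rule filter_leD[OF at_le[OF subset_UNIV]])
  moreover have "eventually (\<lambda>x. x \<in> {0<..<g}) (at_left g)" using g by (intro eventually_at_left_real)
  ultimately have "eventually (\<lambda>x. R < 1/2 * log 2 (1 + p x) \<and> info_term (p x) (\<tau> x) \<sigma>2 (p x / (p x + 1)) - info_term (p x) (\<tau> x) 1 (p x / (p x + 1)) < RK
     \<and> x \<in> {0<..<g}) (at_left g)"
    by eventually_elim auto
  then obtain x where x: "R < 1/2 * log 2 (1 + p x)" "info_term (p x) (\<tau> x) \<sigma>2 (p x / (p x + 1)) - info_term (p x) (\<tau> x) 1 (p x / (p x + 1)) < RK"
    "0 < x" "x < g"
    using eventually_happens'[of "at_left g"] by (auto simp: trivial_limit_at_left_real)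
  have "x < P / (2 * T)" using x by (simp add: g_def)
  then have "2 * x * T < P" using T by (simp add: field_simps)
  then show ?thesis using x g R unfolding p_def \<tau>_def by (intro dirty_paper_achievable[OF T \<sigma>2, of x]) auto
qed

section \<open>Converse\<close>

lemma second_moment_add_noise_integral:
  assumes "v > 0"
  shows "integrable (add_noise n v a) (\<lambda>z. \<Sum>i<n. (z i - e i)\<^sup>2)"
    and "(\<integral>z. (\<Sum>i<n. (z i - e i)\<^sup>2) \<partial>add_noise n v a) = (\<Sum>i<n. (a i - e i)\<^sup>2) + real n * v"
proof -
  have [measurable]: "(\<lambda>z. \<Sum>i<n. (z i - e i)\<^sup>2) \<in> borel_measurable (add_noise n v a)"
    unfolding measurable_cong_sets[OF sets_add_noise refl]
    by (intro borel_measurable_sum borel_measurable_power borel_measurable_diff borel_measurable_const vspace_component) auto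
  show i: "integrable (add_noise n v a) (\<lambda>z. \<Sum>i<n. (z i - e i)\<^sup>2)"
    using second_moment_add_noise[OF assms] by (intro integrableI_nonneg) (auto intro!: sum_nonneg simp del: ennreal_plus)
  show "(\<integral>z. (\<Sum>i<n. (z i - e i)\<^sup>2) \<partial>add_noise n v a) = (\<Sum>i<n. (a i - e i)\<^sup>2) + real n * v"
  proof (subst integral_eq_nn_integral)
    have "0 \<le> (\<Sum>i<n. (a i - e i)\<^sup>2) + real n * v" using assms by (intro add_nonneg_nonneg sum_nonneg) auto
    then show "enn2real (\<integral>\<^sup>+z. ennreal (\<Sum>i<n. (z i - e i)\<^sup>2) \<partial>add_noise n v a) = (\<Sum>i<n. (a i - e i)\<^sup>2) + real n * v"
      unfolding second_moment_add_noise[OF assms] by (rule enn2real_ennreal)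
  qed (auto intro!: sum_nonneg)
qed

lemma prob_space_add_noise: "v > 0 \<Longrightarrow> prob_space (add_noise n v a)"
  unfolding add_noise_eq_PiM by (intro prob_space_PiM prob_space_gm)

lemma ln_LR:
  assumes "v > 0" "w > 0"
  shows "ln (LR n v w a z) = (\<Sum>i<n. - (z i - a i)\<^sup>2 / (2 * v) + (z i)\<^sup>2 / (2 * w) + ln (w / v) / 2)"
  unfolding LR_def using lr_pos[OF assms] by (subst ln_prod) (auto simp: lr_exp[OF assms])

text \<open>Replaces Fano's inequality: apply \<open>ln t \<le> t - 1\<close> to the reweighted density ratio.\<close>

lemma gaussian_change_of_measure:
  assumes w: "w > 0" and N: "N \<ge> 1" and D[measurable]: "D \<in> sets (vspace n)"
  shows "measure (add_noise n 1 a) D * ln N \<le> (N - 1) * measure (add_noise n w b) D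
    + real n / 2 * (ln w + 1 / w - 1) + (\<Sum>i<n. (a i - b i)\<^sup>2) / (2 * w)"
proof -
  define p where "p = LR n 1 w a"
  define q where "q = LR n w w b"
  have [measurable]: "p \<in> borel_measurable (vspace n)" "q \<in> borel_measurable (vspace n)" unfolding p_def q_def by measurable
  have pos: "p y > 0" "q y > 0" for y unfolding p_def q_def using w by (auto intro!: LR_pos)
  let ?P = "add_noise n 1 a" and ?Q = "add_noise n w b"
  interpret P: prob_space ?P by (rule prob_space_add_noise) simp
  interpret Q: prob_space ?Q by (rule prob_space_add_noise) (rule w)
  have Pd: "?P = density (gauss_iid n w) (\<lambda>y. ennreal (p y))" unfolding p_def using w by (intro add_noise_density) auto
  have Qd: "?Q = density (gauss_iid n w) (\<lambda>y. ennreal (q y))" unfolding q_def using w by (intro add_noise_density) auto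
  have mP: "measurable ?P M = measurable (vspace n) M" for M by (rule measurable_cong_sets) auto
  have mQ: "measurable ?Q M = measurable (vspace n) M" for M by (rule measurable_cong_sets) auto
  \<comment> \<open>With this weight \<open>ln (g * q / p)\<close> gains \<open>ln N\<close> on
    \<open>D\<close>, while the mean of \<open>g * q / p\<close> under the true law exceeds 1 only
    by \<open>N - 1\<close> times the comparison probability of \<open>D\<close>.\<close>
  define g where "g y = (if y \<in> D then N else 1)" for y :: "nat \<Rightarrow> real"
  have [measurable]: "g \<in> borel_measurable (vspace n)" unfolding g_def by measurable
  have g: "g y \<ge> 1" for y using N by (simp add: g_def)
  define X where "X y = (\<Sum>i<n. (y i - a i)\<^sup>2)" for y
  define Y where "Y y = (\<Sum>i<n. (y i - b i)\<^sup>2)" for y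
  have iX: "integrable ?P X" "(\<integral>y. X y \<partial>?P) = real n"
    using second_moment_add_noise_integral[of 1 n a a] by (simp_all add: X_def[abs_def])
  have iY: "integrable ?P Y" "(\<integral>y. Y y \<partial>?P) = (\<Sum>i<n. (a i - b i)\<^sup>2) + real n"
    using second_moment_add_noise_integral[of 1 n a b] by (simp_all add: Y_def[abs_def])
  have lnpq: "ln (p y) - ln (q y) = - X y / 2 + Y y / (2 * w) + real n * (ln w / 2)" for y
  proof -
    have "ln (p y) - ln (q y) = (\<Sum>i<n. (- ((y i - a i)\<^sup>2 / 2) + (y i - b i)\<^sup>2 / (2 * w)) + ln w / 2)"
      unfolding p_def q_def using w by (simp add: ln_LR algebra_simps flip: sum_subtractf)
    also have "\<dots> = - X y / 2 + Y y / (2 * w) + real n * (ln w / 2)"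
      by (simp add: X_def Y_def sum.distrib sum_subtractf sum_divide_distrib sum_negf)
    finally show ?thesis .
  qed
  have nn: "(\<integral>\<^sup>+y. ennreal (g y * q y / p y) \<partial>?P) = ennreal (1 + (N - 1) * measure ?Q D)"
  proof -
    have "(\<integral>\<^sup>+y. ennreal (g y * q y / p y) \<partial>?P) = (\<integral>\<^sup>+y. ennreal (p y) * ennreal (g y * q y / p y) \<partial>gauss_iid n w)"
      unfolding Pd by (subst nn_integral_density) auto
    also have "\<dots> = (\<integral>\<^sup>+y. ennreal (q y) * ennreal (g y) \<partial>gauss_iid n w)"
    proof (intro nn_integral_cong)
      fix y
      have "p y * (g y * q y / p y) = q y * g y" using pos[of y] by simp
      then show "ennreal (p y) * ennreal (g y * q y / p y) = ennreal (q y) * ennreal (g y)"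
        using pos[of y] g[of y] by (simp add: ennreal_mult[symmetric])
    qed
    also have "\<dots> = (\<integral>\<^sup>+y. ennreal (g y) \<partial>?Q)"
      unfolding Qd by (subst nn_integral_density) auto
    also have "\<dots> = (\<integral>\<^sup>+y. 1 + ennreal (N - 1) * indicator D y \<partial>?Q)"
    proof (intro nn_integral_cong)
      fix y
      have "1 + ennreal (N - 1) = ennreal N" using N ennreal_plus[of 1 "N - 1"] by simp
      then show "ennreal (g y) = 1 + ennreal (N - 1) * indicator D y" by (simp add: g_def)
    qed
    also have "\<dots> = 1 + ennreal (N - 1) * emeasure ?Q D"
      by (simp add: nn_integral_add nn_integral_cmult Q.emeasure_space_1 mQ)
    also have "\<dots> = ennreal (1 + (N - 1) * measure ?Q D)"
      using N by (simp add: Q.emeasure_eq_measure ennreal_mult[symmetric] flip: ennreal_1 ennreal_plus)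
    finally show ?thesis .
  qed
  have Rp: "0 \<le> g y * q y / p y" for y using pos[of y] g[of y] by simp
  have iR: "integrable ?P (\<lambda>y. g y * q y / p y)" using nn Rp by (intro integrableI_nonneg) (auto simp: mP)
  have eR: "(\<integral>y. g y * q y / p y \<partial>?P) = 1 + (N - 1) * measure ?Q D"
  proof (subst integral_eq_nn_integral)
    have "0 \<le> 1 + (N - 1) * measure ?Q D" using N by simp
    then show "enn2real (\<integral>\<^sup>+y. ennreal (g y * q y / p y) \<partial>?P) = 1 + (N - 1) * measure ?Q D"
      unfolding nn by (rule enn2real_ennreal)
  qed (use Rp in \<open>auto simp: mP\<close>)
  have iD: "integrable ?P (indicator D :: _ \<Rightarrow> real)" by (auto simp: less_top[symmetric])
  have "(\<integral>y. indicator D y * ln N - (- X y / 2 + Y y / (2 * w) + real n * (ln w / 2)) \<partial>?P) \<le> (\<integral>y. g y * q y / p y - 1 \<partial>?P)"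
  proof (rule integral_mono)
    show "integrable ?P (\<lambda>y. indicator D y * ln N - (- X y / 2 + Y y / (2 * w) + real n * (ln w / 2)))"
      using iX iY iD by auto
    show "integrable ?P (\<lambda>y. g y * q y / p y - 1)" using iR by auto
    fix y
    have "ln (g y * q y / p y) \<le> g y * q y / p y - 1" using pos[of y] g[of y] by (intro ln_le_minus_one) auto
    moreover have "ln (g y * q y / p y) = ln (g y) - (ln (p y) - ln (q y))"
      using pos[of y] g[of y] by (simp add: ln_mult ln_div)
    moreover have "ln (g y) = indicator D y * ln N" by (simp add: g_def)
    ultimately show "indicator D y * ln N - (- X y / 2 + Y y / (2 * w) + real n * (ln w / 2)) \<le> g y * q y / p y - 1"
      unfolding lnpq by simp
  qed
  also have "(\<integral>y. g y * q y / p y - 1 \<partial>?P) = (N - 1) * measure ?Q D" using iR eR by (simp add: P.prob_space)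
  also have "(\<integral>y. indicator D y * ln N - (- X y / 2 + Y y / (2 * w) + real n * (ln w / 2)) \<partial>?P)
     = measure ?P D * ln N - (- real n / 2 + ((\<Sum>i<n. (a i - b i)\<^sup>2) + real n) / (2 * w) + real n * (ln w / 2))"
    using iX iY iD by (simp add: P.prob_space)
  finally have "measure ?P D * ln N \<le> (N - 1) * measure ?Q D + (- real n / 2 + ((\<Sum>i<n. (a i - b i)\<^sup>2) + real n) / (2 * w) + real n * (ln w / 2))"
    by linarith
  moreover have "- real n / 2 + (S + real n) / (2 * w) + real n * (ln w / 2) = real n / 2 * (ln w + 1 / w - 1) + S / (2 * w)" for S
    using w by (simp add: field_simps)
  ultimately show ?thesis by (simp only: add.assoc)
qed

text \<open>Variational bound on relative entropy with the centred Gaussian of larger variance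
  \<open>v'\<close> as test law: the logarithm of its ratio is a positive multiple of the energy
  plus a constant. For bounded \<open>B\<close> and \<open>v'\<close> close to \<open>v\<close>, the
  energy can hardly exceed \<open>n * v\<close>.\<close>

lemma warden_second_moment:
  assumes v: "v > 0" "v' > v" and W: "prob_space W" and fin: "(\<integral>\<^sup>+z. ennreal (\<Sum>i<n. (z i)\<^sup>2) \<partial>W) < \<infinity>"
    and re: "rel_entropy W (gauss_iid n v) \<le> ereal B"
  shows "(\<integral>\<^sup>+z. ennreal (\<Sum>i<n. (z i)\<^sup>2) \<partial>W) \<le> ennreal ((2 * B + real n * ln (v' / v)) / (1 / v - 1 / v'))"
proof -
  let ?Q = "gauss_iid n v"
  interpret W: prob_space W by fact
  interpret Q: prob_space ?Q by (rule prob_space_gauss_iid[OF v(1)])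
  have ac: "absolutely_continuous ?Q W" "sets W = sets ?Q" "integrable W (entropy_density (exp 1) ?Q W)"
    and KL: "KL_divergence (exp 1) ?Q W \<le> B"
    using re unfolding rel_entropy_def by (auto split: if_splits)
  have mW: "measurable W M = measurable (vspace n) M" for M using ac(2) by (intro measurable_cong_sets) auto
  obtain h where h[measurable]: "h \<in> borel_measurable ?Q" and RN: "AE x in ?Q. RN_deriv ?Q W x = ennreal (h x)"
    and hW: "AE x in W. 0 < h x" and h0: "\<And>x. 0 \<le> h x"
    using Q.real_RN_deriv[OF W.finite_measure_axioms ac(1,2)] by blast
  have hm[measurable]: "h \<in> borel_measurable (vspace n)" using h by simp
  have Wd: "W = density ?Q (\<lambda>x. ennreal (h x))"
  proof -
    have "W = density ?Q (RN_deriv ?Q W)" using Q.density_RN_deriv[OF ac(1,2)] by simp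
    also have "\<dots> = density ?Q (\<lambda>x. ennreal (h x))" using RN by (intro density_cong) auto
    finally show ?thesis .
  qed
  have RNW: "AE x in W. RN_deriv ?Q W x = ennreal (h x)"
    by (rule absolutely_continuous_AE[OF ac(2) ac(1) RN])
  define S where "S z = (\<Sum>i<n. (z i)\<^sup>2)" for z :: "nat \<Rightarrow> real"
  have Sm[measurable]: "S \<in> borel_measurable (vspace n)"
    unfolding S_def by (intro borel_measurable_sum borel_measurable_power vspace_component) auto
  have S0: "S z \<ge> 0" for z by (simp add: S_def sum_nonneg)
  have iS: "integrable W S" using fin S0 by (intro integrableI_nonneg) (auto simp: mW S_def[symmetric])
  define f where "f = LR n v' v (\<lambda>_. 0)"
  have fm[measurable]: "f \<in> borel_measurable (vspace n)" unfolding f_def by measurable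
  have fpos: "f z > 0" for z unfolding f_def using v by (intro LR_pos) auto
  have lnf: "ln (f z) = (1 / v - 1 / v') / 2 * S z + real n * (ln (v / v') / 2)" for z
    unfolding f_def S_def using v by (simp add: ln_LR sum.distrib sum_distrib_left sum_subtractf algebra_simps diff_divide_distrib flip: sum_divide_distrib)
  have nn: "(\<integral>\<^sup>+z. ennreal (f z / h z) \<partial>W) \<le> 1"
  proof -
    have "(\<integral>\<^sup>+z. ennreal (f z / h z) \<partial>W) = (\<integral>\<^sup>+z. ennreal (h z) * ennreal (f z / h z) \<partial>?Q)"
      by (subst Wd, subst nn_integral_density) auto
    \<comment> \<open>Only an inequality: where \<open>h\<close> vanishes, \<open>f z / h z\<close>
      is 0 while \<open>f z\<close> is positive.\<close>
    also have "\<dots> \<le> (\<integral>\<^sup>+z. ennreal (f z) \<partial>?Q)"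
    proof (intro nn_integral_mono)
      fix z
      have "h z * (f z / h z) \<le> f z" using fpos[of z] by simp
      then show "ennreal (h z) * ennreal (f z / h z) \<le> ennreal (f z)"
        using h0[of z] fpos[of z] by (simp add: ennreal_mult[symmetric] ennreal_leI)
    qed
    also have "\<dots> = 1" unfolding f_def using v by (intro nn_integral_LR_output) auto
    finally show ?thesis .
  qed
  have fh0: "0 \<le> f z / h z" for z using fpos[of z] h0[of z] by simp
  have iR: "integrable W (\<lambda>z. f z / h z)" using nn fh0 by (intro integrableI_nonneg) (auto simp: mW intro: le_less_trans)
  have eR: "(\<integral>z. f z / h z \<partial>W) \<le> 1"
  proof -
    have "ennreal (\<integral>z. f z / h z \<partial>W) \<le> 1" using nn iR fh0 by (subst nn_integral_eq_integral[symmetric]) auto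
    then show ?thesis by (simp add: ennreal_le_1)
  qed
  have "(\<integral>z. (1 / v - 1 / v') / 2 * S z + real n * (ln (v / v') / 2) - entropy_density (exp 1) ?Q W z \<partial>W) \<le> (\<integral>z. f z / h z - 1 \<partial>W)"
  proof (rule integral_mono_AE)
    show "integrable W (\<lambda>z. (1 / v - 1 / v') / 2 * S z + real n * (ln (v / v') / 2) - entropy_density (exp 1) ?Q W z)"
      using iS ac(3) by auto
    show "integrable W (\<lambda>z. f z / h z - 1)" using iR by auto
    show "AE z in W. (1 / v - 1 / v') / 2 * S z + real n * (ln (v / v') / 2) - entropy_density (exp 1) ?Q W z \<le> f z / h z - 1"
      using RNW hW
    proof eventually_elim
      case (elim z)
      have "entropy_density (exp 1) ?Q W z = ln (h z)"
        using elim by (simp add: entropy_density_def log_def)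
      moreover have "ln (f z / h z) \<le> f z / h z - 1" using fpos[of z] elim by (intro ln_le_minus_one) auto
      moreover have "ln (f z / h z) = ln (f z) - ln (h z)" using fpos[of z] elim by (simp add: ln_div)
      ultimately show ?case using lnf[of z] by simp
    qed
  qed
  also have "\<dots> \<le> 0" using iR eR by (simp add: W.prob_space)
  also have "(\<integral>z. (1 / v - 1 / v') / 2 * S z + real n * (ln (v / v') / 2) - entropy_density (exp 1) ?Q W z \<partial>W)
    = (1 / v - 1 / v') / 2 * (\<integral>z. S z \<partial>W) + real n * (ln (v / v') / 2) - KL_divergence (exp 1) ?Q W"
    using iS ac(3) by (simp add: W.prob_space KL_divergence_def)
  finally have "(1 / v - 1 / v') / 2 * (\<integral>z. S z \<partial>W) \<le> B - real n * (ln (v / v') / 2)" using KL by linarith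
  moreover have "ln (v / v') = - ln (v' / v)" using v by (simp add: ln_div)
  moreover have "a * x \<le> 2 * B + real n * l" if "a / 2 * x \<le> B - real n * (- l / 2)" for a x l :: real
    using that by (simp add: algebra_simps)
  ultimately have "(1 / v - 1 / v') * (\<integral>z. S z \<partial>W) \<le> 2 * B + real n * ln (v' / v)"
    by metis
  moreover have "1 / v - 1 / v' > 0" using v by (simp add: field_simps)
  ultimately have "(\<integral>z. S z \<partial>W) \<le> (2 * B + real n * ln (v' / v)) / (1 / v - 1 / v')"
    by (simp add: field_simps)
  then show ?thesis using iS S0 unfolding S_def[symmetric] by (subst nn_integral_eq_integral) (auto intro: ennreal_leI)
qed

section \<open>Energies of input and state under an encoder kernel\<close>

abbreviation shift_sq :: "nat \<Rightarrow> real \<Rightarrow> (nat \<Rightarrow> real) \<Rightarrow> (nat \<Rightarrow> real) \<Rightarrow> ennreal" where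
  "shift_sq n g s x \<equiv> ennreal (\<Sum>i<n. (x i + g * s i)\<^sup>2)"

definition joint_expect :: "nat \<Rightarrow> real \<Rightarrow> ((nat \<Rightarrow> real) \<Rightarrow> (nat \<Rightarrow> real) measure) \<Rightarrow>
    ((nat \<Rightarrow> real) \<Rightarrow> (nat \<Rightarrow> real) \<Rightarrow> ennreal) \<Rightarrow> ennreal" where
  "joint_expect n T K f = (\<integral>\<^sup>+s. \<integral>\<^sup>+x. f s x \<partial>K s \<partial>gauss_iid n T)"

lemma joint_expect_mono: "(\<And>s x. f s x \<le> h s x) \<Longrightarrow> joint_expect n T K f \<le> joint_expect n T K h"
  unfolding joint_expect_def by (intro nn_integral_mono)

lemma joint_expect_linear:
  assumes K: "K \<in> vspace n \<rightarrow>\<^sub>M prob_algebra (vspace n)"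
    and f: "(\<lambda>(s, x). f s x) \<in> borel_measurable (vspace n \<Otimes>\<^sub>M vspace n)"
    and h: "(\<lambda>(s, x). h s x) \<in> borel_measurable (vspace n \<Otimes>\<^sub>M vspace n)"
  shows "joint_expect n T K (\<lambda>s x. a * f s x + b * h s x) = a * joint_expect n T K f + b * joint_expect n T K h"
proof -
  note K' = measurable_prob_algebraD[OF K]
  have "joint_expect n T K (\<lambda>s x. a * f s x + b * h s x) =
    (\<integral>\<^sup>+s. a * (\<integral>\<^sup>+x. f s x \<partial>K s) + b * (\<integral>\<^sup>+x. h s x \<partial>K s) \<partial>gauss_iid n T)"
    unfolding joint_expect_def
  proof (intro nn_integral_cong)
    fix s assume "s \<in> space (gauss_iid n T)"
    then have s: "s \<in> space (vspace n)" by simp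
    then have e: "sets (K s) = sets (vspace n)" using measurable_space[OF K] by (simp add: space_prob_algebra)
    have "f s \<in> borel_measurable (K s)" "h s \<in> borel_measurable (K s)"
      unfolding measurable_cong_sets[OF e refl] using measurable_compose[OF measurable_Pair1'[OF s] f] measurable_compose[OF measurable_Pair1'[OF s] h] by auto
    then show "(\<integral>\<^sup>+x. a * f s x + b * h s x \<partial>K s) = a * (\<integral>\<^sup>+x. f s x \<partial>K s) + b * (\<integral>\<^sup>+x. h s x \<partial>K s)"
      by (simp add: nn_integral_add nn_integral_cmult)
  qed
  then show ?thesis
    using nn_integral_measurable_subprob_algebra2[OF f K'] nn_integral_measurable_subprob_algebra2[OF h K']
    by (simp add: joint_expect_def nn_integral_add nn_integral_cmult)
qed

lemma joint_expect_state:
  assumes K: "K \<in> vspace n \<rightarrow>\<^sub>M prob_algebra (vspace n)"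
  shows "joint_expect n T K (\<lambda>s x. f s) = (\<integral>\<^sup>+s. f s \<partial>gauss_iid n T)"
  unfolding joint_expect_def
proof (intro nn_integral_cong)
  fix s assume "s \<in> space (gauss_iid n T)"
  then have "prob_space (K s)" using measurable_space[OF K, of s] by (simp add: space_prob_algebra)
  from prob_space.emeasure_space_1[OF this] show "(\<integral>\<^sup>+x. f s \<partial>K s) = f s" by simp
qed

lemma nn_integral_out_dist_joint:
  assumes "enc m k \<in> vspace n \<rightarrow>\<^sub>M prob_algebra (vspace n)" "v > 0" "f \<in> borel_measurable (vspace n)"
  shows "(\<integral>\<^sup>+y. f y \<partial>out_dist n T v enc m k) = joint_expect n T (enc m k) (\<lambda>s x. \<integral>\<^sup>+y. f y \<partial>add_noise n v (\<lambda>i. x i + s i))"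
  unfolding joint_expect_def by (rule nn_integral_out_dist[where enc=enc, OF assms])

lemma square_sum_measurable: "(\<lambda>s. ennreal (\<Sum>i<n. (s i)\<^sup>2)) \<in> borel_measurable (vspace n)"
  by (intro measurable_compose[OF _ measurable_ennreal] borel_measurable_sum borel_measurable_power vspace_component) auto

lemma shift_sq_measurable: "(\<lambda>(s, x). shift_sq n g s x) \<in> borel_measurable (vspace n \<Otimes>\<^sub>M vspace n)"
  unfolding case_prod_unfold
  by (intro measurable_compose[OF _ measurable_ennreal] borel_measurable_sum borel_measurable_power borel_measurable_add borel_measurable_times
    borel_measurable_const vspace_nth[OF measurable_fst] vspace_nth[OF measurable_snd]) auto

context
  fixes n :: nat and T :: real and enc :: "nat \<Rightarrow> nat \<Rightarrow> (nat \<Rightarrow> real) \<Rightarrow> (nat \<Rightarrow> real) measure"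
  assumes T: "T > 0" and enc: "\<And>m k. enc m k \<in> vspace n \<rightarrow>\<^sub>M prob_algebra (vspace n)"
begin

private abbreviation E :: "nat \<Rightarrow> nat \<Rightarrow> ((nat \<Rightarrow> real) \<Rightarrow> (nat \<Rightarrow> real) \<Rightarrow> ennreal) \<Rightarrow> ennreal" where
  "E m k \<equiv> joint_expect n T (enc m k)"

lemma state_power: "E m k (\<lambda>s x. ennreal (\<Sum>i<n. (s i)\<^sup>2)) = ennreal (real n * T)"
  using second_moment_add_noise[OF T, of n "\<lambda>_. 0" "\<lambda>_. 0"] by (simp add: joint_expect_state[OF enc] add_noise_zero[OF T])

lemma state_sq_measurable: "(\<lambda>(s, x). ennreal (\<Sum>i<n. (s i)\<^sup>2)) \<in> borel_measurable (vspace n \<Otimes>\<^sub>M vspace n)"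
  unfolding case_prod_unfold by (rule measurable_compose[OF measurable_fst square_sum_measurable])

lemma joint_expect_const: "E m k (\<lambda>s x. c) = c"
  using prob_space.emeasure_space_1[OF prob_space_gauss_iid[OF T]] by (simp add: joint_expect_state[OF enc])

text \<open>Pointwise, \<open>(x + g s)^2 + g (1 - g) s^2 = (1 - g) x^2 + g (x + s)^2\<close>, and
  the state energy is known exactly. The correction stands on the left to avoid subtracting extended
  reals.\<close>

lemma input_moment_combination:
  assumes g: "0 \<le> g" "g \<le> 1"
  shows "E m k (shift_sq n g) + ennreal (g * (1 - g) * (real n * T))
    = ennreal (1 - g) * E m k (shift_sq n 0) + ennreal g * E m k (shift_sq n 1)"
proof -
  have "E m k (shift_sq n g) + ennreal (g * (1 - g) * (real n * T)) =
    1 * E m k (shift_sq n g) + ennreal (g * (1 - g)) * E m k (\<lambda>s x. ennreal (\<Sum>i<n. (s i)\<^sup>2))"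
    unfolding state_power using g T by (simp add: ennreal_mult[symmetric])
  also have "\<dots> = E m k (\<lambda>s x. 1 * shift_sq n g s x + ennreal (g * (1 - g)) * ennreal (\<Sum>i<n. (s i)\<^sup>2))"
    by (rule joint_expect_linear[OF enc shift_sq_measurable state_sq_measurable, symmetric])
  also have "\<dots> = E m k (\<lambda>s x. ennreal (1 - g) * shift_sq n 0 s x + ennreal g * shift_sq n 1 s x)"
  proof (intro arg_cong[where f="E m k"] ext)
    fix s x
    have "(\<Sum>i<n. (x i + g * s i)\<^sup>2 + g * (1 - g) * (s i)\<^sup>2) = (\<Sum>i<n. (1 - g) * (x i + 0 * s i)\<^sup>2 + g * (x i + 1 * s i)\<^sup>2)"
      by (intro sum.cong refl) (simp add: power2_eq_square algebra_simps)
    then have "(\<Sum>i<n. (x i + g * s i)\<^sup>2) + g * (1 - g) * (\<Sum>i<n. (s i)\<^sup>2) = (1 - g) * (\<Sum>i<n. (x i + 0 * s i)\<^sup>2) + g * (\<Sum>i<n. (x i + 1 * s i)\<^sup>2)"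
      by (simp add: sum.distrib sum_distrib_left)
    then show "1 * shift_sq n g s x + ennreal (g * (1 - g)) * ennreal (\<Sum>i<n. (s i)\<^sup>2) = ennreal (1 - g) * shift_sq n 0 s x + ennreal g * shift_sq n 1 s x"
      using g by (simp add: ennreal_mult[symmetric] ennreal_plus[symmetric] sum_nonneg del: ennreal_plus)
  qed
  also have "\<dots> = ennreal (1 - g) * E m k (shift_sq n 0) + ennreal g * E m k (shift_sq n 1)"
    by (rule joint_expect_linear[OF enc shift_sq_measurable shift_sq_measurable])
  finally show ?thesis .
qed

text \<open>Crude, from \<open>(x + s)^2 \<le> 2 x^2 + 2 s^2\<close>: it makes the warden's second
  moment finite, as \<open>warden_second_moment\<close> requires before giving the sharp
  bound.\<close>

lemma input_moment_one_le:
  "E m k (shift_sq n 1) \<le> ennreal 2 * E m k (shift_sq n 0) + ennreal (2 * (real n * T))"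
proof -
  have "E m k (shift_sq n 1) \<le> E m k (\<lambda>s x. ennreal 2 * shift_sq n 0 s x + ennreal 2 * ennreal (\<Sum>i<n. (s i)\<^sup>2))"
  proof (intro joint_expect_mono)
    fix s x :: "nat \<Rightarrow> real"
    have "(\<Sum>i<n. (x i + 1 * s i)\<^sup>2) \<le> (\<Sum>i<n. 2 * (x i + 0 * s i)\<^sup>2 + 2 * (s i)\<^sup>2)"
    proof (intro sum_mono)
      fix i show "(x i + 1 * s i)\<^sup>2 \<le> 2 * (x i + 0 * s i)\<^sup>2 + 2 * (s i)\<^sup>2"
        using zero_le_power2[of "x i - s i"] by (simp add: power2_eq_square algebra_simps)
    qed
    also have "\<dots> = 2 * (\<Sum>i<n. (x i + 0 * s i)\<^sup>2) + 2 * (\<Sum>i<n. (s i)\<^sup>2)" by (simp add: sum.distrib sum_distrib_left)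
    finally have "shift_sq n 1 s x \<le> ennreal (2 * (\<Sum>i<n. (x i + 0 * s i)\<^sup>2) + 2 * (\<Sum>i<n. (s i)\<^sup>2))" by (rule ennreal_leI)
    then show "shift_sq n 1 s x \<le> ennreal 2 * shift_sq n 0 s x + ennreal 2 * ennreal (\<Sum>i<n. (s i)\<^sup>2)"
      by (simp only: ennreal_mult[symmetric] ennreal_plus[symmetric] sum_nonneg zero_le_power2 mult_nonneg_nonneg zero_le_numeral)
  qed
  also have "\<dots> = ennreal 2 * E m k (shift_sq n 0) + ennreal 2 * ennreal (real n * T)"
    unfolding state_power[of m k, symmetric] by (rule joint_expect_linear[OF enc shift_sq_measurable state_sq_measurable])
  also have "ennreal 2 * ennreal (real n * T) = ennreal (2 * (real n * T))"
    using T by (intro ennreal_mult[symmetric]) auto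
  finally show ?thesis .
qed

lemma avg_power_eq:
  assumes n: "n \<ge> 1"
  shows "code_avg (set_size n R) (set_size n RK) (\<lambda>m k. E m k (shift_sq n 0)) = ennreal (real n) * avg_power n T R RK enc"
proof -
  have "(\<integral>\<^sup>+ s. \<integral>\<^sup>+ x. ennreal ((\<Sum>i<n. (x i)\<^sup>2) / real n) \<partial>(enc m k s) \<partial>(gauss_iid n T)) = ennreal (1 / real n) * E m k (shift_sq n 0)" for m k
  proof -
    have "E m k (\<lambda>s x. ennreal (1 / real n) * shift_sq n 0 s x + 0 * shift_sq n 0 s x) =
      ennreal (1 / real n) * E m k (shift_sq n 0) + 0 * E m k (shift_sq n 0)"
      by (rule joint_expect_linear[OF enc shift_sq_measurable shift_sq_measurable])
    then show ?thesis by (simp add: joint_expect_def ennreal_mult[symmetric] sum_nonneg)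
  qed
  then have "ennreal (real n) * avg_power n T R RK enc = ennreal (real n) * (ennreal (1 / real n) *
      code_avg (set_size n R) (set_size n RK) (\<lambda>m k. E m k (shift_sq n 0)))"
    by (simp add: avg_power_def code_avg_def sum_distrib_left[symmetric] mult.left_commute)
  then show ?thesis using n by (simp add: mult.assoc[symmetric] ennreal_mult[symmetric])
qed

lemma warden_moment_eq:
  assumes \<sigma>2: "\<sigma>2 > 0"
  shows "(\<integral>\<^sup>+z. ennreal (\<Sum>i<n. (z i)\<^sup>2) \<partial>warden_dist n T \<sigma>2 R RK enc)
    = code_avg (set_size n R) (set_size n RK) (\<lambda>m k. E m k (shift_sq n 1)) + ennreal (real n * \<sigma>2)"
proof -
  have "(\<integral>\<^sup>+z. ennreal (\<Sum>i<n. (z i)\<^sup>2) \<partial>out_dist n T \<sigma>2 enc m k) = E m k (shift_sq n 1) + ennreal (real n * \<sigma>2)" for m k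
  proof -
    have "(\<integral>\<^sup>+z. ennreal (\<Sum>i<n. (z i)\<^sup>2) \<partial>out_dist n T \<sigma>2 enc m k) = E m k (\<lambda>s x. 1 * shift_sq n 1 s x + ennreal (real n * \<sigma>2) * 1)"
      using second_moment_add_noise[OF \<sigma>2, of n _ "\<lambda>_. 0"] \<sigma>2
      by (subst nn_integral_out_dist_joint[where enc=enc, OF enc \<sigma>2 square_sum_measurable]) (simp add: sum_nonneg)
    also have "\<dots> = 1 * E m k (shift_sq n 1) + ennreal (real n * \<sigma>2) * E m k (\<lambda>s x. 1)"
      by (rule joint_expect_linear[OF enc shift_sq_measurable]) simp
    finally show ?thesis by (simp add: joint_expect_const)
  qed
  moreover have "0 \<le> real n * \<sigma>2" using \<sigma>2 by simp
  ultimately show ?thesis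
    by (simp only: nn_integral_warden_dist(1)[where enc=enc, OF enc T \<sigma>2 square_sum_measurable] code_avg_add code_avg_const set_size_pos)
qed

text \<open>The comparison law is centred at \<open>(1 - g) * s\<close>. It may depend on the state,
  as for a receiver who knows it, because the state is independent of message and key. Since it does
  not depend on the message, its probabilities of the disjoint decoding sets for one key add up to
  at most 1, and the term with \<open>M - 1\<close> averages to at most 1.\<close>

lemma oneshot_converse:
  fixes g w R RK :: real and dec :: "(nat \<Rightarrow> real) \<Rightarrow> nat \<Rightarrow> nat"
  assumes dec: "\<And>k. (\<lambda>y. dec y k) \<in> vspace n \<rightarrow>\<^sub>M count_space UNIV" and w: "w > 0"
  defines "M \<equiv> set_size n R" and "K \<equiv> set_size n RK"
  shows "ennreal (ln (real M) * (1 - err_prob n T R RK enc dec))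
    \<le> ennreal (1 + real n / 2 * (ln w + 1 / w - 1)) + ennreal (1 / (2 * w)) * code_avg M K (\<lambda>m k. E m k (shift_sq n g))"
proof -
  have MK: "M \<ge> 1" "K \<ge> 1" unfolding M_def K_def by (rule set_size_pos)+
  interpret G: prob_space "gauss_iid n T" by (rule prob_space_gauss_iid[OF T])
  define A where "A = real n / 2 * (ln w + 1 / w - 1)"
  have "ln (1 / w) \<le> 1 / w - 1" using w by (intro ln_le_minus_one) auto
  then have A0: "A \<ge> 0" using w by (simp add: A_def ln_div)
  define D where "D m k = {y \<in> space (vspace n). dec y k = m}" for m k
  have Dm[measurable]: "D m k \<in> sets (vspace n)" for m k
    unfolding D_def using dec[of k] by measurable
  define \<Phi> where "\<Phi> m k s = emeasure (add_noise n w (\<lambda>i. (1 - g) * s i)) (D m k)" for m k s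
  let ?\<Phi> = "\<lambda>m k. \<integral>\<^sup>+s. \<Phi> m k s \<partial>gauss_iid n T"
  have \<Phi>m: "\<Phi> m k \<in> borel_measurable (vspace n)" for m k
    unfolding \<Phi>_def[abs_def]
    by (intro measurable_compose[OF measurable_prob_algebraD measurable_emeasure_subprob_algebra[OF Dm]]
      add_noise_kernel w borel_measurable_times borel_measurable_const vspace_component)
  define pc where "pc m k = measure (out_dist n T 1 enc m k) (D m k)" for m k
  have one: "ennreal (ln (real M)) * ennreal (pc m k) \<le> ennreal (real M - 1) * (?\<Phi> m k)
     + ennreal A + ennreal (1 / (2 * w)) * E m k (shift_sq n g)" for m k
  proof -
    interpret O: prob_space "out_dist n T 1 enc m k" by (rule prob_space_out_dist[where enc=enc, OF enc _ T]) simp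
    have Om: "measurable (out_dist n T 1 enc m k) N = measurable (vspace n) N" for N
      by (rule measurable_cong_sets[OF prob_space_out_dist(2)[where enc=enc, OF enc _ T] refl]) simp
    have iD: "(\<lambda>y. ennreal (ln (real M)) * indicator (D m k) y) \<in> borel_measurable (vspace n)" by measurable
    have "ennreal (ln (real M)) * ennreal (pc m k) = (\<integral>\<^sup>+y. ennreal (ln (real M)) * indicator (D m k) y \<partial>out_dist n T 1 enc m k)"
      unfolding pc_def by (subst nn_integral_cmult) (auto simp: Om O.emeasure_eq_measure prob_space_out_dist(2)[where enc=enc, OF enc _ T])
    also have "\<dots> = E m k (\<lambda>s x. \<integral>\<^sup>+y. ennreal (ln (real M)) * indicator (D m k) y \<partial>add_noise n 1 (\<lambda>i. x i + s i))"
      by (rule nn_integral_out_dist_joint[where enc=enc, OF enc _ iD]) simp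
    also have "\<dots> \<le> E m k (\<lambda>s x. 1 * (ennreal (real M - 1) * \<Phi> m k s + ennreal A) + ennreal (1 / (2 * w)) * shift_sq n g s x)"
    proof (intro joint_expect_mono, goal_cases)
      case (1 s x)
      let ?N = "add_noise n 1 (\<lambda>i. x i + s i)" and ?Q = "add_noise n w (\<lambda>i. (1 - g) * s i)"
      interpret N: prob_space ?N by (rule prob_space_add_noise) simp
      interpret Q: prob_space ?Q by (rule prob_space_add_noise) (rule w)
      have mN: "measurable ?N M = measurable (vspace n) M" for M by (rule measurable_cong_sets) auto
      have "(\<integral>\<^sup>+y. ennreal (ln (real M)) * indicator (D m k) y \<partial>?N) = ennreal (measure ?N (D m k) * ln (real M))"
        using MK by (subst nn_integral_cmult) (auto simp: mN N.emeasure_eq_measure ennreal_mult[symmetric] mult.commute)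
      also have "\<dots> \<le> ennreal ((real M - 1) * measure ?Q (D m k) + A + (\<Sum>i<n. (x i + s i - (1 - g) * s i)\<^sup>2) / (2 * w))"
        unfolding A_def using MK by (intro ennreal_leI gaussian_change_of_measure w) auto
      also have "(\<Sum>i<n. (x i + s i - (1 - g) * s i)\<^sup>2) = (\<Sum>i<n. (x i + g * s i)\<^sup>2)"
        by (simp add: algebra_simps)
      also have "ennreal ((real M - 1) * measure ?Q (D m k) + A + (\<Sum>i<n. (x i + g * s i)\<^sup>2) / (2 * w)) =
          1 * (ennreal (real M - 1) * \<Phi> m k s + ennreal A) + ennreal (1 / (2 * w)) * shift_sq n g s x"
        using MK A0 w by (simp add: \<Phi>_def Q.emeasure_eq_measure ennreal_mult[symmetric] sum_nonneg flip: ennreal_plus)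
      finally show ?case .
    qed
    also have "\<dots> = 1 * E m k (\<lambda>s x. ennreal (real M - 1) * \<Phi> m k s + ennreal A) + ennreal (1 / (2 * w)) * E m k (shift_sq n g)"
    proof (rule joint_expect_linear[OF enc _ shift_sq_measurable])
      show "(\<lambda>(s, x). ennreal (real M - 1) * \<Phi> m k s + ennreal A) \<in> borel_measurable (vspace n \<Otimes>\<^sub>M vspace n)"
        unfolding case_prod_unfold
        by (intro borel_measurable_add borel_measurable_times_ennreal borel_measurable_const measurable_compose[OF measurable_fst \<Phi>m])
    qed
    finally show ?thesis
      using \<Phi>m[of m k] by (simp add: joint_expect_state[OF enc] nn_integral_add nn_integral_cmult G.emeasure_space_1[simplified])
  qed
  have \<Phi>sum: "(\<Sum>m\<in>{1..M}. ?\<Phi> m k) \<le> 1" for k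
  proof -
    have "(\<Sum>m\<in>{1..M}. ?\<Phi> m k) = (\<integral>\<^sup>+s. (\<Sum>m\<in>{1..M}. \<Phi> m k s) \<partial>gauss_iid n T)"
      using \<Phi>m by (subst nn_integral_sum) auto
    also have "\<dots> \<le> (\<integral>\<^sup>+s. 1 \<partial>gauss_iid n T)"
    proof (intro nn_integral_mono)
      fix s
      interpret Q: prob_space "add_noise n w (\<lambda>i. (1 - g) * s i)" by (rule prob_space_add_noise) (rule w)
      have "(\<Sum>m\<in>{1..M}. \<Phi> m k s) = emeasure (add_noise n w (\<lambda>i. (1 - g) * s i)) (\<Union>m\<in>{1..M}. D m k)"
        unfolding \<Phi>_def by (intro sum_emeasure) (auto simp: disjoint_family_on_def D_def Dm[unfolded D_def])
      also have "\<dots> \<le> 1" by (rule Q.emeasure_le_1)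
      finally show "(\<Sum>m\<in>{1..M}. \<Phi> m k s) \<le> 1" .
    qed
    finally show ?thesis by (simp add: G.emeasure_space_1[simplified])
  qed
  have first: "code_avg M K (\<lambda>m k. ennreal (real M - 1) * (?\<Phi> m k)) \<le> 1"
  proof -
    have "(\<Sum>m\<in>{1..M}. \<Sum>k\<in>{1..K}. ?\<Phi> m k) = (\<Sum>k\<in>{1..K}. \<Sum>m\<in>{1..M}. ?\<Phi> m k)"
      by (rule sum.swap)
    also have "\<dots> \<le> (\<Sum>k\<in>{1..K}. 1)" by (intro sum_mono \<Phi>sum)
    also have "\<dots> = ennreal (real K)" by (simp add: ennreal_of_nat_eq_real_of_nat)
    finally have "code_avg M K (\<lambda>m k. ennreal (real M - 1) * (?\<Phi> m k)) \<le> ennreal (real M - 1) * (ennreal (1 / (real M * real K)) * ennreal (real K))"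
      unfolding code_avg_cmult unfolding code_avg_def by (intro mult_left_mono) auto
    also have "\<dots> = ennreal ((real M - 1) * (1 / (real M * real K) * real K))"
      using MK by (simp add: ennreal_mult[symmetric])
    also have "\<dots> \<le> 1" using MK by (subst ennreal_le_1) (simp add: field_simps)
    finally show ?thesis .
  qed
  have pcD: "measure (out_dist n T 1 enc m k) {y \<in> space (vspace n). dec y k \<noteq> m} = 1 - pc m k" for m k
  proof -
    interpret O: prob_space "out_dist n T 1 enc m k" by (rule prob_space_out_dist[where enc=enc, OF enc _ T]) simp
    have s: "sets (out_dist n T 1 enc m k) = sets (vspace n)" by (rule prob_space_out_dist(2)[where enc=enc, OF enc _ T]) simp
    have "{y \<in> space (vspace n). dec y k \<noteq> m} = space (out_dist n T 1 enc m k) - D m k"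
      using sets_eq_imp_space_eq[OF s] by (auto simp: D_def)
    then show ?thesis unfolding pc_def using Dm by (simp add: O.prob_compl s)
  qed
  have "1 - err_prob n T R RK enc dec = 1 / (real M * real K) * (\<Sum>m\<in>{1..M}. \<Sum>k\<in>{1..K}. pc m k)"
    using MK unfolding err_prob_def pcD M_def[symmetric] K_def[symmetric] by (simp add: sum_subtractf field_simps)
  then have "ennreal (1 - err_prob n T R RK enc dec) = code_avg M K (\<lambda>m k. ennreal (pc m k))"
    unfolding code_avg_def by (simp add: pc_def sum_ennreal sum_nonneg ennreal_mult[symmetric])
  then have "ennreal (ln (real M) * (1 - err_prob n T R RK enc dec)) = code_avg M K (\<lambda>m k. ennreal (ln (real M)) * ennreal (pc m k))"
    using MK by (subst ennreal_mult') (simp_all add: code_avg_cmult)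
  also have "\<dots> \<le> code_avg M K (\<lambda>m k. ennreal (real M - 1) * (?\<Phi> m k)
     + ennreal A + ennreal (1 / (2 * w)) * E m k (shift_sq n g))"
    by (intro code_avg_mono one)
  also have "\<dots> = code_avg M K (\<lambda>m k. ennreal (real M - 1) * (?\<Phi> m k)) + ennreal A + ennreal (1 / (2 * w)) * code_avg M K (\<lambda>m k. E m k (shift_sq n g))"
    using MK A0 by (simp only: code_avg_add code_avg_const code_avg_cmult[where f="\<lambda>m k. E m k (shift_sq n g)"])
  also have "\<dots> \<le> 1 + ennreal A + ennreal (1 / (2 * w)) * code_avg M K (\<lambda>m k. E m k (shift_sq n g))"
    by (intro add_right_mono first)
  also have "1 + ennreal A = ennreal (1 + A)" using A0 by simp
  finally show ?thesis by (simp add: A_def)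
qed

end

text \<open>The weight \<open>g\<close> is the \<gamma> of the coding scheme: by \<open>opt\<close>
  it makes the bound on the energy per letter of \<open>X + g * S\<close> equal to
  \<open>Ps\<close>, up to vanishing terms, and the comparison variance \<open>1 + Ps\<close> then
  yields the capacity formula.\<close>

lemma nc_converse:
  fixes T \<sigma>2 P RK R :: real
  assumes T: "T > 0" and \<sigma>2: "\<sigma>2 > 0" and P: "P > 0" and ach: "nc_achievable T \<sigma>2 P RK R"
  defines "g \<equiv> min 1 (P / (2 * T))"
  defines "Ps \<equiv> T - (1 - g)\<^sup>2 * T"
  shows "R \<le> 1/2 * log 2 (1 + Ps)"
proof -
  obtain enc dec where nc: "\<And>n. nc_code n (enc n) (dec n)" and pw: "limsup (\<lambda>n. avg_power n T R RK (enc n)) \<le> ennreal P"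
    and er: "(\<lambda>n. err_prob n T R RK (enc n) (dec n)) \<longlonglongrightarrow> 0"
    and re: "(\<lambda>n. rel_entropy (warden_dist n T \<sigma>2 R RK (enc n)) (gauss_iid n (T + \<sigma>2))) \<longlonglongrightarrow> 0"
    using ach unfolding nc_achievable_def by blast
  let ?err = "\<lambda>n. err_prob n T R RK (enc n) (dec n)"
  have encm: "enc n m k \<in> vspace n \<rightarrow>\<^sub>M prob_algebra (vspace n)" for n m k using nc[of n] by (auto simp: nc_code_def)
  have decm: "(\<lambda>y. dec n y k) \<in> vspace n \<rightarrow>\<^sub>M count_space UNIV" for n k using nc[of n] by (auto simp: nc_code_def)
  have g: "0 < g" "g \<le> 1" using T P by (auto simp: g_def)
  have "(1 - g)\<^sup>2 < 1" using g by (simp add: abs_square_less_1)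
  then have Ps: "Ps > 0" using T by (simp add: Ps_def)
  define w where "w = 1 + Ps"
  have w: "w > 0" using Ps by (simp add: w_def)
  \<comment> \<open>If \<open>g < 1\<close>, then \<open>P = 2 * g * T\<close>; if
    \<open>g = 1\<close>, the power constraint has weight 0 and the covertness bound
    \<open>T\<close> alone gives \<open>Ps\<close>.\<close>
  have opt: "(1 - g) * P + g * T - g * (1 - g) * T = Ps"
  proof (cases "P / (2 * T) < 1")
    case True
    then have "P = 2 * g * T" using T by (simp add: g_def)
    then show ?thesis by (simp add: Ps_def power2_eq_square algebra_simps)
  next
    case False
    then have "g = 1" by (simp add: g_def)
    then show ?thesis by (simp add: Ps_def)
  qed
  have main: "R * ln 2 \<le> ln w / 2 + \<epsilon>" if \<epsilon>: "\<epsilon> > 0" for \<epsilon>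
  proof (cases "R \<le> 0")
    case True
    then have "R * ln 2 \<le> 0" by (simp add: mult_nonpos_nonneg)
    moreover have "ln w \<ge> 0" using Ps by (simp add: w_def)
    ultimately show ?thesis using \<epsilon> by linarith
  next
    case False
    define v where "v = T + \<sigma>2"
    have v: "v > 0" using T \<sigma>2 by (simp add: v_def)
    define \<kappa> where "\<kappa> = 1 / v - 1 / (v + \<epsilon>)"
    have \<kappa>: "\<kappa> > 0" using v \<epsilon> by (simp add: \<kappa>_def frac_less2)
    have "eventually (\<lambda>n. avg_power n T R RK (enc n) < ennreal (P + \<epsilon>)) sequentially"
      using pw P \<epsilon> by (intro Limsup_lessD) (auto intro: le_less_trans simp: ennreal_less_iff simp del: ennreal_plus)
    \<comment> \<open>The bound 1 adds the constant \<open>2 / \<kappa>\<close> to the energy of the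
      block, which vanishes per letter.\<close>
    moreover have "eventually (\<lambda>n. rel_entropy (warden_dist n T \<sigma>2 R RK (enc n)) (gauss_iid n (T + \<sigma>2)) < 1) sequentially"
      using re by (rule order_tendstoD) simp
    moreover have "eventually (\<lambda>n. ?err n < 1) sequentially"
      using er by (rule order_tendstoD) simp
    ultimately have "eventually (\<lambda>n. R * ln 2 * (1 - ?err n) \<le> (1 + 1 / (\<kappa> * w)) * (1 / real n) + (ln w / 2 + \<epsilon> / (2 * w))) sequentially"
      using eventually_ge_at_top[of 1]
    proof eventually_elim
      case (elim n)
      let ?av = "code_avg (set_size n R) (set_size n RK)"
      let ?p = "\<lambda>m k. joint_expect n T (enc n m k) (shift_sq n 0)" and ?q = "\<lambda>m k. joint_expect n T (enc n m k) (shift_sq n 1)"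
        and ?x = "\<lambda>m k. joint_expect n T (enc n m k) (shift_sq n g)"
      note n = elim(4)
      have p: "?av ?p \<le> ennreal (real n * (P + \<epsilon>))"
      proof -
        have "?av ?p = ennreal (real n) * avg_power n T R RK (enc n)"
          by (rule avg_power_eq[OF T encm n])
        also have "\<dots> \<le> ennreal (real n) * ennreal (P + \<epsilon>)" using elim(1) by (intro mult_left_mono) auto
        also have "\<dots> = ennreal (real n * (P + \<epsilon>))" using P \<epsilon> by (intro ennreal_mult[symmetric]) auto
        finally show ?thesis .
      qed
      have "?av ?q \<le> ?av (\<lambda>m k. ennreal 2 * ?p m k + ennreal (2 * (real n * T)))"
        by (intro code_avg_mono input_moment_one_le T encm)
      also have "\<dots> = ennreal 2 * ?av ?p + ennreal (2 * (real n * T))"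
        using T by (simp only: code_avg_add code_avg_cmult[where f="?p"] code_avg_const set_size_pos mult_nonneg_nonneg of_nat_0_le_iff zero_le_numeral less_imp_le[OF T])
      also have "\<dots> < \<infinity>" using p by (auto simp: ennreal_mult_less_top intro: le_less_trans)
      finally have qfin: "?av ?q < \<infinity>" .
      have W: "(\<integral>\<^sup>+z. ennreal (\<Sum>i<n. (z i)\<^sup>2) \<partial>warden_dist n T \<sigma>2 R RK (enc n)) = ?av ?q + ennreal (real n * \<sigma>2)"
        by (rule warden_moment_eq[OF T encm \<sigma>2])
      \<comment> \<open>The test variance \<open>v + \<epsilon>\<close> allows the energy per letter
        to exceed \<open>v\<close> by \<epsilon>, up to the constant.\<close>
      have "(\<integral>\<^sup>+z. ennreal (\<Sum>i<n. (z i)\<^sup>2) \<partial>warden_dist n T \<sigma>2 R RK (enc n)) \<le> ennreal ((2 * 1 + real n * ln ((v + \<epsilon>) / v)) / (1 / v - 1 / (v + \<epsilon>)))"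
      proof (rule warden_second_moment)
        show "prob_space (warden_dist n T \<sigma>2 R RK (enc n))"
          by (rule nn_integral_warden_dist(2)[OF encm T \<sigma>2])
        show "(\<integral>\<^sup>+z. ennreal (\<Sum>i<n. (z i)\<^sup>2) \<partial>warden_dist n T \<sigma>2 R RK (enc n)) < \<infinity>"
          unfolding W using qfin by simp
        show "rel_entropy (warden_dist n T \<sigma>2 R RK (enc n)) (gauss_iid n v) \<le> ereal 1"
          using elim(2) by (simp add: v_def one_ereal_def less_imp_le)
      qed (use v \<epsilon> in auto)
      also have "(2 * 1 + real n * ln ((v + \<epsilon>) / v)) / (1 / v - 1 / (v + \<epsilon>)) \<le> 2 / \<kappa> + real n * (v + \<epsilon>)"
      proof -
        have "ln ((v + \<epsilon>) / v) \<le> (v + \<epsilon>) / v - 1" using v \<epsilon> by (intro ln_le_minus_one) auto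
        also have "\<dots> = (v + \<epsilon>) * \<kappa>" using v \<epsilon> by (simp add: \<kappa>_def right_diff_distrib)
        finally have "real n * ln ((v + \<epsilon>) / v) \<le> real n * ((v + \<epsilon>) * \<kappa>)" by (rule mult_left_mono) simp
        then have "(2 * 1 + real n * ln ((v + \<epsilon>) / v)) / \<kappa> \<le> (2 + real n * ((v + \<epsilon>) * \<kappa>)) / \<kappa>"
          using \<kappa> by (intro divide_right_mono) auto
        also have "\<dots> = 2 / \<kappa> + real n * (v + \<epsilon>)" using \<kappa> by (simp add: add_divide_distrib)
        finally show ?thesis by (simp add: \<kappa>_def)
      qed
      finally have "?av ?q + ennreal (real n * \<sigma>2) \<le> ennreal (2 / \<kappa> + real n * (v + \<epsilon>))"
        unfolding W by (simp add: ennreal_leI)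
      also have "2 / \<kappa> + real n * (v + \<epsilon>) = (2 / \<kappa> + real n * (T + \<epsilon>)) + real n * \<sigma>2" by (simp add: v_def algebra_simps)
      also have "ennreal \<dots> = ennreal (2 / \<kappa> + real n * (T + \<epsilon>)) + ennreal (real n * \<sigma>2)"
        using \<kappa> T \<epsilon> \<sigma>2 by (intro ennreal_plus) auto
      finally have q: "?av ?q \<le> ennreal (2 / \<kappa> + real n * (T + \<epsilon>))"
        by simp
      have "?av ?x + ennreal (g * (1 - g) * (real n * T)) = ?av (\<lambda>m k. ?x m k + ennreal (g * (1 - g) * (real n * T)))"
      proof -
        have "0 \<le> g * (1 - g) * (real n * T)" using g T by simp
        then show ?thesis by (simp only: code_avg_add code_avg_const set_size_pos)
      qed
      also have "\<dots> = ?av (\<lambda>m k. ennreal (1 - g) * ?p m k + ennreal g * ?q m k)"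
        by (subst input_moment_combination[OF T encm less_imp_le[OF g(1)] g(2)]) (rule refl)
      also have "\<dots> = ennreal (1 - g) * ?av ?p + ennreal g * ?av ?q"
        by (simp only: code_avg_add code_avg_cmult)
      also have "\<dots> \<le> ennreal (1 - g) * ennreal (real n * (P + \<epsilon>)) + ennreal g * ennreal (2 / \<kappa> + real n * (T + \<epsilon>))"
        by (intro add_mono mult_left_mono p q) auto
      also have "\<dots> = ennreal ((1 - g) * (real n * (P + \<epsilon>)) + g * (2 / \<kappa> + real n * (T + \<epsilon>)))"
        using g P T \<epsilon> \<kappa> by (simp add: ennreal_mult[symmetric] ennreal_plus[symmetric] del: ennreal_plus)
      also have "\<dots> \<le> ennreal ((real n * (Ps + \<epsilon>) + 2 / \<kappa>) + g * (1 - g) * (real n * T))"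
      proof (rule ennreal_leI)
        have "(1 - g) * (real n * (P + \<epsilon>)) + g * (2 / \<kappa> + real n * (T + \<epsilon>)) = real n * ((1 - g) * P + g * T - g * (1 - g) * T + \<epsilon>) + g * (2 / \<kappa>) + g * (1 - g) * (real n * T)"
          by (simp add: algebra_simps)
        moreover have "g * (2 / \<kappa>) \<le> 2 / \<kappa>" using g \<kappa> by (intro mult_left_le_one_le) auto
        ultimately show "(1 - g) * (real n * (P + \<epsilon>)) + g * (2 / \<kappa> + real n * (T + \<epsilon>)) \<le> (real n * (Ps + \<epsilon>) + 2 / \<kappa>) + g * (1 - g) * (real n * T)"
          unfolding opt by linarith
      qed
      also have "\<dots> = ennreal (real n * (Ps + \<epsilon>) + 2 / \<kappa>) + ennreal (g * (1 - g) * (real n * T))"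
        using Ps \<epsilon> \<kappa> g T by (intro ennreal_plus) auto
      finally have E: "?av ?x \<le> ennreal (real n * (Ps + \<epsilon>) + 2 / \<kappa>)"
        by simp
      have A0: "0 \<le> ln w + 1 / w - 1"
      proof -
        have "ln (1 / w) \<le> 1 / w - 1" using w by (intro ln_le_minus_one) auto
        then show ?thesis using w by (simp add: ln_div)
      qed
      have "ennreal (ln (real (set_size n R)) * (1 - ?err n))
        \<le> ennreal (1 + real n / 2 * (ln w + 1 / w - 1)) + ennreal (1 / (2 * w)) * ?av ?x"
        by (rule oneshot_converse[OF T encm decm w])
      also have "\<dots> \<le> ennreal (1 + real n / 2 * (ln w + 1 / w - 1)) + ennreal (1 / (2 * w)) * ennreal (real n * (Ps + \<epsilon>) + 2 / \<kappa>)"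
        by (intro add_left_mono mult_left_mono E) simp
      also have "\<dots> = ennreal (1 + real n / 2 * (ln w + 1 / w - 1) + 1 / (2 * w) * (real n * (Ps + \<epsilon>) + 2 / \<kappa>))"
        using w Ps \<epsilon> \<kappa> A0 by (simp add: ennreal_mult[symmetric] ennreal_plus[symmetric] del: ennreal_plus)
      finally have "ln (real (set_size n R)) * (1 - ?err n) \<le> 1 + real n / 2 * (ln w + 1 / w - 1) + 1 / (2 * w) * (real n * (Ps + \<epsilon>) + 2 / \<kappa>)"
        using w Ps \<epsilon> \<kappa> A0 by (subst (asm) ennreal_le_iff) auto
      \<comment> \<open>With \<open>w = 1 + Ps\<close> the terms \<open>1 / w - 1\<close> and
        \<open>Ps / w\<close> cancel, leaving \<open>ln w / 2\<close> per letter.\<close>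
      also have "\<dots> = real n * (ln w / 2 + \<epsilon> / (2 * w)) + (1 + 1 / (\<kappa> * w))"
      proof -
        have Psw: "Ps = w - 1" by (simp add: w_def)
        show ?thesis unfolding Psw using w \<kappa> by (simp add: field_simps)
      qed
      finally have 1: "ln (real (set_size n R)) * (1 - ?err n) \<le> real n * (ln w / 2 + \<epsilon> / (2 * w)) + (1 + 1 / (\<kappa> * w))" .
      have "real n * (R * ln 2) \<le> ln (real (set_size n R))"
      proof -
        have "ln (2 powr (real n * R)) \<le> ln (real (set_size n R))"
          using set_size_ge[of n R] set_size_pos[of n R] by (subst ln_le_cancel_iff) auto
        then show ?thesis by (simp add: ln_powr)
      qed
      then have le: "real n * (R * ln 2) * (1 - ?err n) \<le> ln (real (set_size n R)) * (1 - ?err n)"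
        using elim(3) by (intro mult_right_mono) auto
      have "real n * (R * ln 2 * (1 - ?err n)) \<le> real n * ((1 + 1 / (\<kappa> * w)) * (1 / real n) + (ln w / 2 + \<epsilon> / (2 * w)))"
      proof -
        have "real n * (c * (1 / real n) + d) = real n * d + c" for c d using n by (simp add: distrib_left)
        then show ?thesis using 1 le by (simp only: mult.assoc)
      qed
      then show ?case using n by (simp only: mult_le_cancel_left_pos of_nat_0_less_iff)
    qed
    moreover have "(\<lambda>n. R * ln 2 * (1 - ?err n)) \<longlonglongrightarrow> R * ln 2 * (1 - 0)"
      by (intro tendsto_intros er)
    moreover have "(\<lambda>n. (1 + 1 / (\<kappa> * w)) * (1 / real n) + (ln w / 2 + \<epsilon> / (2 * w))) \<longlonglongrightarrow> (1 + 1 / (\<kappa> * w)) * 0 + (ln w / 2 + \<epsilon> / (2 * w))"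
      by (intro tendsto_intros lim_1_over_n)
    ultimately have "R * ln 2 * (1 - 0) \<le> (1 + 1 / (\<kappa> * w)) * 0 + (ln w / 2 + \<epsilon> / (2 * w))"
      by (intro tendsto_le[OF trivial_limit_sequentially])
    moreover have "\<epsilon> / (2 * w) \<le> \<epsilon>" using w Ps \<epsilon> by (simp add: w_def field_simps)
    ultimately show ?thesis by simp
  qed
  then have "R * ln 2 \<le> ln w / 2" by (rule field_le_epsilon)
  then show ?thesis by (simp add: w_def log_def field_simps)
qed

theorem theorem6:
  fixes T \<sigma>2 P RK :: real
  assumes "T > 0" and "\<sigma>2 > 0" and "P > 0"
  defines "\<gamma> \<equiv> min 1 (P / (2 * T))"
  defines "Ts \<equiv> (1 - \<gamma>)\<^sup>2 * T"
  defines "Ps \<equiv> T - Ts"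
  defines "\<alpha> \<equiv> Ps / (Ps + 1)"
  assumes "RK > 1/2 * log 2 (1 + (Ps + \<alpha> * Ts)\<^sup>2 /
                 ((Ps + \<alpha>\<^sup>2 * Ts) * (Ps + Ts + \<sigma>2) - (Ps + \<alpha> * Ts)\<^sup>2))
             - 1/2 * log 2 (1 + (Ps + \<alpha> * Ts)\<^sup>2 /
                 ((Ps + \<alpha>\<^sup>2 * Ts) * (Ps + Ts + 1) - (Ps + \<alpha> * Ts)\<^sup>2))"
  shows "covert_capacity_nc T \<sigma>2 P RK = ereal (1/2 * log 2 (1 + Ps))"
proof -
  have \<gamma>: "0 < \<gamma>" "\<gamma> \<le> 1" using assms(1,3) by (auto simp: \<gamma>_def)
  have "(1 - \<gamma>)\<^sup>2 < 1" using \<gamma> by (simp add: abs_square_less_1)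
  then have Ps: "Ps > 0" using assms(1) by (simp add: Ps_def Ts_def)
  have upper: "covert_capacity_nc T \<sigma>2 P RK \<le> ereal (1/2 * log 2 (1 + Ps))"
    unfolding covert_capacity_nc_def
    using nc_converse[OF assms(1-3)] by (intro SUP_least) (auto simp: Ps_def Ts_def \<gamma>_def)
  \<comment> \<open>Achievability is shown for rates strictly below the limit, so the supremum is
    approached from below.\<close>
  have "ereal (1/2 * log 2 (1 + Ps)) \<le> covert_capacity_nc T \<sigma>2 P RK"
  proof (rule dense_le)
    fix y assume y: "y < ereal (1/2 * log 2 (1 + Ps))"
    define C where "C = 1/2 * log 2 (1 + Ps)"
    have C: "C > 0" using Ps by (simp add: C_def)
    obtain R where R: "y \<le> ereal R" "0 < R" "R < C"
    proof -
      \<comment> \<open>\<open>achievable_below_capacity\<close> needs a positive rate, hence the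
        maximum with 0.\<close>
      have "max y 0 < ereal C" using y C by (simp add: C_def)
      then obtain z where "max y 0 < ereal z" "ereal z < ereal C" using ereal_dense2 by blast
      then show thesis using that[of z] by (auto simp: less_imp_le)
    qed
    have "nc_achievable T \<sigma>2 P RK R"
      using assms(8) R(2,3) unfolding C_def Ps_def Ts_def \<alpha>_def \<gamma>_def
      by (intro achievable_below_capacity[OF assms(1-3)]) (auto simp: info_term_def)
    then have "ereal R \<le> covert_capacity_nc T \<sigma>2 P RK"
      unfolding covert_capacity_nc_def by (intro SUP_upper) simp
    with R(1) show "y \<le> covert_capacity_nc T \<sigma>2 P RK" by (rule order.trans)
  qed
  with upper show ?thesis by (rule antisym)
qed

end
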